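(* Let $n\ge 2$ be an integer, $\mu>0$, $\beta>2$ and $1<p<p_S(n)$. Let $f\in H^1(\mathbf{R}^n)$ and $g\in L^2(\mathbf{R}^n)$ both be non-negative and not vanish identically, with $\mathrm{supp}\, f,\ \mathrm{supp}\, g\subset\{x:|x|\le 1\}$. Then there exist a constant $\varepsilon_0=\varepsilon_0(f,g,n,p,\mu,\beta)>0$ and a constant $C>0$ independent of $\varepsilon$ such that the following holds. For every $0<\varepsilon\le\varepsilon_0$, if $u$ is an energy solution on $[0,T)$ of $$u_{tt}-\Delta u+\frac{\mu}{(1+|x|)^\beta}u_t=|u|^p,\qquad u(0,x)=\varepsilon f(x),\quad u_t(0,x)=\varepsilon g(x),$$ satisfying $$\mathrm{supp}\, u\subset\{(x,t)\in\mathbf{R}^n\times[0,T):|x|\le t+1\},$$ then $$T\le\begin{cases} C\varepsilon^{-\frac{2(p-1)}{n+1-(n-1)p}} & \text{if } 1<p\le\frac{n}{n-1},\\[2pt] C\varepsilon^{-2p(p-1)/\gamma(p,n)} & \text{if } \frac{n}{n-1}<p<p_S(n).\end{cases}$$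
   Context: Define $\gamma(p,n):=2+(n+1)p-(n-1)p^2$. For $n\ge2$, the Strauss exponent $p_S(n)$ is the positive root $p$ of $\gamma(p,n)=0$, i.e. $p_S(n)=\frac{n+1+\sqrt{n^2+10n-7}}{2(n-1)}$. Energy solution: $u$ is an energy solution on $[0,T)$ of the Cauchy problem $u_{tt}-\Delta u+\frac{\mu}{(1+|x|)^\beta}u_t=|u|^p$ in $[0,T)\times\mathbf{R}^n$, $u(0,x)=\varepsilon f(x)$, $u_t(0,x)=\varepsilon g(x)$, if $$u\in C([0,T),H^1(\mathbf{R}^n))\cap C^1([0,T),L^2(\mathbf{R}^n))\cap L^p_{\rm loc}(\mathbf{R}^n\times(0,T))$$ satisfies $u(0,x)=\varepsilon f(x)$, $u_t(0,x)=\varepsilon g(x)$ and $$\varepsilon\int_{\mathbf{R}^n}g(x)\Psi(0,x)\,dx+\varepsilon\int_{\mathbf{R}^n}\frac{\mu}{(1+|x|)^\beta}f(x)\Psi(0,x)\,dx+\int_0^T\!\int_{\mathbf{R}^n}|u|^p\Psi\,dx\,dt$$ $$=-\int_0^T\!\int_{\mathbf{R}^n}u_t\Psi_t\,dx\,dt+\int_0^T\!\int_{\mathbf{R}^n}\nabla u\cdot\nabla\Psi\,dx\,dt-\int_0^T\!\int_{\mathbf{R}^n}\frac{\mu}{(1+|x|)^\beta}u\,\Psi_t\,dx\,dt$$ for every $\Psi\in C_0^\infty([0,T)\times\mathbf{R}^n)$ (all integrals being understood as convergent). *)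

theory Defs
  imports "HOL-Analysis.Analysis"
begin

section \<open>The Strauss exponent\<close>

definition strauss_poly :: "real \<Rightarrow> nat \<Rightarrow> real" where
  "strauss_poly p n = 2 + (real n + 1) * p - (real n - 1) * p\<^sup>2"

definition strauss_exponent :: "nat \<Rightarrow> real" where
  "strauss_exponent n = (THE p. 0 < p \<and> strauss_poly p n = 0)"

lemma strauss_exponent_eq:
  assumes "2 \<le> n"
  shows "strauss_exponent n
    = (real n + 1 + sqrt ((real n)\<^sup>2 + 10 * real n - 7)) / (2 * (real n - 1))"
proof -
  define a where "a = real n - 1"
  define s where "s = sqrt ((real n)\<^sup>2 + 10 * real n - 7)"
  define r where "r = (a + 2 + s) / (2 * a)"
  have a: "a \<ge> 1" using assms by (simp add: a_def)
  have disc: "(real n)\<^sup>2 + 10 * real n - 7 = (a + 2)\<^sup>2 + 8 * a"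
    by (simp add: a_def power2_eq_square algebra_simps)
  have s2: "s\<^sup>2 = (a + 2)\<^sup>2 + 8 * a" and "s \<ge> 0"
    using a unfolding s_def disc by simp_all
  have s_gt: "s > a + 2"
    by (rule power2_less_imp_less) (use s2 a \<open>s \<ge> 0\<close> in auto)
  have fac: "4 * a * strauss_poly p n = (s - (2 * a * p - (a + 2))) * (s + (2 * a * p - (a + 2)))"
    for p
  proof -
    have "(s - (2 * a * p - (a + 2))) * (s + (2 * a * p - (a + 2)))
        = s\<^sup>2 - (2 * a * p - (a + 2))\<^sup>2"
      by (simp add: power2_eq_square algebra_simps)
    also have "\<dots> = 4 * a * strauss_poly p n"
      unfolding s2 strauss_poly_def by (simp add: a_def power2_eq_square algebra_simps)
    finally show ?thesis by simp
  qed
  have "strauss_exponent n = r"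
    unfolding strauss_exponent_def
  proof (rule the_equality)
    have "2 * a * r = a + 2 + s" using a by (simp add: r_def)
    then have "4 * a * strauss_poly r n = 0" unfolding fac by simp
    moreover have "0 < r" unfolding r_def using a s_gt by (intro divide_pos_pos) auto
    ultimately show "0 < r \<and> strauss_poly r n = 0" using a by simp
  next
    fix p assume p: "0 < p \<and> strauss_poly p n = 0"
    have "0 < 2 * a * p" using p a by simp
    then have "s + (2 * a * p - (a + 2)) > 0" using s_gt by linarith
    then have "2 * a * p = a + 2 + s" using fac[of p] p by simp
    then show "p = r" using a by (simp add: r_def field_simps)
  qed
  then show ?thesis by (simp add: r_def s_def a_def)
qed


section \<open>Smooth compactly supported functions\<close>

text \<open>
  Derivatives are taken within \<open>S\<close>, so that \<open>S\<close> may contain part of its boundary.  The sets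
  used here are \<open>UNIV\<close> and \<open>[0,T) \<times> UNIV\<close>, for which derivatives within the set are unique; on the
  latter, smoothness is smoothness up to and including \<open>t = 0\<close>.  In finite dimension, \<open>f\<close> is of
  class \<open>C\<^sup>k\<^sup>+\<^sup>1\<close> iff it is differentiable with all directional derivatives of class \<open>C\<^sup>k\<close>.
\<close>

primrec Ck_on :: "nat \<Rightarrow> 'a::euclidean_space set \<Rightarrow> ('a \<Rightarrow> 'b::real_normed_vector) \<Rightarrow> bool" where
  "Ck_on 0 S f \<longleftrightarrow> continuous_on S f"
| "Ck_on (Suc k) S f \<longleftrightarrow>
     (\<exists>f'. (\<forall>z\<in>S. (f has_derivative f' z) (at z within S)) \<and> (\<forall>v. Ck_on k S (\<lambda>z. f' z v)))"

definition test_functions :: "'a::euclidean_space set \<Rightarrow> ('a \<Rightarrow> real) set" where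
  "test_functions S =
     {\<phi>. (\<forall>k. Ck_on k S \<phi>) \<and> (\<exists>K. compact K \<and> K \<subseteq> S \<and> (\<forall>z\<in>S - K. \<phi> z = 0))}"

definition grad :: "('a::euclidean_space \<Rightarrow> real) \<Rightarrow> 'a \<Rightarrow> 'a" where
  "grad \<phi> x = (THE D. GDERIV \<phi> x :> D)"


section \<open>Lebesgue and Sobolev spaces\<close>

text \<open>
  Elements of \<open>L\<^sup>2\<close> and \<open>H\<^sup>1\<close> are represented by functions; all notions below are invariant under
  changing a representative on a null set.
\<close>

definition L2 :: "('a::euclidean_space \<Rightarrow> 'b::euclidean_space) set" where
  "L2 = {w. w \<in> borel_measurable lebesgue \<and> integrable lebesgue (\<lambda>x. (norm (w x))\<^sup>2)}"

definition L2_norm :: "('a::euclidean_space \<Rightarrow> 'b::euclidean_space) \<Rightarrow> real" where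
  "L2_norm w = sqrt (LINT x|lebesgue. (norm (w x))\<^sup>2)"

definition has_weak_L2_grad ::
  "('a::euclidean_space \<Rightarrow> real) \<Rightarrow> ('a \<Rightarrow> 'a) \<Rightarrow> bool" where
  "has_weak_L2_grad w G \<longleftrightarrow> G \<in> L2 \<and>
     (\<forall>\<phi>\<in>test_functions UNIV.
        (LINT x|lebesgue. w x *\<^sub>R grad \<phi> x) = - (LINT x|lebesgue. \<phi> x *\<^sub>R G x))"

definition H1 :: "('a::euclidean_space \<Rightarrow> real) set" where
  "H1 = {w. w \<in> L2 \<and> (\<exists>G. has_weak_L2_grad w G)}"

text \<open>For \<open>w \<in> H1\<close> the weak gradient is unique up to null sets; any representative is chosen.\<close>

definition weak_grad :: "('a::euclidean_space \<Rightarrow> real) \<Rightarrow> 'a \<Rightarrow> 'a" where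
  "weak_grad w = (SOME G. has_weak_L2_grad w G)"

definition H1_norm :: "('a::euclidean_space \<Rightarrow> real) \<Rightarrow> real" where
  "H1_norm w = sqrt ((L2_norm w)\<^sup>2 + (L2_norm (weak_grad w))\<^sup>2)"

definition Lp_loc :: "real \<Rightarrow> 'a::euclidean_space set \<Rightarrow> ('a \<Rightarrow> real) set" where
  "Lp_loc p S = {w. set_borel_measurable lebesgue S w \<and>
     (\<forall>K. compact K \<and> K \<subseteq> S \<longrightarrow> set_integrable lebesgue K (\<lambda>z. \<bar>w z\<bar> powr p))}"

text \<open>
  Support of (the almost-everywhere class of) \<open>w\<close>, as a function on \<open>S\<close>: the points of \<open>S\<close> without
  any neighbourhood on which \<open>w\<close> vanishes almost everywhere.
\<close>

definition support_in :: "'a::euclidean_space set \<Rightarrow> ('a \<Rightarrow> real) \<Rightarrow> 'a set" where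
  "support_in S w =
     {z\<in>S. \<not> (\<exists>U. open U \<and> z \<in> U \<and> (AE y in lebesgue. y \<in> S \<inter> U \<longrightarrow> w y = 0))}"


section \<open>Curves in \<open>L\<^sup>2\<close> and \<open>H\<^sup>1\<close>\<close>

definition L2_continuous_on ::
  "real set \<Rightarrow> (real \<Rightarrow> 'a::euclidean_space \<Rightarrow> real) \<Rightarrow> bool" where
  "L2_continuous_on I w \<longleftrightarrow> (\<forall>t\<in>I. w t \<in> L2 \<and>
     ((\<lambda>s. L2_norm (\<lambda>x. w s x - w t x)) \<longlongrightarrow> 0) (at t within I))"

definition H1_continuous_on ::
  "real set \<Rightarrow> (real \<Rightarrow> 'a::euclidean_space \<Rightarrow> real) \<Rightarrow> bool" where
  "H1_continuous_on I w \<longleftrightarrow> (\<forall>t\<in>I. w t \<in> H1 \<and>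
     ((\<lambda>s. H1_norm (\<lambda>x. w s x - w t x)) \<longlongrightarrow> 0) (at t within I))"

text \<open>\<open>w \<in> C\<^sup>1(I, L\<^sup>2)\<close> with derivative \<open>w'\<close>; difference quotients are one-sided at endpoints of \<open>I\<close>.\<close>

definition L2_C1_on :: "real set \<Rightarrow> (real \<Rightarrow> 'a::euclidean_space \<Rightarrow> real) \<Rightarrow>
    (real \<Rightarrow> 'a \<Rightarrow> real) \<Rightarrow> bool" where
  "L2_C1_on I w w' \<longleftrightarrow> L2_continuous_on I w \<and> L2_continuous_on I w' \<and>
     (\<forall>t\<in>I. ((\<lambda>s. L2_norm (\<lambda>x. (w s x - w t x) / (s - t) - w' t x)) \<longlongrightarrow> 0) (at t within I))"


section \<open>Energy solutions\<close>

text \<open>\<open>[0,T)\<close>, where \<open>T = \<infinity>\<close> (a global solution) is permitted.\<close>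

definition time_ivl :: "ereal \<Rightarrow> real set" where
  "time_ivl T = {t. 0 \<le> t \<and> ereal t < T}"

definition spacetime_convergent :: "ereal \<Rightarrow> (real \<Rightarrow> 'a::euclidean_space \<Rightarrow> real) \<Rightarrow> bool" where
  "spacetime_convergent T F \<longleftrightarrow>
     (AE t in lebesgue. t \<in> time_ivl T \<longrightarrow> integrable lebesgue (F t)) \<and>
     set_integrable lebesgue (time_ivl T) (\<lambda>t. LINT x|lebesgue. F t x)"

definition spacetime_integral :: "ereal \<Rightarrow> (real \<Rightarrow> 'a::euclidean_space \<Rightarrow> real) \<Rightarrow> real" where
  "spacetime_integral T F = (LINT t:time_ivl T|lebesgue. (LINT x|lebesgue. F t x))"

definition damping :: "real \<Rightarrow> real \<Rightarrow> 'a::euclidean_space \<Rightarrow> real" where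
  "damping \<mu> \<beta> x = \<mu> / (1 + norm x) powr \<beta>"

text \<open>
  \<open>ut\<close> is the time derivative of the curve \<open>u\<close> in \<open>L\<^sup>2\<close>, hence determined for every \<open>t\<close> up to a null
  set of \<open>x\<close>.  Since the space-time integrals are iterated, only \<open>u\<close> has to be jointly measurable.
  The integrability conditions carry content only for the term with \<open>\<bar>u\<bar>\<^sup>p\<close>: there they also give
  integrability up to \<open>t = 0\<close>, which \<open>L\<^sup>p\<^sub>l\<^sub>o\<^sub>c\<close> on the open interval does not.
\<close>

definition energy_solution ::
  "real \<Rightarrow> real \<Rightarrow> real \<Rightarrow> real \<Rightarrow> ('a::euclidean_space \<Rightarrow> real) \<Rightarrow> ('a \<Rightarrow> real) \<Rightarrow>
   ereal \<Rightarrow> (real \<Rightarrow> 'a \<Rightarrow> real) \<Rightarrow> bool" where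
  "energy_solution \<mu> \<beta> p \<epsilon> f g T u \<longleftrightarrow>
     H1_continuous_on (time_ivl T) u \<and>
     (\<lambda>(t, x). u t x) \<in> Lp_loc p ((time_ivl T - {0}) \<times> UNIV) \<and>
     (\<exists>ut. L2_C1_on (time_ivl T) u ut \<and>
       (AE x in lebesgue. u 0 x = \<epsilon> * f x) \<and>
       (AE x in lebesgue. ut 0 x = \<epsilon> * g x) \<and>
       (\<forall>\<Psi>\<in>test_functions (time_ivl T \<times> UNIV).
         let \<Psi>t = (\<lambda>t x. vector_derivative (\<lambda>s. \<Psi> (s, x)) (at t within time_ivl T));
             F = (\<lambda>t x. \<bar>u t x\<bar> powr p * \<Psi> (t, x));
             A = (\<lambda>t x. ut t x * \<Psi>t t x);
             B = (\<lambda>t x. weak_grad (u t) x \<bullet> grad (\<lambda>y. \<Psi> (t, y)) x);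
             D = (\<lambda>t x. damping \<mu> \<beta> x * u t x * \<Psi>t t x)
         in
           integrable lebesgue (\<lambda>x. g x * \<Psi> (0, x)) \<and>
           integrable lebesgue (\<lambda>x. damping \<mu> \<beta> x * f x * \<Psi> (0, x)) \<and>
           spacetime_convergent T F \<and> spacetime_convergent T A \<and>
           spacetime_convergent T B \<and> spacetime_convergent T D \<and>
           \<epsilon> * (LINT x|lebesgue. g x * \<Psi> (0, x))
             + \<epsilon> * (LINT x|lebesgue. damping \<mu> \<beta> x * f x * \<Psi> (0, x))
             + spacetime_integral T F
           = - spacetime_integral T A + spacetime_integral T B - spacetime_integral T D))"

end

theory Submission
  imports Defs
begin

text \<open>
  The weak formulation is tested with products \<open>a(t) Y(x)\<close>, which after integration by parts reads
  \<open>\<epsilon> (data) + \<integral>\<integral> \<bar>u\<bar>\<^sup>p a Y = \<integral>\<integral> u (a'' Y - a \<Delta>Y - a' V Y)\<close> with \<open>V = \<mu> / (1 + \<bar>x\<bar>)\<^sup>\<beta>\<close>.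
  Let \<open>q = p / (p - 1)\<close>.  Taking for \<open>a Y\<close> a cutoff to \<open>t \<le> R\<close>, \<open>\<bar>x\<bar> \<le> R + 1\<close> and Young's inequality bounds
  \<open>J = \<integral>\<integral> \<bar>u\<bar>\<^sup>p a\<close> by a power of \<open>R\<close>.  Taking instead \<open>e\<^sup>-\<^sup>t\<close> times a positive solution of \<open>\<Delta>Y = (1 + V) Y\<close>, only
  terms with a derivative on the time cutoff survive, and since \<open>Y\<close> is of size \<open>e\<^sup>r (1 + r)\<^sup>-\<^sup>m\<close>, \<open>m = (n - 1) / 2\<close>,
  one gets \<open>\<epsilon> c \<le> \<lambda>\<^sup>p J + C \<lambda>\<^sup>-\<^sup>q R\<^sup>\<alpha>\<close> with an explicit exponent \<open>\<alpha>\<close> for every \<open>\<lambda> > 0\<close>.  The best \<open>\<lambda>\<close> turns this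
  into \<open>\<epsilon> \<le> C R\<^sup>E\<close> with \<open>E < 0\<close>, for every \<open>R\<close> with \<open>1 \<le> R < T\<close>.

  As \<open>V\<close> is not smooth at the origin, neither is \<open>Y\<close>; it is replaced by a polynomial in \<open>\<bar>x\<bar>\<^sup>2\<close> that solves
  the equation up to an arbitrarily small error on \<open>\<bar>x\<bar> \<le> R + 1\<close>, and the growth of that polynomial is
  controlled, uniformly in \<open>R\<close>, by comparison with an explicit supersolution.
\<close>

section \<open>Smooth functions\<close>

text \<open>\<open>e^-t Y\<close> solves the adjoint of the linear damped equation, so all terms
  with an undifferentiated time cutoff cancel. The others live on R/2 \<le> t \<le> R and carry a
  factor 1/R; there the weight e^(q(r-t)) keeps the spatial integral near the light cone, where it
  has size R^c with c = (n-1)(1-q/2). Hence \<alpha> = 1 + c - q. Both estimates share the same J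
  because the cutoff is a high power: Young's inequality returns the cutoff itself, and the weight
  \<open>e^-t Y\<close> is left to the other factor. The two cases of the theorem come from the
  first estimate: for q > n, that is p < n/(n-1), the power R^(n-q) decays, but the integral of V^q
  over the ball does not.

  The positive solution Y is approximated by Picard iteration from the constant 1. The radial
  Laplacian is inverted monomial by monomial, so every iterate is smooth at the origin. All terms of
  the series are nonnegative and increasing in r, so one upper bound by a supersolution gives both
  the growth and the smallness of the residual. The growth constant is fixed before R and the
  tolerance are chosen, so the tolerance may depend on R.\<close>

lemma Ck_on_Suc_imp: "Ck_on (Suc k) S f \<Longrightarrow> Ck_on k S f"
proof (induction k arbitrary: f)
  case 0
  then obtain f' where "\<forall>z\<in>S. (f has_derivative f' z) (at z within S)" by auto
  then show ?case by (auto simp: continuous_on_eq_continuous_within intro: has_derivative_continuous)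
next
  case (Suc k)
  then obtain f' where f': "\<forall>z\<in>S. (f has_derivative f' z) (at z within S)"
    "\<forall>v. Ck_on (Suc k) S (\<lambda>z. f' z v)" unfolding Ck_on.simps(2)[of "Suc k"] by blast
  then have "\<forall>v. Ck_on k S (\<lambda>z. f' z v)" using Suc.IH by blast
  then show ?case unfolding Ck_on.simps(2) using f'(1) by blast
qed

lemma Ck_on_SucI:
  assumes "\<And>z. z \<in> S \<Longrightarrow> (f has_derivative f' z) (at z within S)" "\<And>v. Ck_on k S (\<lambda>z. f' z v)"
  shows "Ck_on (Suc k) S f"
  using assms unfolding Ck_on.simps(2) by blast

lemma Ck_on_SucE:
  assumes "Ck_on (Suc k) S f"
  obtains f' where "\<And>z. z \<in> S \<Longrightarrow> (f has_derivative f' z) (at z within S)"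
    "\<And>v. Ck_on k S (\<lambda>z. f' z v)"
  using assms unfolding Ck_on.simps(2) by blast

lemma Ck_on_UNIV_SucE:
  assumes "Ck_on (Suc k) UNIV f"
  obtains f' where "\<And>z. (f has_derivative f' z) (at z)" "\<And>v. Ck_on k UNIV (\<lambda>z. f' z v)"
  using assms unfolding Ck_on.simps(2) by auto

lemma Ck_on_const: "Ck_on k S (\<lambda>_. c)"
proof (induction k arbitrary: c)
  case (Suc k)
  show ?case by (rule Ck_on_SucI[where f' = "\<lambda>_ _. 0"]) (auto simp: Suc.IH)
qed auto

lemma Ck_on_bounded_linear: "bounded_linear f \<Longrightarrow> Ck_on k S f"
proof (cases k)
  case 0
  assume "bounded_linear f"
  then show ?thesis using 0 by (simp add: linear_continuous_on)
next
  case (Suc m)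
  assume "bounded_linear f"
  then show ?thesis unfolding Suc
    by (intro Ck_on_SucI[where f' = "\<lambda>_. f"] Ck_on_const) (auto intro: bounded_linear_imp_has_derivative)
qed

lemma Ck_on_add: "Ck_on k S f \<Longrightarrow> Ck_on k S g \<Longrightarrow> Ck_on k S (\<lambda>z. f z + g z)"
proof (induction k arbitrary: f g)
  case 0
  then show ?case by (auto intro: continuous_on_add)
next
  case (Suc k)
  from Suc.prems(1) obtain f' where f: "\<And>z. z \<in> S \<Longrightarrow> (f has_derivative f' z) (at z within S)"
    "\<And>v. Ck_on k S (\<lambda>z. f' z v)" by (rule Ck_on_SucE) blast
  from Suc.prems(2) obtain g' where g: "\<And>z. z \<in> S \<Longrightarrow> (g has_derivative g' z) (at z within S)"
    "\<And>v. Ck_on k S (\<lambda>z. g' z v)" by (rule Ck_on_SucE) blast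
  show ?case
    by (rule Ck_on_SucI[where f' = "\<lambda>z v. f' z v + g' z v"]) (auto intro!: f g Suc.IH has_derivative_add)
qed

lemma Ck_on_mult:
  fixes f g :: "'a::euclidean_space \<Rightarrow> real"
  shows "Ck_on k S f \<Longrightarrow> Ck_on k S g \<Longrightarrow> Ck_on k S (\<lambda>z. f z * g z)"
proof (induction k arbitrary: f g)
  case 0
  then show ?case by (auto intro: continuous_on_mult)
next
  case (Suc k)
  from Suc.prems(1) obtain f' where f: "\<And>z. z \<in> S \<Longrightarrow> (f has_derivative f' z) (at z within S)"
    "\<And>v. Ck_on k S (\<lambda>z. f' z v)" by (rule Ck_on_SucE) blast
  from Suc.prems(2) obtain g' where g: "\<And>z. z \<in> S \<Longrightarrow> (g has_derivative g' z) (at z within S)"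
    "\<And>v. Ck_on k S (\<lambda>z. g' z v)" by (rule Ck_on_SucE) blast
  show ?case
  proof (rule Ck_on_SucI[where f' = "\<lambda>z v. f z * g' z v + f' z v * g z"])
    show "((\<lambda>z. f z * g z) has_derivative (\<lambda>v. f z * g' z v + f' z v * g z)) (at z within S)"
      if "z \<in> S" for z
      by (rule has_derivative_mult[OF f(1)[OF that] g(1)[OF that]])
    show "Ck_on k S (\<lambda>z. f z * g' z v + f' z v * g z)" for v
      by (rule Ck_on_add[OF Suc.IH[OF Ck_on_Suc_imp[OF Suc.prems(1)] g(2)]
            Suc.IH[OF f(2) Ck_on_Suc_imp[OF Suc.prems(2)]]])
  qed
qed

lemma Ck_on_compose:
  fixes f :: "'a::euclidean_space \<Rightarrow> real" and h :: "real \<Rightarrow> real"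
  shows "Ck_on k UNIV h \<Longrightarrow> Ck_on k S f \<Longrightarrow> Ck_on k S (\<lambda>z. h (f z))"
proof (induction k arbitrary: f h)
  case 0
  then show ?case by (auto intro: continuous_on_compose2)
next
  case (Suc k)
  from Suc.prems(1) obtain h' where h: "\<And>z. (h has_derivative h' z) (at z)"
    "\<And>v. Ck_on k UNIV (\<lambda>z. h' z v)" by (rule Ck_on_UNIV_SucE) (rule that)
  from Suc.prems(2) obtain f' where f: "\<And>z. z \<in> S \<Longrightarrow> (f has_derivative f' z) (at z within S)"
    "\<And>v. Ck_on k S (\<lambda>z. f' z v)" by (rule Ck_on_SucE) blast
  \<comment> \<open>In the chain rule the direction \<open>f' z v\<close> fed to \<open>h'\<close>
    varies with z. Linearity pulls it out as a scalar factor, leaving the fixed direction 1, to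
    which the induction hypothesis applies.\<close>
  have lin: "h' z v = v * h' z 1" for z v
    using linear_cmul[OF has_derivative_linear[OF h(1)[of z]], of v 1] by simp
  show ?case
  proof (rule Ck_on_SucI[where f' = "\<lambda>z v. f' z v * h' (f z) 1"])
    fix z assume "z \<in> S"
    have "((\<lambda>z. h (f z)) has_derivative (\<lambda>v. h' (f z) (f' z v))) (at z within S)"
      by (rule has_derivative_compose[OF f(1)[OF \<open>z \<in> S\<close>] h(1)])
    then show "((\<lambda>z. h (f z)) has_derivative (\<lambda>v. f' z v * h' (f z) 1)) (at z within S)"
      by (subst (asm) lin)
  next
    fix v
    show "Ck_on k S (\<lambda>z. f' z v * h' (f z) 1)"
      by (rule Ck_on_mult[OF f(2) Suc.IH[OF h(2) Ck_on_Suc_imp[OF Suc.prems(2)]]])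
  qed
qed

lemma Ck_on_sum:
  "(\<And>i. i \<in> I \<Longrightarrow> Ck_on k S (f i)) \<Longrightarrow> Ck_on k S (\<lambda>z. \<Sum>i\<in>I. f i z)"
  by (induction I rule: infinite_finite_induct) (simp_all add: Ck_on_const Ck_on_add)

lemma Ck_on_inner:
  fixes f g :: "'a::euclidean_space \<Rightarrow> 'b::euclidean_space"
  assumes "\<And>i. i \<in> Basis \<Longrightarrow> Ck_on k S (\<lambda>z. f z \<bullet> i)" "\<And>i. i \<in> Basis \<Longrightarrow> Ck_on k S (\<lambda>z. g z \<bullet> i)"
  shows "Ck_on k S (\<lambda>z. f z \<bullet> g z)"
proof -
  have "(\<lambda>z. f z \<bullet> g z) = (\<lambda>z. \<Sum>i\<in>Basis. (f z \<bullet> i) * (g z \<bullet> i))"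
    by (rule ext) (rule euclidean_inner)
  moreover have "Ck_on k S (\<lambda>z. \<Sum>i\<in>Basis. (f z \<bullet> i) * (g z \<bullet> i))"
    by (rule Ck_on_sum, rule Ck_on_mult[OF assms])
  ultimately show ?thesis by metis
qed

lemma Ck_on_power:
  fixes f :: "'a::euclidean_space \<Rightarrow> real"
  shows "Ck_on k S f \<Longrightarrow> Ck_on k S (\<lambda>z. f z ^ m)"
  by (induction m) (simp_all add: Ck_on_const Ck_on_mult)

lemma Ck_on_Suc_realI:
  fixes h :: "real \<Rightarrow> real"
  assumes "\<And>x. (h has_real_derivative h' x) (at x)" "Ck_on k UNIV h'"
  shows "Ck_on (Suc k) UNIV h"
proof (rule Ck_on_SucI[where f' = "\<lambda>z v. h' z * v"])
  show "(h has_derivative (\<lambda>v. h' z * v)) (at z)" for z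
    using assms(1)[of z] by (simp add: has_field_derivative_def)
  show "Ck_on k UNIV (\<lambda>z. h' z * v)" for v
    by (rule Ck_on_mult[OF assms(2) Ck_on_const])
qed

text \<open>\<open>Ck_on\<close> supplies a possibly different derivative for each order k.
  Uniqueness of derivatives identifies them, so that one function serves for all k.\<close>

lemma smooth_realE:
  fixes h :: "real \<Rightarrow> real"
  assumes "\<And>k. Ck_on k UNIV h"
  obtains h' where "\<And>x. (h has_real_derivative h' x) (at x)" "\<And>k. Ck_on k UNIV h'"
proof -
  obtain h' where h': "\<And>x. (h has_derivative h' x) (at x)"
    using assms[of "Suc 0"] by (rule Ck_on_UNIV_SucE) (rule that)
  have d: "(h has_real_derivative h' x 1) (at x)" for x
  proof -
    have "h' x = (*) (h' x 1)"
    proof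
      fix v show "h' x v = h' x 1 * v"
        using linear_cmul[OF has_derivative_linear[OF h'[of x]], of v 1] by simp
    qed
    then show ?thesis using h'[of x] unfolding has_field_derivative_def by simp
  qed
  show ?thesis
  proof (rule that[of "\<lambda>x. h' x 1"])
    fix k
    obtain g where g: "\<And>x. (h has_derivative g x) (at x)" "\<And>v. Ck_on k UNIV (\<lambda>z. g z v)"
      using assms[of "Suc k"] by (rule Ck_on_UNIV_SucE) (rule that)
    have "g x = h' x" for x using has_derivative_unique[OF g(1) h'] .
    then show "Ck_on k UNIV (\<lambda>x. h' x 1)" using g(2)[of 1] by simp
  qed (rule d)
qed

lemma Ck_on_poly: "Ck_on k UNIV (poly (P::real poly))"
proof (induction k arbitrary: P)
  case (Suc k)
  show ?case by (rule Ck_on_Suc_realI[OF poly_DERIV Suc.IH])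
qed (simp add: continuous_on_poly)

section \<open>A smooth cutoff\<close>

lemma poly_exp_decay: "((\<lambda>y. poly P y * exp (- y)) \<longlongrightarrow> 0) (at_top :: real filter)"
proof -
  have "((\<lambda>y. \<Sum>i\<le>degree P. coeff P i * (y ^ i / exp y)) \<longlongrightarrow> (\<Sum>i\<le>degree P. coeff P i * 0)) at_top"
    by (intro tendsto_sum tendsto_mult tendsto_const tendsto_power_div_exp_0)
  then show ?thesis
    by (simp add: poly_altdef exp_minus field_simps sum_distrib_right sum_divide_distrib)
qed

text \<open>\<open>flat 1\<close> is the classical smooth function e^(-1/x), extended by 0. The
  polynomial parameter makes the family closed under differentiation, so smoothness follows by
  induction on the order.\<close>

definition flat :: "real poly \<Rightarrow> real \<Rightarrow> real" where
  "flat P x = (if x \<le> 0 then 0 else poly P (1 / x) * exp (- (1 / x)))"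

lemma flat_tendsto_0: "(flat P \<longlongrightarrow> 0) (at 0)"
proof -
  have "((\<lambda>x. poly P (inverse x) * exp (- inverse x)) \<longlongrightarrow> 0) (at_right 0)"
    by (rule filterlim_compose[OF poly_exp_decay filterlim_inverse_at_top_right])
  then have "(flat P \<longlongrightarrow> 0) (at_right 0)"
    by (rule Lim_transform_eventually)
      (auto simp: flat_def eventually_at_filter inverse_eq_divide intro!: always_eventually)
  moreover have "(flat P \<longlongrightarrow> 0) (at_left 0)"
    by (rule Lim_transform_eventually[OF tendsto_const])
      (auto simp: flat_def eventually_at_filter intro!: always_eventually)
  ultimately show ?thesis by (simp add: filterlim_split_at)
qed

lemma flat_DERIV:
  "(flat P has_real_derivative flat ((P - pderiv P) * [:0, 0, 1:]) x) (at x)"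
proof -
  consider "x < 0" | "x = 0" | "x > 0" by linarith
  then show ?thesis
  proof cases
    case 1
    have "((\<lambda>_. 0) has_real_derivative 0) (at x)" by simp
    then have "(flat P has_real_derivative 0) (at x)"
      by (rule has_field_derivative_transform_within_open[where S = "{..<0}"]) (use 1 in \<open>auto simp: flat_def\<close>)
    then show ?thesis using 1 by (simp add: flat_def)
  next
    case 2
    \<comment> \<open>For \<open>h > 0\<close> the factor 1/h of the difference quotient is absorbed
      into the polynomial, which is evaluated at 1/h.\<close>
    have "((\<lambda>h. flat (P * [:0, 1:]) h) \<longlongrightarrow> 0) (at 0)" by (rule flat_tendsto_0)
    then have "((\<lambda>h. (flat P (0 + h) - flat P 0) / h) \<longlongrightarrow> 0) (at 0)"
      by (rule Lim_transform_eventually)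
       (auto simp: flat_def eventually_at_filter intro!: always_eventually)
    then show ?thesis using 2 by (simp add: DERIV_def flat_def)
  next
    case 3
    have "((\<lambda>x. poly P (1 / x) * exp (- (1 / x))) has_real_derivative
        flat ((P - pderiv P) * [:0, 0, 1:]) x) (at x)"
      unfolding flat_def using 3
      by (auto intro!: derivative_eq_intros DERIV_chain2[OF poly_DERIV] simp: field_simps power2_eq_square)
    then show ?thesis
      by (rule has_field_derivative_transform_within_open[where S = "{0<..}"]) (use 3 in \<open>auto simp: flat_def\<close>)
  qed
qed

lemma Ck_on_flat: "Ck_on k UNIV (flat P)"
proof (induction k arbitrary: P)
  case 0
  show ?case using flat_DERIV by (auto intro!: continuous_at_imp_continuous_on intro: DERIV_isCont)
next
  case (Suc k)
  show ?case by (rule Ck_on_Suc_realI[OF flat_DERIV Suc.IH])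
qed

text \<open>A descent from 1 to 0 on [1/2, 1], obtained by composing two copies of
  \<open>flat 1\<close>. The inner one vanishes up to 1/2 and has reached e^(-2) at 1, and
  \<open>flat 1 1\<close> is e^(-1); the factors \<open>exp 2\<close> and \<open>exp 1\<close>
  normalise these values to 1.\<close>

definition step :: "real \<Rightarrow> real" where
  "step x = exp 1 * flat 1 (1 - exp 2 * flat 1 (x - 1 / 2))"

lemma Ck_on_step: "Ck_on k UNIV step"
proof -
  have aff: "Ck_on k UNIV (\<lambda>x. x + c)" for c :: real
    by (rule Ck_on_add[OF Ck_on_bounded_linear[OF bounded_linear_ident] Ck_on_const])
  have 1: "Ck_on k UNIV (\<lambda>x. - exp 2 * flat 1 (x + (- 1 / 2)))"
    by (rule Ck_on_mult[OF Ck_on_const Ck_on_compose[OF Ck_on_flat aff]])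
  have 2: "Ck_on k UNIV (\<lambda>x. exp 1 * flat 1 (1 + - exp 2 * flat 1 (x + (- 1 / 2))))"
    by (rule Ck_on_mult[OF Ck_on_const Ck_on_compose[OF Ck_on_flat Ck_on_add[OF Ck_on_const 1]]])
  have "step = (\<lambda>x. exp 1 * flat 1 (1 + - exp 2 * flat 1 (x + (- 1 / 2))))"
    by (simp add: fun_eq_iff step_def)
  then show ?thesis using 2 by metis
qed

lemma step_eq_1: "x \<le> 1 / 2 \<Longrightarrow> step x = 1"
  by (simp add: step_def flat_def flip: exp_add)

lemma step_eq_0:
  assumes "1 \<le> x" shows "step x = 0"
proof -
  have "exp (-2) \<le> flat 1 (x - 1 / 2)" using assms by (simp add: flat_def field_simps)
  then have "1 \<le> exp 2 * flat 1 (x - 1 / 2)"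
    using mult_left_mono[of "exp (-2)" "flat 1 (x - 1 / 2)" "exp 2"] by (simp flip: exp_add)
  then show ?thesis by (simp add: step_def flat_def)
qed

lemma step_nonneg: "0 \<le> step x"
  by (simp add: step_def flat_def)

lemma step_le_1: "step x \<le> 1"
proof -
  have "0 \<le> flat 1 (x - 1 / 2)" by (simp add: flat_def)
  then have "1 - exp 2 * flat 1 (x - 1 / 2) \<le> 1" by simp
  moreover have "flat 1 y \<le> exp (-1)" if "y \<le> 1" for y using that by (auto simp: flat_def field_simps)
  ultimately have "flat 1 (1 - exp 2 * flat 1 (x - 1 / 2)) \<le> exp (-1)" by blast
  then have "step x \<le> exp 1 * exp (-1)" unfolding step_def by (intro mult_left_mono) auto
  then show ?thesis by (simp flip: exp_add)
qed

lemma bounded_of_unit_support: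
  fixes h :: "real \<Rightarrow> real"
  assumes "continuous_on UNIV h" "\<And>x. x < 0 \<or> 1 < x \<Longrightarrow> h x = 0"
  obtains B where "B > 0" "\<And>x. \<bar>h x\<bar> \<le> B"
proof -
  have "bounded (h ` {0..1})"
    by (intro compact_imp_bounded compact_continuous_image continuous_on_subset[OF assms(1)]) auto
  then obtain B where B: "B > 0" "\<forall>x\<in>{0..1}. \<bar>h x\<bar> \<le> B" unfolding bounded_pos by auto
  have "\<bar>h x\<bar> \<le> B" for x using B assms(2)[of x] by (cases "x \<in> {0..1}") auto
  then show ?thesis using B(1) that by blast
qed

lemma DERIV_locally_const:
  fixes h :: "real \<Rightarrow> real"
  assumes "(h has_real_derivative D) (at x)" "open S" "x \<in> S" "\<And>y. y \<in> S \<Longrightarrow> h y = c"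
  shows "D = 0"
proof -
  have "((\<lambda>_. c) has_real_derivative D) (at x)"
    by (rule has_field_derivative_transform_within_open[OF assms(1-3)]) (use assms(4) in auto)
  then show ?thesis using DERIV_unique[OF _ DERIV_const] by blast
qed

text \<open>A high power of \<open>step\<close>: each derivative costs one power, so that the first two are dominated
  by the power \<open>1/p < 1\<close> of the cutoff itself.\<close>

lemma cutoff:
  assumes p: "1 < p"
  obtains \<eta> \<eta>1 \<eta>2 C where
    "\<And>k. Ck_on k UNIV \<eta>"
    "\<And>x. (\<eta> has_real_derivative \<eta>1 x) (at x)" "\<And>x. (\<eta>1 has_real_derivative \<eta>2 x) (at x)"
    "continuous_on UNIV \<eta>2"
    "\<And>x. 0 \<le> \<eta> x" "\<And>x. \<eta> x \<le> 1" "\<And>x. x < 1 / 2 \<Longrightarrow> \<eta> x = 1 \<and> \<eta>1 x = 0 \<and> \<eta>2 x = 0"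
    "\<And>x. 1 \<le> x \<Longrightarrow> \<eta> x = 0 \<and> \<eta>1 x = 0 \<and> \<eta>2 x = 0"
    "C > 0" "\<And>x. \<bar>\<eta>1 x\<bar> \<le> C * \<eta> x powr (1 / p)" "\<And>x. \<bar>\<eta>2 x\<bar> \<le> C * \<eta> x powr (1 / p)"
proof -
  obtain h1 where h1: "\<And>x. (step has_real_derivative h1 x) (at x)" "\<And>k. Ck_on k UNIV h1"
    using smooth_realE[of step] Ck_on_step by blast
  obtain h2 where h2: "\<And>x. (h1 has_real_derivative h2 x) (at x)" "\<And>k. Ck_on k UNIV h2"
    using smooth_realE[of h1] h1(2) by blast
  have h1z: "h1 x = 0" if "x < 1 / 2 \<or> 1 < x" for x
    using that
  proof
    assume "x < 1 / 2"
    then show ?thesis using step_eq_1 by (intro DERIV_locally_const[OF h1(1), of "{..<1/2}" _ 1]) auto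
  next
    assume "1 < x"
    then show ?thesis using step_eq_0 by (intro DERIV_locally_const[OF h1(1), of "{1<..}" _ 0]) auto
  qed
  have h2z: "h2 x = 0" if "x < 1 / 2 \<or> 1 < x" for x
    using that
  proof
    assume "x < 1 / 2"
    then show ?thesis using h1z by (intro DERIV_locally_const[OF h2(1), of "{..<1/2}" _ 0]) auto
  next
    assume "1 < x"
    then show ?thesis using h1z by (intro DERIV_locally_const[OF h2(1), of "{1<..}" _ 0]) auto
  qed
  obtain B1 where B1: "B1 > 0" "\<And>x. \<bar>h1 x\<bar> \<le> B1"
    by (rule bounded_of_unit_support[of h1]) (use h1(2)[of 0] h1z in auto)
  obtain B2 where B2: "B2 > 0" "\<And>x. \<bar>h2 x\<bar> \<le> B2"
    by (rule bounded_of_unit_support[of h2]) (use h2(2)[of 0] h2z in auto)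
  \<comment> \<open>The condition m \<ge> 2/(p-1) says (m+2)/p \<le> m: of the power k = m+2, what
    two derivatives leave over is still at least the power k/p.\<close>
  obtain m :: nat where m: "real m \<ge> max 1 (2 / (p - 1))" using real_arch_simple by blast
  define k where "k = m + 2"
  have kp: "real k / p \<le> real m"
  proof -
    have "2 \<le> real m * (p - 1)" using m p by (simp add: field_simps)
    then show ?thesis using p by (simp add: k_def field_simps)
  qed
  define \<eta>1 where "\<eta>1 x = real k * step x ^ (m + 1) * h1 x" for x
  define \<eta>2 where "\<eta>2 x = real k * (real (m + 1) * step x ^ m * h1 x * h1 x + step x ^ (m + 1) * h2 x)" for x
  have m0: "m > 0" using m by auto
  have dom: "step x ^ m \<le> (step x ^ k) powr (1 / p)" for x
  proof (cases "step x = 0")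
    case False
    then have s: "step x > 0" using step_nonneg[of x] by simp
    have "step x ^ m = step x powr real m" using s by (simp add: powr_realpow)
    also have "\<dots> \<le> step x powr (real k / p)" using s step_le_1 kp by (intro powr_mono') auto
    also have "\<dots> = (step x ^ k) powr (1 / p)" using s by (simp add: powr_powr flip: powr_realpow)
    finally show ?thesis .
  qed (use m0 in \<open>simp add: k_def zero_power\<close>)
  have dom': "step x ^ (m + 1) \<le> (step x ^ k) powr (1 / p)" for x
    using dom[of x] power_decreasing[of m "m + 1" "step x"] step_nonneg[of x] step_le_1[of x] by linarith
  have dp: "((\<lambda>x. step x ^ j) has_real_derivative real j * step x ^ (j - 1) * h1 x) (at x)" for j x
    using DERIV_power[OF h1(1)[of x], of j] by (simp add: algebra_simps)
  define C where "C = real k * (B1 + (real (m + 1) * B1 * B1 + B2))"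
  show ?thesis
  proof (rule that[of "\<lambda>x. step x ^ k" \<eta>1 \<eta>2 C])
    show "Ck_on j UNIV (\<lambda>x. step x ^ k)" for j by (intro Ck_on_power Ck_on_step)
    show "((\<lambda>x. step x ^ k) has_real_derivative \<eta>1 x) (at x)" for x
      using dp[of k x] by (simp add: \<eta>1_def k_def)
    show "(\<eta>1 has_real_derivative \<eta>2 x) (at x)" for x
      unfolding \<eta>1_def[abs_def] \<eta>2_def
      using DERIV_cmult[OF DERIV_mult[OF dp[of "m + 1" x] h2(1)[of x]], of "real k"]
      by (simp add: algebra_simps)
    show "continuous_on UNIV \<eta>2" unfolding \<eta>2_def[abs_def]
      using h1(2)[of 0] h2(2)[of 0] Ck_on_step[of 0] by (auto intro!: continuous_intros)
    show "0 \<le> step x ^ k" "step x ^ k \<le> 1" for x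
      using step_nonneg[of x] step_le_1[of x] by (auto intro: power_le_one)
    show "step x ^ k = 1 \<and> \<eta>1 x = 0 \<and> \<eta>2 x = 0" if "x < 1 / 2" for x
      using that h1z[of x] h2z[of x] step_eq_1[of x] by (simp add: \<eta>1_def \<eta>2_def)
    show "step x ^ k = 0 \<and> \<eta>1 x = 0 \<and> \<eta>2 x = 0" if "1 \<le> x" for x
      using that step_eq_0[of x] m0 by (simp add: \<eta>1_def \<eta>2_def k_def)
    show "C > 0" unfolding C_def k_def using B1(1) B2(1) by (intro mult_pos_pos add_pos_pos) auto
    fix x
    let ?D = "(step x ^ k) powr (1 / p)"
    have s0: "0 \<le> step x ^ j" for j using step_nonneg[of x] by simp
    have D0: "0 \<le> ?D" by simp
    have a1: "step x ^ (m + 1) * \<bar>h1 x\<bar> \<le> ?D * B1"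
      by (intro mult_mono dom' B1 s0 D0) auto
    have a2: "step x ^ (m + 1) * \<bar>h2 x\<bar> \<le> ?D * B2"
      by (intro mult_mono dom' B2 s0 D0) auto
    have a3: "step x ^ m * (\<bar>h1 x\<bar> * \<bar>h1 x\<bar>) \<le> ?D * (B1 * B1)"
      by (intro mult_mono dom B1 s0 D0) (use B1 in auto)
    have "\<bar>\<eta>1 x\<bar> = real k * (step x ^ (m + 1) * \<bar>h1 x\<bar>)"
      using step_nonneg[of x] by (simp add: \<eta>1_def abs_mult)
    also have "\<dots> \<le> real k * (?D * B1)" by (intro mult_left_mono a1) auto
    also have "\<dots> = real k * B1 * ?D" by simp
    also have "\<dots> \<le> C * ?D"
      unfolding C_def using B1(1) B2(1) by (intro mult_right_mono mult_left_mono) auto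
    finally show "\<bar>\<eta>1 x\<bar> \<le> C * ?D" .
    have "\<bar>\<eta>2 x\<bar> \<le> real k * (real (m + 1) * (step x ^ m * (\<bar>h1 x\<bar> * \<bar>h1 x\<bar>)) + step x ^ (m + 1) * \<bar>h2 x\<bar>)"
    proof -
      have "\<bar>real (m + 1) * step x ^ m * h1 x * h1 x + step x ^ (m + 1) * h2 x\<bar>
         \<le> \<bar>real (m + 1) * step x ^ m * h1 x * h1 x\<bar> + \<bar>step x ^ (m + 1) * h2 x\<bar>" by (rule abs_triangle_ineq)
      then show ?thesis unfolding \<eta>2_def using step_nonneg[of x]
        by (simp add: abs_mult mult_left_mono mult.assoc)
    qed
    also have "\<dots> \<le> real k * (real (m + 1) * (?D * (B1 * B1)) + ?D * B2)"
      by (intro mult_left_mono add_mono a2 a3) auto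
    also have "\<dots> = real k * (real (m + 1) * B1 * B1 + B2) * ?D" by (simp add: algebra_simps)
    also have "\<dots> \<le> C * ?D"
      unfolding C_def using B1(1) B2(1) by (intro mult_right_mono mult_left_mono) auto
    finally show "\<bar>\<eta>2 x\<bar> \<le> C * ?D" .
  qed
qed

section \<open>Radial sub- and supersolutions\<close>

text \<open>The assumption is r times \<open>d'' + (n-1) d'/r \<ge> 0\<close>, free of a division at
  the origin. It makes \<open>r^(n-1) d'\<close> nondecreasing from the value 0, hence
  \<open>d' \<ge> 0\<close>. Applied to a difference of radial functions this is the comparison
  principle.\<close>

lemma radial_comparison:
  fixes d d1 d2 :: "real \<Rightarrow> real"
  assumes n: "2 \<le> n"
    and d: "\<And>r. 0 \<le> r \<Longrightarrow> r \<le> L \<Longrightarrow> (d has_real_derivative d1 r) (at r)"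
    and d1: "\<And>r. 0 \<le> r \<Longrightarrow> r \<le> L \<Longrightarrow> (d1 has_real_derivative d2 r) (at r)"
    and ge: "\<And>r. 0 \<le> r \<Longrightarrow> r \<le> L \<Longrightarrow> 0 \<le> r * d2 r + (real n - 1) * d1 r"
    and rs: "0 \<le> r" "r \<le> s" "s \<le> L"
  shows "d r \<le> d s"
proof -
  obtain k where k: "n = Suc (Suc k)" using n by (metis add_2_eq_Suc le_Suc_ex)
  have d1_nonneg: "0 \<le> d1 x" if x: "0 \<le> x" "x \<le> L" for x
  proof (cases "x = 0")
    case True
    then show ?thesis using ge[of 0] x k by (simp add: zero_le_mult_iff)
  next
    case False
    have "0 ^ Suc k * d1 0 \<le> x ^ Suc k * d1 x"
    proof (rule DERIV_nonneg_imp_nondecreasing[where f = "\<lambda>y. y ^ Suc k * d1 y"])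
      show "\<exists>D. ((\<lambda>y. y ^ Suc k * d1 y) has_real_derivative D) (at y) \<and> 0 \<le> D" if "0 \<le> y" "y \<le> x" for y
      proof (intro exI conjI)
        show "((\<lambda>y. y ^ Suc k * d1 y) has_real_derivative y ^ k * (y * d2 y + (real n - 1) * d1 y)) (at y)"
          using DERIV_mult[OF DERIV_pow[of "Suc k"] d1[of y]] that x by (simp add: k algebra_simps)
        show "0 \<le> y ^ k * (y * d2 y + (real n - 1) * d1 y)"
          using ge[of y] that x by simp
      qed
    qed (rule x)
    then have "x ^ Suc k * 0 \<le> x ^ Suc k * d1 x" by simp
    then show ?thesis
      by (rule mult_left_le_imp_le) (use False x in simp)
  qed
  show ?thesis
  proof (rule DERIV_nonneg_imp_nondecreasing[OF rs(2)])
    show "\<exists>D. (d has_real_derivative D) (at x) \<and> 0 \<le> D" if "r \<le> x" "x \<le> s" for x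
      using d[of x] d1_nonneg[of x] that rs by auto
  qed
qed

section \<open>The Laplacian of \<open>Q(r^2)\<close>, acting on the polynomial Q in s = r^2\<close>

definition radial_lap :: "nat \<Rightarrow> real poly \<Rightarrow> real poly" where
  "radial_lap n Q = smult 4 (pCons 0 (pderiv (pderiv Q))) + smult (2 * real n) (pderiv Q)"

lemma poly_radial_lap:
  "poly (radial_lap n Q) s = 4 * s * poly (pderiv (pderiv Q)) s + 2 * real n * poly (pderiv Q) s"
  by (simp add: radial_lap_def)

lemma radial_lap_add: "radial_lap n (P + Q) = radial_lap n P + radial_lap n Q"
  by (simp add: radial_lap_def pderiv_add smult_add_right algebra_simps flip: add_pCons)
    (metis add_pCons add_0 smult_add_right)

lemma radial_lap_sum: "radial_lap n (\<Sum>i\<in>I. F i) = (\<Sum>i\<in>I. radial_lap n (F i))"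
  by (induction I rule: infinite_finite_induct) (simp_all add: radial_lap_add, simp_all add: radial_lap_def)

lemma radial_lap_monom:
  "radial_lap n (monom c (Suc k)) = monom (2 * (real k + 1) * (2 * real k + real n) * c) k"
  by (cases k) (simp_all add: radial_lap_def pderiv_monom smult_monom add_monom algebra_simps flip: monom_Suc)

text \<open>The Laplacian sends s^(k+1) to 2(k+1)(2k+n) s^k, so it is inverted coefficient by
  coefficient. The preimage without constant term is taken, which vanishes at the origin.\<close>

definition radial_inv :: "nat \<Rightarrow> real poly \<Rightarrow> real poly" where
  "radial_inv n P = (\<Sum>k\<le>degree P. monom (coeff P k / (2 * (real k + 1) * (2 * real k + real n))) (Suc k))"

lemma radial_lap_inv:
  assumes "0 < n" shows "radial_lap n (radial_inv n P) = P"
proof -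
  have "2 * (real k + 1) * (2 * real k + real n) \<noteq> 0" for k using assms by auto
  then show ?thesis
    by (simp add: radial_inv_def radial_lap_sum radial_lap_monom poly_as_sum_of_monoms)
qed

lemma poly_radial_inv_0: "poly (radial_inv n P) 0 = 0"
  by (simp add: radial_inv_def poly_sum poly_monom)

lemma poly_sq_DERIV:
  fixes Q :: "real poly"
  shows "((\<lambda>r. poly Q (r\<^sup>2)) has_real_derivative 2 * r * poly (pderiv Q) (r\<^sup>2)) (at r)"
  by (rule derivative_eq_intros DERIV_chain2[OF poly_DERIV] refl | simp)+

lemma poly_sq_DERIV2:
  fixes Q :: "real poly"
  shows "((\<lambda>r. 2 * r * poly (pderiv Q) (r\<^sup>2)) has_real_derivative
    2 * poly (pderiv Q) (r\<^sup>2) + 4 * r\<^sup>2 * poly (pderiv (pderiv Q)) (r\<^sup>2)) (at r)"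
  using DERIV_mult[OF DERIV_cmult[OF DERIV_ident, of 2] poly_sq_DERIV[of "pderiv Q" r]]
  by (simp add: power2_eq_square algebra_simps)

text \<open>The exact solution behaves like \<open>e\<^sup>r r\<^sup>-\<^sup>m\<close> at infinity; the factor \<open>exp (- A / (1 + r))\<close> turns
  this asymptotic profile into a supersolution that absorbs a potential of size \<open>K / (1 + r)\<^sup>2\<close>.\<close>

locale supersolution =
  fixes n :: nat and K :: real
  assumes n2: "2 \<le> n" and K0: "0 \<le> K"
begin

definition "m = (real n - 1) / 2"
definition "A = (K + 1 + m\<^sup>2) / 2"
text \<open>The summand A in the exponent normalises the value at r = 0 to 1, the value that the
  iterates below have there. The functions \<open>w\<close> and \<open>w'\<close> are the
  logarithmic derivative of \<open>profile\<close> and its derivative.\<close>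

definition "profile r = exp (A + r - A / (1 + r)) * (1 + r) powr (- m)"
definition "w r = 1 - m / (1 + r) + A / (1 + r)\<^sup>2"
definition "w' r = m / (1 + r)\<^sup>2 - 2 * A / (1 + r) ^ 3"

lemma profile_DERIV:
  assumes "0 \<le> r" shows "(profile has_real_derivative w r * profile r) (at r)"
  unfolding profile_def[abs_def] w_def using assms
  by (auto intro!: derivative_eq_intros simp: powr_diff field_simps power2_eq_square)

lemma w_DERIV:
  assumes "0 \<le> r" shows "(w has_real_derivative w' r) (at r)"
proof -
  have "((\<lambda>r. inverse (1 + r)) has_real_derivative - (inverse (1 + r) ^ 2)) (at r)"
    using assms by (auto intro!: derivative_eq_intros simp: power2_eq_square)
  note inv = this
  have "((\<lambda>r. 1 - m * inverse (1 + r) + A * (inverse (1 + r))\<^sup>2) has_real_derivative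
      m * (inverse (1 + r) ^ 2) - 2 * A * inverse (1 + r) ^ 3) (at r)"
    by (rule derivative_eq_intros inv refl)+ (simp add: power2_eq_square power3_eq_cube)
  then show ?thesis
    by (simp add: w_def[abs_def] w'_def divide_inverse power_inverse)
qed

lemma w_profile_DERIV:
  assumes "0 \<le> r" shows "((\<lambda>r. w r * profile r) has_real_derivative (w' r + (w r)\<^sup>2) * profile r) (at r)"
  using DERIV_mult[OF w_DERIV[OF assms] profile_DERIV[OF assms]] by (simp add: power2_eq_square algebra_simps)

lemma w_nonneg: assumes "0 \<le> r" shows "0 \<le> w r"
proof -
  define x where "x = 1 / (1 + r)"
  have "0 \<le> (1 - m * x / 2)\<^sup>2 + (A - m\<^sup>2 / 4) * x\<^sup>2"
    by (intro add_nonneg_nonneg mult_nonneg_nonneg) (use K0 in \<open>auto simp: A_def\<close>)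
  also have "\<dots> = 1 - m * x + A * x\<^sup>2" by (simp add: power2_eq_square algebra_simps)
  also have "\<dots> = w r" by (simp add: w_def x_def power2_eq_square)
  finally show ?thesis .
qed

lemma sup_supersolution:
  assumes r: "0 \<le> r"
  shows "r * (1 + K / (1 + r)\<^sup>2) \<le> r * (w' r + (w r)\<^sup>2) + (real n - 1) * w r"
proof -
  define x where "x = 1 / (1 + r)"
  have w: "w r = 1 - m * x + A * x\<^sup>2" by (simp add: w_def x_def power2_eq_square)
  have w': "w' r = m * x\<^sup>2 - 2 * A * x ^ 3" by (simp add: w'_def x_def power2_eq_square power3_eq_cube)
  have m0: "0 \<le> m" using n2 by (simp add: m_def)
  \<comment> \<open>Origin of A and m: expanding \<open>w' + w^2 + 2 m w x\<close> in powers of x,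
    the choice m = (n-1)/2 cancels the linear terms. The value of A makes the coefficient of x^2
    equal to K + m + 1, and the extra 1 completes the cubic and quartic terms to a square.\<close>
  have "0 \<le> (A * x - 1)\<^sup>2 * x\<^sup>2 + m * x\<^sup>2" using m0 by simp
  also have "\<dots> = (w' r + (w r)\<^sup>2 + 2 * m * w r * x) - (1 + K * x\<^sup>2)"
  proof -
    have "2 * A * x\<^sup>2 = (K + 1 + m\<^sup>2) * x\<^sup>2" by (simp add: A_def)
    then show ?thesis unfolding w w' by (simp add: power2_eq_square power3_eq_cube algebra_simps)
  qed
  finally have "1 + K * x\<^sup>2 \<le> w' r + (w r)\<^sup>2 + 2 * m * w r * x" by simp
  then have "r * (1 + K * x\<^sup>2) \<le> r * (w' r + (w r)\<^sup>2 + 2 * m * w r * x)" using r by (rule mult_left_mono)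
  also have "\<dots> = r * (w' r + (w r)\<^sup>2) + 2 * m * w r * (r * x)" by (simp add: algebra_simps)
  \<comment> \<open>The Laplacian has 1/r where the expansion has x = 1/(1+r). Since
    \<open>w\<close> is nonnegative, passing from r x to 1 only increases the right-hand
    side.\<close>
  also have "\<dots> \<le> r * (w' r + (w r)\<^sup>2) + 2 * m * w r * 1"
    by (intro add_left_mono mult_left_mono mult_nonneg_nonneg) (use r m0 w_nonneg[OF r] in \<open>auto simp: x_def\<close>)
  also have "2 * m = real n - 1" by (simp add: m_def)
  finally show ?thesis by (simp add: x_def power2_eq_square)
qed

lemma profile_0: "profile 0 = 1" by (simp add: profile_def)

lemma profile_pos: "0 \<le> r \<Longrightarrow> 0 < profile r" by (simp add: profile_def)

lemma A_nonneg: "0 \<le> A" using K0 by (simp add: A_def)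

lemma profile_le: assumes "0 \<le> r" shows "profile r \<le> exp A * (exp r * (1 + r) powr (- m))"
proof -
  have "0 \<le> A / (1 + r)" using A_nonneg assms by simp
  then have "exp (A + r - A / (1 + r)) \<le> exp (A + r)" by simp
  then show ?thesis unfolding profile_def by (simp add: exp_add mult_right_mono flip: mult.assoc)
qed

section \<open>Picard iteration for a polynomial potential\<close>

context
  fixes P :: "real poly" and L :: real
  assumes L: "0 \<le> L" and P: "\<And>r. 0 \<le> r \<Longrightarrow> r \<le> L \<Longrightarrow> 0 \<le> poly P (r\<^sup>2) \<and> poly P (r\<^sup>2) \<le> K / (1 + r)\<^sup>2"
begin

text \<open>The terms of the Neumann series of the radial solution of \<Delta>Y = (1 + P) Y with
  Y(0) = 1.\<close>

primrec phi :: "nat \<Rightarrow> real poly" where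
  "phi 0 = 1"
| "phi (Suc j) = radial_inv n ((1 + P) * phi j)"

text \<open>The constant \<open>phi 0\<close> is harmonic, so the Laplacian of a partial sum lags
  one term behind. The lag drives the induction against the supersolution and leaves (1 + P) times
  the last term as the residual.\<close>

lemma lap_partial_sum: "radial_lap n (\<Sum>j<Suc N. phi j) = (1 + P) * (\<Sum>j<N. phi j)"
proof -
  have "radial_lap n (\<Sum>j<Suc N. phi j) = radial_lap n (phi 0) + (\<Sum>j<N. radial_lap n (phi (Suc j)))"
    by (simp only: radial_lap_sum radial_lap_add sum.lessThan_Suc_shift)
  also have "\<dots> = (\<Sum>j<N. (1 + P) * phi j)"
    using n2 by (simp add: radial_lap_inv) (simp add: radial_lap_def)
  finally show ?thesis by (simp add: sum_distrib_left)
qed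

lemma partial_sum_0: "poly (\<Sum>j<Suc N. phi j) 0 = 1"
  by (induction N) (simp_all add: poly_radial_inv_0)

text \<open>Nonnegativity of one term makes the Laplacian of the next nonnegative, so that next term
  increases by \<open>radial_comparison\<close>; starting from 0 at the origin, it is nonnegative
  too.\<close>

lemma phi_mono_nonneg:
  "0 \<le> r \<Longrightarrow> r \<le> s \<Longrightarrow> s \<le> L \<Longrightarrow> 0 \<le> poly (phi j) (r\<^sup>2) \<and> poly (phi j) (r\<^sup>2) \<le> poly (phi j) (s\<^sup>2)"
proof (induction j arbitrary: r s)
  case (Suc j)
  have mono: "poly (phi (Suc j)) (r\<^sup>2) \<le> poly (phi (Suc j)) (s\<^sup>2)" if rs: "0 \<le> r" "r \<le> s" "s \<le> L" for r s
  proof (rule radial_comparison[OF n2 poly_sq_DERIV poly_sq_DERIV2 _ rs])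
    fix x assume x: "0 \<le> x" "x \<le> L"
    have "0 \<le> x * ((1 + poly P (x\<^sup>2)) * poly (phi j) (x\<^sup>2))"
      using Suc.IH[of x x] P[of x] x by simp
    also have "(1 + poly P (x\<^sup>2)) * poly (phi j) (x\<^sup>2) = poly (radial_lap n (phi (Suc j))) (x\<^sup>2)"
      using n2 by (simp add: radial_lap_inv)
    finally have "0 \<le> x * poly (radial_lap n (phi (Suc j))) (x\<^sup>2)" .
    then show "0 \<le> x * (2 * poly (pderiv (phi (Suc j))) (x\<^sup>2) + 4 * x\<^sup>2 * poly (pderiv (pderiv (phi (Suc j)))) (x\<^sup>2))
         + (real n - 1) * (2 * x * poly (pderiv (phi (Suc j))) (x\<^sup>2))"
      unfolding poly_radial_lap by (simp add: algebra_simps del: phi.simps)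
  qed
  have "poly (phi (Suc j)) (0\<^sup>2) \<le> poly (phi (Suc j)) (r\<^sup>2)" by (rule mono) (use Suc.prems in auto)
  then show ?case using mono[OF Suc.prems] by (simp add: poly_radial_inv_0)
qed simp

text \<open>\<open>profile\<close> and the partial sum agree at the origin. The Laplacian of the new
  partial sum is (1 + P) times the old one, which by induction is at most the potential of the
  supersolution times \<open>profile\<close>.\<close>

lemma partial_sum_le_profile: "0 \<le> r \<Longrightarrow> r \<le> L \<Longrightarrow> poly (\<Sum>j<N. phi j) (r\<^sup>2) \<le> profile r"
proof (induction N arbitrary: r)
  case 0
  then show ?case using profile_pos[of r] by simp
next
  case (Suc N)
  let ?Q = "\<Sum>j<Suc N. phi j"
  have "profile 0 - poly ?Q (0\<^sup>2) \<le> profile r - poly ?Q (r\<^sup>2)"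
  proof (rule radial_comparison[OF n2 DERIV_diff[OF profile_DERIV poly_sq_DERIV]
        DERIV_diff[OF w_profile_DERIV poly_sq_DERIV2] _ order_refl Suc.prems])
    fix x assume x: "0 \<le> x" "x \<le> L"
    have "poly (radial_lap n ?Q) (x\<^sup>2) = (1 + poly P (x\<^sup>2)) * poly (\<Sum>j<N. phi j) (x\<^sup>2)"
      unfolding lap_partial_sum by simp
    also have "\<dots> \<le> (1 + K / (1 + x)\<^sup>2) * profile x"
      using P[OF x] Suc.IH[OF x] phi_mono_nonneg[OF x(1) order_refl x(2)]
      by (intro mult_mono) (auto simp: poly_sum intro!: sum_nonneg)
    finally have "x * poly (radial_lap n ?Q) (x\<^sup>2) \<le> x * ((1 + K / (1 + x)\<^sup>2) * profile x)"
      using x by (intro mult_left_mono) auto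
    also have "\<dots> = (x * (1 + K / (1 + x)\<^sup>2)) * profile x" by simp
    also have "\<dots> \<le> (x * (w' x + (w x)\<^sup>2) + (real n - 1) * w x) * profile x"
      using sup_supersolution[OF x(1)] profile_pos[OF x(1)] by (intro mult_right_mono) auto
    finally show "0 \<le> x * ((w' x + (w x)\<^sup>2) * profile x - (2 * poly (pderiv ?Q) (x\<^sup>2) +
            4 * x\<^sup>2 * poly (pderiv (pderiv ?Q)) (x\<^sup>2))) +
         (real n - 1) * (w x * profile x - 2 * x * poly (pderiv ?Q) (x\<^sup>2))"
      unfolding poly_radial_lap by (simp add: algebra_simps del: sum.lessThan_Suc)
  qed auto
  then show ?case using partial_sum_0[of N] profile_0 by simp
qed

text \<open>A series of nonnegative terms with partial sums bounded by \<open>profile L\<close>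
  converges, so its terms tend to 0. Since each term increases in r, the endpoint L controls the
  whole ball.\<close>

lemma phi_tendsto_0: "(\<lambda>j. poly (phi j) (L\<^sup>2)) \<longlonglongrightarrow> 0"
proof (rule summable_LIMSEQ_zero, rule summableI_nonneg_bounded)
  show "0 \<le> poly (phi j) (L\<^sup>2)" for j using phi_mono_nonneg[OF L order_refl order_refl] by simp
  show "(\<Sum>j<N. poly (phi j) (L\<^sup>2)) \<le> profile L" for N
    using partial_sum_le_profile[OF L order_refl] by (simp add: poly_sum)
qed

lemma partial_sum_ge_1:
  assumes "0 \<le> r" "r \<le> L" shows "1 \<le> poly (\<Sum>j<Suc N. phi j) (r\<^sup>2)"
proof -
  have "0 \<le> poly (\<Sum>j<N. phi (Suc j)) (r\<^sup>2)"
    unfolding poly_sum by (intro sum_nonneg) (use phi_mono_nonneg[OF assms(1) order_refl assms(2)] in blast)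
  then show ?thesis unfolding sum.lessThan_Suc_shift by simp
qed

lemma approx_solution:
  assumes "0 < \<delta>"
  obtains Q where "\<And>r. 0 \<le> r \<Longrightarrow> r \<le> L \<Longrightarrow> 1 \<le> poly Q (r\<^sup>2) \<and> poly Q (r\<^sup>2) \<le> profile r"
    "\<And>r. 0 \<le> r \<Longrightarrow> r \<le> L \<Longrightarrow> \<bar>poly (radial_lap n Q) (r\<^sup>2) - (1 + poly P (r\<^sup>2)) * poly Q (r\<^sup>2)\<bar> \<le> \<delta>"
proof -
  \<comment> \<open>The residual of the partial sum up to N is (1 + P) times \<open>phi N\<close>,
    and 1 + P is at most 1 + K.\<close>
  have "\<delta> / (1 + K) > 0" using assms K0 by simp
  then obtain N where "\<bar>poly (phi N) (L\<^sup>2)\<bar> < \<delta> / (1 + K)"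
    using LIMSEQ_D[OF phi_tendsto_0] by (metis diff_zero order_refl real_norm_def)
  then have "(1 + K) * \<bar>poly (phi N) (L\<^sup>2)\<bar> \<le> \<delta>" using K0 by (simp add: field_simps)
  moreover have "(1 + K) * poly (phi N) (L\<^sup>2) \<le> (1 + K) * \<bar>poly (phi N) (L\<^sup>2)\<bar>"
    using K0 by (intro mult_left_mono) auto
  ultimately have N: "(1 + K) * poly (phi N) (L\<^sup>2) \<le> \<delta>" by linarith
  show ?thesis
  proof (rule that[of "\<Sum>j<Suc N. phi j"])
    fix r assume r: "0 \<le> r" "r \<le> L"
    show "1 \<le> poly (\<Sum>j<Suc N. phi j) (r\<^sup>2) \<and> poly (\<Sum>j<Suc N. phi j) (r\<^sup>2) \<le> profile r"
      using partial_sum_ge_1[OF r] partial_sum_le_profile[OF r] by blast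
    have "1 \<le> (1 + r)\<^sup>2" using r by simp
    then have "K / (1 + r)\<^sup>2 \<le> K / 1" using K0 by (intro divide_left_mono) auto
    then have "K / (1 + r)\<^sup>2 \<le> K" by simp
    then have P': "0 \<le> poly P (r\<^sup>2)" "poly P (r\<^sup>2) \<le> K" using P[OF r] by auto
    have ph: "0 \<le> poly (phi N) (r\<^sup>2)" "poly (phi N) (r\<^sup>2) \<le> poly (phi N) (L\<^sup>2)"
      using phi_mono_nonneg[OF r order_refl] by auto
    have "poly (radial_lap n (\<Sum>j<Suc N. phi j)) (r\<^sup>2) - (1 + poly P (r\<^sup>2)) * poly (\<Sum>j<Suc N. phi j) (r\<^sup>2)
        = - ((1 + poly P (r\<^sup>2)) * poly (phi N) (r\<^sup>2))"
      unfolding lap_partial_sum by (simp add: algebra_simps)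
    moreover have "(1 + poly P (r\<^sup>2)) * poly (phi N) (r\<^sup>2) \<le> (1 + K) * poly (phi N) (L\<^sup>2)"
      using P' ph K0 by (intro mult_mono) auto
    moreover have "0 \<le> (1 + poly P (r\<^sup>2)) * poly (phi N) (r\<^sup>2)" using P' ph by simp
    ultimately show "\<bar>poly (radial_lap n (\<Sum>j<Suc N. phi j)) (r\<^sup>2) -
        (1 + poly P (r\<^sup>2)) * poly (\<Sum>j<Suc N. phi j) (r\<^sup>2)\<bar> \<le> \<delta>" using N by linarith
  qed
qed

end

end

section \<open>From polynomial potentials to continuous ones\<close>

lemma Weierstrass_poly:
  fixes f :: "real \<Rightarrow> real"
  assumes "continuous_on {0..S} f" "0 < e"
  obtains P :: "real poly" where "\<And>s. 0 \<le> s \<Longrightarrow> s \<le> S \<Longrightarrow> \<bar>f s - poly P s\<bar> < e"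
proof -
  obtain g where g: "real_polynomial_function g" "\<And>x. x \<in> {0..S} \<Longrightarrow> \<bar>f x - g x\<bar> < e"
    using Stone_Weierstrass_real_polynomial_function[OF compact_Icc assms] by blast
  obtain a N where "g = (\<lambda>x. \<Sum>i\<le>N. a i * x ^ i)"
    using g(1) unfolding real_polynomial_function_iff_sum by blast
  then have "g x = poly (\<Sum>i\<le>N. monom (a i) i) x" for x by (simp add: poly_sum poly_monom)
  then show ?thesis using g(2) that by (metis atLeastAtMost_iff)
qed

text \<open>The potential need not be smooth in \<open>s = r\<^sup>2\<close>, so the equation is solved for a polynomial
  approximation of it; the error \<open>\<kappa>\<close> is arbitrarily small on the given ball.\<close>

lemma radial_test_function:
  fixes V :: "real \<Rightarrow> real"
  assumes n: "2 \<le> n" and V: "continuous_on {0..} V" "\<And>r. 0 \<le> r \<Longrightarrow> 0 \<le> V r \<and> V r \<le> \<mu> / (1 + r)\<^sup>2"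
    and \<mu>: "0 \<le> \<mu>"
  obtains B where "0 < B" "\<And>L \<kappa>. 0 \<le> L \<Longrightarrow> 0 < \<kappa> \<Longrightarrow>
    \<exists>Q::real poly. \<forall>r. 0 \<le> r \<and> r \<le> L \<longrightarrow> 1 \<le> poly Q (r\<^sup>2)
      \<and> poly Q (r\<^sup>2) \<le> B * (exp r * (1 + r) powr (- ((real n - 1) / 2)))
      \<and> \<bar>4 * r\<^sup>2 * poly (pderiv (pderiv Q)) (r\<^sup>2) + 2 * real n * poly (pderiv Q) (r\<^sup>2) - (1 + V r) * poly Q (r\<^sup>2)\<bar> \<le> \<kappa>"
proof -
  \<comment> \<open>The additional 1 pays for the approximation error e, which is kept below
    1/(1+L)^2 and hence below 1/(1+r)^2 on the ball. As \<open>A\<close> depends on n and \<mu>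
    alone, the constant \<open>exp A\<close> is uniform in L and \<kappa>.\<close>
  interpret supersolution n "\<mu> + 1" using n \<mu> by unfold_locales auto
  show ?thesis
  proof (rule that[of "exp A"])
    fix L \<kappa> :: real assume L: "0 \<le> L" and \<kappa>: "0 < \<kappa>"
    \<comment> \<open>An upper bound for the solution on the ball, known before the polynomial
      potential is chosen. It converts the error of the potential into an error of the
      equation.\<close>
    define M where "M = exp A * exp L"
    define e where "e = min (\<kappa> / (2 * M)) (1 / (1 + L)\<^sup>2)"
    have M: "M > 0" by (simp add: M_def)
    have e: "e > 0" using \<kappa> M L by (simp add: e_def)
    \<comment> \<open>Approximating V + e/2 to within e/2 gives a polynomial between V and V + e, in
      particular a nonnegative one.\<close>
    have "continuous_on {0..L\<^sup>2} (\<lambda>s. V (sqrt s) + e / 2)"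
      by (intro continuous_intros continuous_on_compose2[OF V(1)]) auto
    then obtain P :: "real poly" where P: "\<And>s. 0 \<le> s \<Longrightarrow> s \<le> L\<^sup>2 \<Longrightarrow> \<bar>V (sqrt s) + e / 2 - poly P s\<bar> < e / 2"
      using Weierstrass_poly[of "L\<^sup>2" "\<lambda>s. V (sqrt s) + e / 2" "e / 2"] e by auto
    have PV: "V r \<le> poly P (r\<^sup>2) \<and> poly P (r\<^sup>2) \<le> V r + e" if "0 \<le> r" "r \<le> L" for r
    proof -
      have "\<bar>V r + e / 2 - poly P (r\<^sup>2)\<bar> < e / 2" using P[of "r\<^sup>2"] that by simp
      then show ?thesis by (intro conjI; linarith)
    qed
    have P2: "0 \<le> poly P (r\<^sup>2) \<and> poly P (r\<^sup>2) \<le> (\<mu> + 1) / (1 + r)\<^sup>2" if r: "0 \<le> r" "r \<le> L" for r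
    proof -
      have "e \<le> 1 / (1 + L)\<^sup>2" by (simp add: e_def)
      also have "\<dots> \<le> 1 / (1 + r)\<^sup>2" using r by (intro divide_left_mono power_mono) auto
      finally show ?thesis using PV[OF r] V(2)[OF r(1)] by (auto simp: add_divide_distrib)
    qed
    obtain Q where Q: "\<And>r. 0 \<le> r \<Longrightarrow> r \<le> L \<Longrightarrow> 1 \<le> poly Q (r\<^sup>2) \<and> poly Q (r\<^sup>2) \<le> profile r"
      "\<And>r. 0 \<le> r \<Longrightarrow> r \<le> L \<Longrightarrow> \<bar>poly (radial_lap n Q) (r\<^sup>2) - (1 + poly P (r\<^sup>2)) * poly Q (r\<^sup>2)\<bar> \<le> \<kappa> / 2"
      using approx_solution[OF L P2, of "\<kappa> / 2"] \<kappa> by (metis half_gt_zero)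
    show "\<exists>Q::real poly. \<forall>r. 0 \<le> r \<and> r \<le> L \<longrightarrow> 1 \<le> poly Q (r\<^sup>2)
      \<and> poly Q (r\<^sup>2) \<le> exp A * (exp r * (1 + r) powr (- ((real n - 1) / 2)))
      \<and> \<bar>4 * r\<^sup>2 * poly (pderiv (pderiv Q)) (r\<^sup>2) + 2 * real n * poly (pderiv Q) (r\<^sup>2) - (1 + V r) * poly Q (r\<^sup>2)\<bar> \<le> \<kappa>"
    proof (intro exI[of _ Q] allI impI)
      fix r assume "0 \<le> r \<and> r \<le> L"
      then have r: "0 \<le> r" "r \<le> L" by auto
      have m0: "0 \<le> m" using n by (simp add: m_def)
      have up: "poly Q (r\<^sup>2) \<le> exp A * (exp r * (1 + r) powr (- m))"
        using Q(1)[OF r] profile_le[OF r(1)] by simp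
      have "(1 + r) powr (- m) \<le> 1" using r m0 powr_mono[of "- m" 0 "1 + r"] by simp
      then have "exp r * (1 + r) powr (- m) \<le> exp L * 1" using r by (intro mult_mono) auto
      then have "exp A * (exp r * (1 + r) powr (- m)) \<le> exp A * exp L"
        by (intro mult_left_mono) auto
      then have QM: "poly Q (r\<^sup>2) \<le> M" using up unfolding M_def by linarith
      have "\<bar>(poly P (r\<^sup>2) - V r) * poly Q (r\<^sup>2)\<bar> \<le> e * M"
        unfolding abs_mult using PV[OF r] Q(1)[OF r] QM e by (intro mult_mono) auto
      also have "\<dots> \<le> \<kappa> / (2 * M) * M" using M by (intro mult_right_mono) (auto simp: e_def)
      also have "\<dots> = \<kappa> / 2" using M by simp
      finally have 1: "\<bar>(poly P (r\<^sup>2) - V r) * poly Q (r\<^sup>2)\<bar> \<le> \<kappa> / 2" .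
      have "poly (radial_lap n Q) (r\<^sup>2) - (1 + V r) * poly Q (r\<^sup>2) =
         (poly (radial_lap n Q) (r\<^sup>2) - (1 + poly P (r\<^sup>2)) * poly Q (r\<^sup>2)) + (poly P (r\<^sup>2) - V r) * poly Q (r\<^sup>2)"
        by (simp add: algebra_simps)
      then have "\<bar>poly (radial_lap n Q) (r\<^sup>2) - (1 + V r) * poly Q (r\<^sup>2)\<bar> \<le> \<kappa>"
        using 1 Q(2)[OF r] by linarith
      then show "1 \<le> poly Q (r\<^sup>2)
      \<and> poly Q (r\<^sup>2) \<le> exp A * (exp r * (1 + r) powr (- ((real n - 1) / 2)))
      \<and> \<bar>4 * r\<^sup>2 * poly (pderiv (pderiv Q)) (r\<^sup>2) + 2 * real n * poly (pderiv Q) (r\<^sup>2) - (1 + V r) * poly Q (r\<^sup>2)\<bar> \<le> \<kappa>"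
        using Q(1)[OF r] up unfolding m_def poly_radial_lap by simp
    qed
  qed simp
qed

section \<open>Square-integrable functions\<close>

lemma L2_measurable: "w \<in> L2 \<Longrightarrow> w \<in> borel_measurable lebesgue"
  by (simp add: L2_def)

lemma L2_sq_integrable:
  fixes w :: "'a::euclidean_space \<Rightarrow> real"
  shows "w \<in> L2 \<Longrightarrow> integrable lebesgue (\<lambda>x. (w x)\<^sup>2)"
  by (simp add: L2_def)

lemma L2_mult_integrable:
  fixes v w :: "'a::euclidean_space \<Rightarrow> real"
  assumes "v \<in> L2" "w \<in> L2"
  shows "integrable lebesgue (\<lambda>x. v x * w x)"
proof (rule Bochner_Integration.integrable_bound)
  show "integrable lebesgue (\<lambda>x. (v x)\<^sup>2 + (w x)\<^sup>2)"
    using assms by (intro Bochner_Integration.integrable_add L2_sq_integrable)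
  show "(\<lambda>x. v x * w x) \<in> borel_measurable lebesgue"
    using assms by (intro borel_measurable_times L2_measurable)
  have "\<bar>v x * w x\<bar> \<le> (v x)\<^sup>2 + (w x)\<^sup>2" for x
  proof -
    have "2 * (\<bar>v x\<bar> * \<bar>w x\<bar>) \<le> (v x)\<^sup>2 + (w x)\<^sup>2"
      using zero_le_power2[of "\<bar>v x\<bar> - \<bar>w x\<bar>"] by (simp add: power2_diff)
    moreover have "0 \<le> \<bar>v x\<bar> * \<bar>w x\<bar>" by simp
    ultimately show ?thesis unfolding abs_mult by linarith
  qed
  then show "AE x in lebesgue. norm (v x * w x) \<le> norm ((v x)\<^sup>2 + (w x)\<^sup>2)" by simp
qed

lemma L2_diff:
  fixes v w :: "'a::euclidean_space \<Rightarrow> real"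
  assumes "v \<in> L2" "w \<in> L2" shows "(\<lambda>x. v x - w x) \<in> L2"
proof -
  have "integrable lebesgue (\<lambda>x. (v x)\<^sup>2 - 2 * (v x * w x) + (w x)\<^sup>2)"
    using assms
    by (intro Bochner_Integration.integrable_add Bochner_Integration.integrable_diff
        integrable_mult_right L2_sq_integrable L2_mult_integrable)
  also have "(\<lambda>x. (v x)\<^sup>2 - 2 * (v x * w x) + (w x)\<^sup>2) = (\<lambda>x. (v x - w x)\<^sup>2)"
    by (simp add: fun_eq_iff power2_diff)
  finally show ?thesis using assms by (simp add: L2_def borel_measurable_diff)
qed

lemma L2_cmult:
  fixes w :: "'a::euclidean_space \<Rightarrow> real"
  assumes "w \<in> L2" shows "(\<lambda>x. c * w x) \<in> L2"
  using assms by (auto simp: L2_def power_mult_distrib)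

lemma L2_norm_sq:
  fixes w :: "'a::euclidean_space \<Rightarrow> real"
  shows "(L2_norm w)\<^sup>2 = (LINT x|lebesgue. (w x)\<^sup>2)"
  by (simp add: L2_norm_def)

lemma L2_norm_nonneg: "0 \<le> L2_norm w"
  by (simp add: L2_norm_def)

lemma L2_Cauchy_Schwarz:
  fixes v w :: "'a::euclidean_space \<Rightarrow> real"
  assumes v: "v \<in> L2" and w: "w \<in> L2"
  shows "\<bar>LINT x|lebesgue. v x * w x\<bar> \<le> L2_norm v * L2_norm w"
proof -
  define b where "b = (LINT x|lebesgue. v x * w x)"
  have quad: "0 \<le> (L2_norm v)\<^sup>2 - 2 * c * b + c\<^sup>2 * (L2_norm w)\<^sup>2" for c
  proof -
    have "0 \<le> (LINT x|lebesgue. (v x - c * w x)\<^sup>2)" by simp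
    also have "\<dots> = (LINT x|lebesgue. (v x)\<^sup>2 - 2 * c * (v x * w x) + c\<^sup>2 * (w x)\<^sup>2)"
      by (simp add: power2_diff power_mult_distrib algebra_simps)
    also have "\<dots> = (L2_norm v)\<^sup>2 - 2 * c * b + c\<^sup>2 * (L2_norm w)\<^sup>2"
      unfolding b_def L2_norm_sq using L2_sq_integrable[OF v] L2_sq_integrable[OF w] L2_mult_integrable[OF v w]
      by (simp add: Bochner_Integration.integral_add Bochner_Integration.integral_diff)
    finally show ?thesis .
  qed
  have "b\<^sup>2 \<le> (L2_norm v)\<^sup>2 * (L2_norm w)\<^sup>2"
  proof (cases "L2_norm w = 0")
    case True
    then have "(LINT x|lebesgue. (w x)\<^sup>2) = 0" using L2_norm_sq[of w] by simp
    then have "AE x in lebesgue. (w x)\<^sup>2 = 0"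
      using integral_nonneg_eq_0_iff_AE[OF L2_sq_integrable[OF w]] by simp
    then have "AE x in lebesgue. v x * w x = 0" by eventually_elim simp
    then have "b = 0" unfolding b_def by (rule integral_eq_zero_AE)
    then show ?thesis using True by simp
  next
    case False
    define W where "W = (L2_norm w)\<^sup>2"
    have W: "W > 0" using False by (simp add: W_def)
    have "0 \<le> W * ((L2_norm v)\<^sup>2 - 2 * (b / W) * b + (b / W)\<^sup>2 * W)"
      using quad[of "b / W"] W by (simp flip: W_def)
    also have "\<dots> = W * (L2_norm v)\<^sup>2 - b\<^sup>2" using W by (simp add: field_simps power2_eq_square)
    finally show ?thesis by (simp add: W_def mult.commute)
  qed
  then have "\<bar>b\<bar>\<^sup>2 \<le> (L2_norm v * L2_norm w)\<^sup>2" by (simp add: power_mult_distrib)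
  then show ?thesis unfolding b_def
    by (rule power2_le_imp_le) (simp add: L2_norm_nonneg)
qed

lemma continuous_compact_support_L2:
  fixes z :: "'a::euclidean_space \<Rightarrow> 'b::euclidean_space"
  assumes z: "continuous_on UNIV z" and "compact K" "\<And>x. x \<notin> K \<Longrightarrow> z x = 0"
  shows "z \<in> L2"
proof -
  have "integrable lborel (\<lambda>x. indicator K x *\<^sub>R (norm (z x))\<^sup>2)"
    using assms(2) continuous_on_subset[OF z] by (intro borel_integrable_compact continuous_intros) auto
  moreover have "(\<lambda>x. indicator K x *\<^sub>R (norm (z x))\<^sup>2) = (\<lambda>x. (norm (z x))\<^sup>2)"
    using assms(3) by (auto simp: fun_eq_iff indicator_def)
  ultimately have "integrable lborel (\<lambda>x. (norm (z x))\<^sup>2)" by simp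
  then have "integrable lebesgue (\<lambda>x. (norm (z x))\<^sup>2)"
    by (subst integrable_completion) (auto intro: borel_measurable_integrable)
  moreover have "z \<in> borel_measurable lebesgue"
    using z by (simp add: borel_measurable_continuous_onI measurable_completion)
  ultimately show ?thesis by (simp add: L2_def)
qed

lemma L2_scaleR_integrable:
  fixes v :: "'a::euclidean_space \<Rightarrow> real" and w :: "'a \<Rightarrow> 'b::euclidean_space"
  assumes v: "v \<in> L2" and w: "w \<in> L2"
  shows "integrable lebesgue (\<lambda>x. v x *\<^sub>R w x)"
proof (rule Bochner_Integration.integrable_bound)
  have "(\<lambda>x. norm (w x)) \<in> L2"
    using w by (auto simp: L2_def intro!: borel_measurable_norm)
  then show "integrable lebesgue (\<lambda>x. v x * norm (w x))" by (rule L2_mult_integrable[OF v])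
  show "(\<lambda>x. v x *\<^sub>R w x) \<in> borel_measurable lebesgue"
    using v w by (intro borel_measurable_scaleR L2_measurable)
qed (simp add: abs_mult)

text \<open>The weight in the data constant: it equals 1 on the unit ball, where the data live, and
  being square-integrable it has integrable product with g, which is merely in
  \<open>L2\<close>.\<close>

lemma step_sq_L2: "(\<lambda>x::'a::euclidean_space. step (x \<bullet> x / 2)) \<in> L2"
proof (rule continuous_compact_support_L2[OF _ compact_cball[of 0 "sqrt 2"]])
  show "continuous_on UNIV (\<lambda>x::'a. step (x \<bullet> x / 2))"
    by (rule continuous_on_compose2[OF Ck_on_step[of 0, unfolded Ck_on.simps]]) (auto intro!: continuous_intros)
  show "step (x \<bullet> x / 2) = 0" if "x \<notin> cball 0 (sqrt 2)" for x :: 'a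
    using that by (intro step_eq_0) (simp add: norm_eq_sqrt_inner)
qed

text \<open>By Cauchy-Schwarz, pairing with a fixed function turns a curve in \<open>L2\<close> into
  a continuous scalar function, and a C^1 curve into a differentiable one. The time integrations
  below thus become one-dimensional calculus.\<close>

lemma L2_curve_pairing_continuous:
  fixes w :: "real \<Rightarrow> 'a::euclidean_space \<Rightarrow> real"
  assumes w: "L2_continuous_on I w" and z: "z \<in> L2"
  shows "continuous_on I (\<lambda>t. LINT x|lebesgue. w t x * z x)"
  unfolding continuous_on_def
proof
  fix t assume t: "t \<in> I"
  have lim: "((\<lambda>s. L2_norm (\<lambda>x. w s x - w t x) * L2_norm z) \<longlongrightarrow> 0) (at t within I)"
    using w t by (intro tendsto_mult_left_zero) (simp add: L2_continuous_on_def)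
  have "((\<lambda>s. (LINT x|lebesgue. w s x * z x) - (LINT x|lebesgue. w t x * z x)) \<longlongrightarrow> 0) (at t within I)"
  proof (rule Lim_null_comparison[OF _ lim])
    show "\<forall>\<^sub>F s in at t within I. norm ((LINT x|lebesgue. w s x * z x) - (LINT x|lebesgue. w t x * z x))
        \<le> L2_norm (\<lambda>x. w s x - w t x) * L2_norm z"
      unfolding eventually_at_filter
    proof (intro always_eventually allI impI)
      fix s assume "s \<in> I"
      then have ws: "w s \<in> L2" "w t \<in> L2" using w t by (auto simp: L2_continuous_on_def)
      have "(LINT x|lebesgue. w s x * z x) - (LINT x|lebesgue. w t x * z x)
          = (LINT x|lebesgue. (w s x - w t x) * z x)"
        using L2_mult_integrable[OF ws(1) z] L2_mult_integrable[OF ws(2) z]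
        by (simp add: left_diff_distrib)
      then show "norm ((LINT x|lebesgue. w s x * z x) - (LINT x|lebesgue. w t x * z x))
          \<le> L2_norm (\<lambda>x. w s x - w t x) * L2_norm z"
        using L2_Cauchy_Schwarz[OF L2_diff[OF ws] z] by simp
    qed
  qed
  then show "((\<lambda>t. LINT x|lebesgue. w t x * z x) \<longlongrightarrow> (LINT x|lebesgue. w t x * z x)) (at t within I)"
    by (simp add: LIM_zero_iff)
qed

lemma L2_C1_pairing_deriv:
  fixes w w' :: "real \<Rightarrow> 'a::euclidean_space \<Rightarrow> real"
  assumes w: "L2_C1_on I w w'" and z: "z \<in> L2" and t: "t \<in> I"
  shows "((\<lambda>t. LINT x|lebesgue. w t x * z x) has_real_derivative (LINT x|lebesgue. w' t x * z x)) (at t within I)"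
proof -
  have lim: "((\<lambda>s. L2_norm (\<lambda>x. (w s x - w t x) / (s - t) - w' t x) * L2_norm z) \<longlongrightarrow> 0) (at t within I)"
    using w t by (intro tendsto_mult_left_zero) (simp add: L2_C1_on_def)
  have "((\<lambda>s. ((LINT x|lebesgue. w s x * z x) - (LINT x|lebesgue. w t x * z x)) / (s - t)
      - (LINT x|lebesgue. w' t x * z x)) \<longlongrightarrow> 0) (at t within I)"
  proof (rule Lim_null_comparison[OF _ lim])
    show "\<forall>\<^sub>F s in at t within I. norm (((LINT x|lebesgue. w s x * z x) - (LINT x|lebesgue. w t x * z x)) / (s - t)
      - (LINT x|lebesgue. w' t x * z x)) \<le> L2_norm (\<lambda>x. (w s x - w t x) / (s - t) - w' t x) * L2_norm z"
      unfolding eventually_at_filter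
    proof (intro always_eventually allI impI)
      fix s assume "s \<in> I"
      then have ws: "w s \<in> L2" "w t \<in> L2" "w' t \<in> L2"
        using w t by (auto simp: L2_C1_on_def L2_continuous_on_def)
      have q: "(\<lambda>x. (w s x - w t x) / (s - t)) \<in> L2"
        using L2_cmult[OF L2_diff[OF ws(1,2)], of "1 / (s - t)"] by simp
      have "(LINT x|lebesgue. ((w s x - w t x) / (s - t) - w' t x) * z x) =
         (LINT x|lebesgue. (w s x * z x - w t x * z x) / (s - t) - w' t x * z x)"
        by (simp add: left_diff_distrib diff_divide_distrib)
      also have "\<dots> = ((LINT x|lebesgue. w s x * z x) - (LINT x|lebesgue. w t x * z x)) / (s - t)
        - (LINT x|lebesgue. w' t x * z x)"
        using ws by (simp add: L2_mult_integrable z)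
      finally show "norm (((LINT x|lebesgue. w s x * z x) - (LINT x|lebesgue. w t x * z x)) / (s - t)
        - (LINT x|lebesgue. w' t x * z x)) \<le> L2_norm (\<lambda>x. (w s x - w t x) / (s - t) - w' t x) * L2_norm z"
        using L2_Cauchy_Schwarz[OF L2_diff[OF q ws(3)] z] by simp
    qed
  qed
  then show ?thesis unfolding has_field_derivative_iff by (simp add: LIM_zero_iff)
qed

section \<open>Supports\<close>

text \<open>Off the support every point has a neighbourhood on which w vanishes almost everywhere;
  by Lindelof countably many of them suffice, and countably many null sets may be united.\<close>

lemma AE_zero_off_support:
  fixes w :: "'a::euclidean_space \<Rightarrow> real"
  shows "AE z in lebesgue. z \<in> S \<and> z \<notin> support_in S w \<longrightarrow> w z = 0"
proof -
  define F where "F = {U. open U \<and> (AE y in lebesgue. y \<in> S \<inter> U \<longrightarrow> w y = 0)}"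
  obtain F' where F': "F' \<subseteq> F" "countable F'" "\<Union>F' = \<Union>F"
    using Lindelof[of F] unfolding F_def by blast
  have "AE z in lebesgue. \<forall>U\<in>F'. z \<in> S \<inter> U \<longrightarrow> w z = 0"
    using F'(1) by (subst AE_ball_countable[OF F'(2)]) (auto simp: F_def)
  then show ?thesis
  proof eventually_elim
    case (elim z)
    have "z \<in> \<Union>F" if "z \<in> S" "z \<notin> support_in S w"
      using that unfolding support_in_def F_def by blast
    then show ?case using elim F'(3) by blast
  qed
qed

text \<open>A property holds almost everywhere for a measure iff it does for the completion, which
  moves the claim to the product of two \<open>lborel\<close> measures and its Fubini theorem for
  null sets.\<close>

lemma AE_lebesgue_pair:
  fixes P :: "'a::euclidean_space \<times> 'b::euclidean_space \<Rightarrow> bool"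
  assumes "AE z in lebesgue. P z"
  shows "AE x in lebesgue. AE y in lebesgue. P (x, y)"
proof -
  have "AE z in lborel \<Otimes>\<^sub>M lborel. P z"
    using assms unfolding lborel_prod AE_completion_iff .
  then have "AE x in lborel. AE y in lborel. P (x, y)" by (rule lborel_pair.AE_pair)
  then show ?thesis unfolding AE_completion_iff .
qed

section \<open>Radial test functions\<close>

lemma grad_eq:
  assumes "GDERIV f x :> D" shows "grad f x = D"
  unfolding grad_def using assms
proof (rule the_equality)
  fix E assume "GDERIV f x :> E"
  then have "(\<lambda>h. h \<bullet> E) = (\<lambda>h. h \<bullet> D)"
    using assms unfolding gderiv_def by (rule has_derivative_unique)
  then show "E = D" by (metis inner_commute vector_eq_rdot)
qed

lemma Ck_on_sq: "Ck_on k S (\<lambda>x::'a::euclidean_space. x \<bullet> x)"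
  by (rule Ck_on_inner; rule Ck_on_bounded_linear[OF bounded_linear_inner_left])

lemma test_functions_mult_linear:
  fixes \<phi> :: "'a::euclidean_space \<Rightarrow> real"
  assumes "\<phi> \<in> test_functions S" shows "(\<lambda>x. \<phi> x * (x \<bullet> i)) \<in> test_functions S"
proof -
  obtain K where K: "compact K" "K \<subseteq> S" "\<forall>z\<in>S - K. \<phi> z = 0"
    using assms unfolding test_functions_def by blast
  have "Ck_on k S (\<lambda>x. \<phi> x * (x \<bullet> i))" for k
    by (rule Ck_on_mult[OF _ Ck_on_bounded_linear[OF bounded_linear_inner_left]])
      (use assms in \<open>simp add: test_functions_def\<close>)
  then show ?thesis unfolding test_functions_def using K by force
qed

lemma zero_deriv_beyond:
  fixes y :: "real \<Rightarrow> real"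
  assumes "\<And>s. (y has_real_derivative y1 s) (at s)" "\<And>s. S \<le> s \<Longrightarrow> y s = 0" "S < s"
  shows "y1 s = 0"
  by (rule DERIV_locally_const[OF assms(1), of "{S<..}" s 0]) (use assms in auto)

lemma radial_test_functions:
  fixes y :: "real \<Rightarrow> real"
  assumes "\<And>k. Ck_on k UNIV y" "\<And>s. S < s \<Longrightarrow> y s = 0" "0 \<le> S"
  shows "(\<lambda>x::'a::euclidean_space. y (x \<bullet> x)) \<in> test_functions UNIV"
proof -
  have "Ck_on k UNIV (\<lambda>x::'a. y (x \<bullet> x))" for k
    by (rule Ck_on_compose[OF assms(1) Ck_on_sq])
  moreover have "y (x \<bullet> x) = 0" if "x \<notin> cball 0 (sqrt S)" for x :: 'a
    using that assms(2,3) by (simp add: dot_square_norm real_less_rsqrt not_le real_sqrt_less_iff)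
      (metis norm_ge_zero real_sqrt_ge_0_iff real_sqrt_pow2 power_strict_mono zero_less_numeral)
  ultimately show ?thesis unfolding test_functions_def using compact_cball by blast
qed

lemma radial_has_derivative:
  fixes x :: "'a::euclidean_space"
  assumes "(y has_real_derivative D) (at (x \<bullet> x))"
  shows "((\<lambda>x. y (x \<bullet> x)) has_derivative (\<lambda>h. D * (2 * (h \<bullet> x)))) (at x)"
proof -
  have "((\<lambda>x. x \<bullet> x) has_derivative (\<lambda>h. x \<bullet> h + h \<bullet> x)) (at x)"
    by (rule has_derivative_inner[OF has_derivative_ident has_derivative_ident])
  then have "((\<lambda>x. x \<bullet> x) has_derivative (\<lambda>h. 2 * (h \<bullet> x))) (at x)"
    by (simp add: inner_commute)
  from has_derivative_compose[OF this assms[unfolded has_field_derivative_def]]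
  show ?thesis .
qed

lemma grad_radial:
  fixes x :: "'a::euclidean_space"
  assumes "(y has_real_derivative D) (at (x \<bullet> x))"
  shows "grad (\<lambda>x. y (x \<bullet> x)) x = (2 * D) *\<^sub>R x"
  by (rule grad_eq) (use radial_has_derivative[OF assms] in \<open>simp add: gderiv_def mult.left_commute mult.assoc\<close>)

lemma grad_radial_component:
  fixes x :: "'a::euclidean_space"
  assumes "(y has_real_derivative D) (at (x \<bullet> x))"
  shows "grad (\<lambda>x. y (x \<bullet> x) * (x \<bullet> i)) x = (2 * D * (x \<bullet> i)) *\<^sub>R x + y (x \<bullet> x) *\<^sub>R i"
proof (rule grad_eq)
  have "((\<lambda>x. y (x \<bullet> x) * (x \<bullet> i)) has_derivative (\<lambda>h. y (x \<bullet> x) * (h \<bullet> i) + D * (2 * (h \<bullet> x)) * (x \<bullet> i))) (at x)"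
    by (rule has_derivative_mult[OF radial_has_derivative[OF assms] bounded_linear_imp_has_derivative[OF bounded_linear_inner_left]])
  then show "GDERIV (\<lambda>x. y (x \<bullet> x) * (x \<bullet> i)) x :> (2 * D * (x \<bullet> i)) *\<^sub>R x + y (x \<bullet> x) *\<^sub>R i"
    by (simp add: gderiv_def inner_add_right algebra_simps)
qed

definition lap_radial :: "(real \<Rightarrow> real) \<Rightarrow> (real \<Rightarrow> real) \<Rightarrow> 'a::euclidean_space \<Rightarrow> real" where
  "lap_radial y1 y2 x = 4 * (x \<bullet> x) * y2 (x \<bullet> x) + 2 * real DIM('a) * y1 (x \<bullet> x)"

lemma has_weak_L2_grad_weak_grad: "w \<in> H1 \<Longrightarrow> has_weak_L2_grad w (weak_grad w)"
  unfolding H1_def weak_grad_def using someI_ex[of "has_weak_L2_grad w"] by simp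

text \<open>The definition of the weak gradient integrates by parts against scalar test functions.
  Taking for these the partial derivatives \<open>\<phi> i\<close> of y(|x|^2), reading off the i-th
  component and summing over i produces the Laplacian.\<close>

lemma weak_grad_radial:
  fixes w :: "'a::euclidean_space \<Rightarrow> real"
  assumes w: "w \<in> H1"
    and y: "\<And>s. (y has_real_derivative y1 s) (at s)" "\<And>s. (y1 has_real_derivative y2 s) (at s)"
    and sm: "\<And>k. Ck_on k UNIV y1" and y2: "continuous_on UNIV y2"
    and supp: "\<And>s. S \<le> s \<Longrightarrow> y s = 0" and S: "0 \<le> S"
  shows "(LINT x|lebesgue. weak_grad w x \<bullet> grad (\<lambda>x. y (x \<bullet> x)) x) = - (LINT x|lebesgue. w x * lap_radial y1 y2 x)"
proof -
  define G where "G = weak_grad w"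
  have G: "has_weak_L2_grad w G" unfolding G_def by (rule has_weak_L2_grad_weak_grad[OF w])
  have wL: "w \<in> L2" using w by (simp add: H1_def)
  have y1z: "y1 s = 0" if "S < s" for s by (rule zero_deriv_beyond[OF y(1) supp that])
  have y2z: "y2 s = 0" if "S < s" for s
    by (rule DERIV_locally_const[OF y(2), of "{S<..}" s 0]) (use y1z that in auto)
  define \<phi> where "\<phi> i x = 2 * y1 (x \<bullet> x) * (x \<bullet> i)" for i x :: 'a
  have \<phi>: "\<phi> i \<in> test_functions UNIV" for i
  proof -
    have sm2: "Ck_on k UNIV (\<lambda>s. 2 * y1 s)" for k by (rule Ck_on_mult[OF Ck_on_const sm])
    have "(\<lambda>x::'a. 2 * y1 (x \<bullet> x)) \<in> test_functions UNIV"
      by (rule radial_test_functions[where y = "\<lambda>s. 2 * y1 s" and S = S]) (use sm2 y1z S in auto)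
    then show ?thesis unfolding \<phi>_def[abs_def] by (rule test_functions_mult_linear)
  qed
  have gphi: "grad (\<phi> i) x = (4 * y2 (x \<bullet> x) * (x \<bullet> i)) *\<^sub>R x + (2 * y1 (x \<bullet> x)) *\<^sub>R i" for i x
    using grad_radial_component[of "\<lambda>s. 2 * y1 s" "2 * y2 (x \<bullet> x)" x i] DERIV_cmult[OF y(2), of "2" "x \<bullet> x"]
    by (simp add: \<phi>_def[abs_def])
  have lap: "(\<Sum>i\<in>Basis. grad (\<phi> i) x \<bullet> i) = lap_radial y1 y2 x" for x
  proof -
    have "(\<Sum>i\<in>Basis. grad (\<phi> i) x \<bullet> i) = (\<Sum>i\<in>Basis. 4 * y2 (x \<bullet> x) * ((x \<bullet> i) * (x \<bullet> i)) + 2 * y1 (x \<bullet> x))"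
      by (intro sum.cong) (auto simp: gphi inner_add_left)
    also have "\<dots> = 4 * y2 (x \<bullet> x) * (x \<bullet> x) + 2 * real DIM('a) * y1 (x \<bullet> x)"
      unfolding euclidean_inner[of x x] by (simp add: sum.distrib sum_distrib_left)
    finally show ?thesis by (simp add: lap_radial_def)
  qed
  have sq: "S < x \<bullet> x" if "x \<notin> cball 0 (sqrt S)" for x :: 'a
    using that S real_less_lsqrt[of "x \<bullet> x" "sqrt S"] by (simp add: norm_eq_sqrt_inner)
  have cont: "continuous_on UNIV (\<lambda>x::'a. h (x \<bullet> x))" if "continuous_on UNIV h" for h :: "real \<Rightarrow> real"
    by (rule continuous_on_compose2[OF that]) (auto intro!: continuous_intros)
  have y1c: "continuous_on UNIV y1" using sm[of 0] by simp
  have phiL: "\<phi> i \<in> L2" for i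
    by (rule continuous_compact_support_L2[OF _ compact_cball[of 0 "sqrt S"]])
      (auto simp: \<phi>_def[abs_def] y1z sq intro!: continuous_intros cont y1c)
  have gradL: "grad (\<phi> i) \<in> L2" for i
    by (rule continuous_compact_support_L2[OF _ compact_cball[of 0 "sqrt S"]])
      (auto simp: gphi y1z y2z sq intro!: continuous_intros cont y1c y2 simp flip: gphi[abs_def])
  have GL: "G \<in> L2" using G by (simp add: has_weak_L2_grad_def)
  have ibp: "(LINT x|lebesgue. w x * (grad (\<phi> i) x \<bullet> i)) = - (LINT x|lebesgue. \<phi> i x * (G x \<bullet> i))" for i
  proof -
    have "(LINT x|lebesgue. w x *\<^sub>R grad (\<phi> i) x) \<bullet> i = - (LINT x|lebesgue. \<phi> i x *\<^sub>R G x) \<bullet> i"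
      using G \<phi>[of i] unfolding has_weak_L2_grad_def by simp
    then show ?thesis
      using integral_inner_left[OF L2_scaleR_integrable[OF wL gradL], of i i]
        integral_inner_left[OF L2_scaleR_integrable[OF phiL GL], of i i] by simp
  qed
  have int1: "integrable lebesgue (\<lambda>x. w x * (grad (\<phi> i) x \<bullet> i))" for i
    using integrable_inner_left[OF L2_scaleR_integrable[OF wL gradL], of i i] by simp
  have int2: "integrable lebesgue (\<lambda>x. \<phi> i x * (G x \<bullet> i))" for i
    using integrable_inner_left[OF L2_scaleR_integrable[OF phiL GL], of i i] by simp
  have "G x \<bullet> grad (\<lambda>x. y (x \<bullet> x)) x = (\<Sum>i\<in>Basis. \<phi> i x * (G x \<bullet> i))" for x
  proof -
    have "G x \<bullet> x = (\<Sum>i\<in>Basis. (G x \<bullet> i) * (x \<bullet> i))" by (rule euclidean_inner)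
    then show ?thesis unfolding grad_radial[OF y(1)] \<phi>_def
      by (simp add: sum_distrib_left mult.assoc mult.left_commute mult.commute)
  qed
  then have "(LINT x|lebesgue. G x \<bullet> grad (\<lambda>x. y (x \<bullet> x)) x) = (\<Sum>i\<in>Basis. (LINT x|lebesgue. \<phi> i x * (G x \<bullet> i)))"
    using int2 by (simp add: Bochner_Integration.integral_sum)
  also have "\<dots> = - (\<Sum>i\<in>Basis. (LINT x|lebesgue. w x * (grad (\<phi> i) x \<bullet> i)))"
    by (simp add: ibp sum_negf)
  also have "\<dots> = - (LINT x|lebesgue. (\<Sum>i\<in>Basis. w x * (grad (\<phi> i) x \<bullet> i)))"
    using int1 by (simp add: Bochner_Integration.integral_sum)
  also have "\<dots> = - (LINT x|lebesgue. w x * lap_radial y1 y2 x)"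
    by (simp only: lap flip: sum_distrib_left)
  finally show ?thesis unfolding G_def .
qed

section \<open>Radial integrals\<close>

lemma power_diff_le:
  fixes j :: real assumes "0 \<le> j" shows "(j + 1) ^ n - j ^ n \<le> real n * (j + 1) ^ (n - 1)"
proof (induction n)
  case (Suc n)
  have "(j + 1) ^ Suc n - j ^ Suc n = (j + 1) * ((j + 1) ^ n - j ^ n) + j ^ n" by (simp add: algebra_simps)
  also have "\<dots> \<le> (j + 1) * (real n * (j + 1) ^ (n - 1)) + (j + 1) ^ n"
    using Suc.IH assms by (intro add_mono mult_left_mono power_mono) auto
  also have "\<dots> = real (Suc n) * (j + 1) ^ (Suc n - 1)" by (cases n) (simp_all add: algebra_simps)
  finally show ?case .
qed simp

definition shell :: "nat \<Rightarrow> 'a::euclidean_space set" where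
  "shell j = ball 0 (real j + 1) - ball 0 (real j)"

lemma mem_shell: "x \<in> shell j \<longleftrightarrow> real j \<le> norm x \<and> norm x < real j + 1"
  by (auto simp: shell_def)

definition shell_const :: "'a::euclidean_space itself \<Rightarrow> real" where
  "shell_const _ = unit_ball_vol (real DIM('a)) * real DIM('a)"

lemma shell_const_nonneg: "0 \<le> shell_const TYPE('a::euclidean_space)"
  by (simp add: shell_const_def)

lemma shell_lmeasurable: "shell j \<in> lmeasurable"
  unfolding shell_def by (intro fmeasurable.Diff) auto

lemma measure_shell:
  "measure lebesgue (shell j :: 'a::euclidean_space set)
    \<le> shell_const TYPE('a) * (1 + real j) ^ (DIM('a) - 1)"
proof -
  have "measure lebesgue (shell j :: 'a set)
      = measure lebesgue (ball (0::'a) (real j + 1)) - measure lebesgue (ball (0::'a) (real j))"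
    unfolding shell_def by (rule measurable_measure_Diff) auto
  also have "\<dots> = unit_ball_vol (real DIM('a)) * ((real j + 1) ^ DIM('a) - real j ^ DIM('a))"
    by (simp add: content_ball right_diff_distrib)
  also have "\<dots> \<le> unit_ball_vol (real DIM('a)) * (real DIM('a) * (real j + 1) ^ (DIM('a) - 1))"
    by (intro mult_left_mono power_diff_le) auto
  finally show ?thesis by (simp add: shell_const_def add.commute mult.assoc)
qed

text \<open>Integrals of radial functions are bounded by step functions on unit shells, instead of polar
  coordinates.\<close>

lemma shell_majorant:
  fixes G :: "nat \<Rightarrow> real"
  assumes G: "\<And>j. 0 \<le> G j"
  obtains g :: "'a::euclidean_space \<Rightarrow> real" where "integrable lebesgue g" "\<And>x. 0 \<le> g x"
    "\<And>j x. j < N \<Longrightarrow> real j \<le> norm x \<Longrightarrow> norm x < real j + 1 \<Longrightarrow> G j \<le> g x"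
    "(LINT x|lebesgue. g x) \<le> shell_const TYPE('a) * (\<Sum>j<N. G j * (1 + real j) powr (real DIM('a) - 1))"
proof -
  define g :: "'a \<Rightarrow> real" where "g x = (\<Sum>j<N. G j * indicator (shell j) x)" for x
  have int: "integrable lebesgue (\<lambda>x. G j * indicator (shell j) x)" for j
    using shell_lmeasurable[of j] by (intro integrable_mult_right integrable_real_indicator)
      (auto simp: fmeasurable_def)
  show ?thesis
  proof (rule that[of g])
    show "integrable lebesgue g" unfolding g_def[abs_def] using int by (intro Bochner_Integration.integrable_sum)
    show "0 \<le> g x" for x unfolding g_def using G by (intro sum_nonneg) auto
    show "G j \<le> g x" if "j < N" "real j \<le> norm x" "norm x < real j + 1" for j x
    proof -
      have "G j * indicator (shell j) x \<le> g x"
        unfolding g_def by (rule member_le_sum) (use G that in auto)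
      then show ?thesis using that by (simp add: mem_shell)
    qed
    have "(LINT x|lebesgue. g x) = (\<Sum>j<N. G j * measure lebesgue (shell j :: 'a set))"
      unfolding g_def using int shell_lmeasurable by (subst Bochner_Integration.integral_sum) auto
    also have "\<dots> \<le> (\<Sum>j<N. G j * (shell_const TYPE('a) * (1 + real j) ^ (DIM('a) - 1)))"
      by (intro sum_mono mult_left_mono measure_shell G)
    also have "\<dots> = shell_const TYPE('a) * (\<Sum>j<N. G j * (1 + real j) ^ (DIM('a) - 1))"
      by (simp add: sum_distrib_left mult.left_commute)
    also have "(\<lambda>j. (1 + real j) ^ (DIM('a) - 1)) = (\<lambda>j. (1 + real j) powr (real DIM('a) - 1))"
    proof
      fix j
      have "(1 + real j) ^ (DIM('a) - 1) = (1 + real j) powr real (DIM('a) - 1)"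
        by (subst powr_realpow) auto
      also have "real (DIM('a) - 1) = real DIM('a) - 1" by (simp add: of_nat_diff DIM_positive Suc_leI)
      finally show "(1 + real j) ^ (DIM('a) - 1) = (1 + real j) powr (real DIM('a) - 1)" .
    qed
    finally show "(LINT x|lebesgue. g x) \<le> shell_const TYPE('a) * (\<Sum>j<N. G j * (1 + real j) powr (real DIM('a) - 1))"
      by (simp add: fun_eq_iff)
  qed
qed

lemma add_powr_le:
  fixes a b q :: real
  assumes "0 \<le> a" "0 \<le> b" "0 \<le> q" shows "(a + b) powr q \<le> 2 powr q * (a powr q + b powr q)"
proof -
  have "(a + b) powr q \<le> (2 * max a b) powr q" using assms by (intro powr_mono2) auto
  also have "\<dots> = 2 powr q * (max a b) powr q" using assms by (simp add: powr_mult)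
  also have "(max a b) powr q \<le> a powr q + b powr q" by (auto simp: max_def)
  finally show ?thesis by (simp add: mult_left_mono)
qed

text \<open>For \<open>q \<le> n - 1\<close> the summands are increasing after replacing \<open>2q\<close> by \<open>q\<close>; otherwise
  \<open>2q > n\<close> and the series converges.\<close>

lemma sum_powr_bound:
  fixes n q :: real
  assumes n: "2 \<le> n" and q: "1 < q"
  obtains C where "0 \<le> C"
    "\<And>N X. 1 \<le> X \<Longrightarrow> real N \<le> X \<Longrightarrow>
      (\<Sum>j<N. (1 + real j) powr (n - 1 - 2 * q)) \<le> C * X powr (n - (if q < n then q else 1))"
proof (cases "q \<le> n - 1")
  case True
  show ?thesis
  proof (rule that[of 1])
    fix N :: nat and X :: real assume X: "1 \<le> X" "real N \<le> X"
    have "(\<Sum>j<N. (1 + real j) powr (n - 1 - 2 * q)) \<le> (\<Sum>j<N. X powr (n - 1 - q))"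
    proof (rule sum_mono)
      fix j assume "j \<in> {..<N}"
      then have j: "1 + real j \<le> X" using X by auto
      have "(1 + real j) powr (n - 1 - 2 * q) \<le> (1 + real j) powr (n - 1 - q)"
        using q by (intro powr_mono) auto
      also have "\<dots> \<le> X powr (n - 1 - q)" using True j by (intro powr_mono2) auto
      finally show "(1 + real j) powr (n - 1 - 2 * q) \<le> X powr (n - 1 - q)" .
    qed
    also have "\<dots> = real N * X powr (n - 1 - q)" by simp
    also have "\<dots> \<le> X * X powr (n - 1 - q)" using X by (intro mult_right_mono) auto
    also have "\<dots> = X powr (n - q)" using X by (simp add: powr_mult_base)
    finally show "(\<Sum>j<N. (1 + real j) powr (n - 1 - 2 * q)) \<le> 1 * X powr (n - (if q < n then q else 1))"
      using True by simp
  qed simp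
next
  case False
  then have "n - 1 - 2 * q < -1" using n by simp
  then have "summable (\<lambda>j. real j powr (n - 1 - 2 * q))" by (simp add: summable_real_powr_iff)
  then have "summable (\<lambda>j. real (Suc j) powr (n - 1 - 2 * q))" by (subst summable_Suc_iff)
  then have sm: "summable (\<lambda>j. (1 + real j) powr (n - 1 - 2 * q))" by simp
  let ?C = "\<Sum>j. (1 + real j) powr (n - 1 - 2 * q)"
  have C: "0 \<le> ?C" by (intro suminf_nonneg sm) auto
  show ?thesis
  proof (rule that[OF C])
    fix N :: nat and X :: real assume X: "1 \<le> X" "real N \<le> X"
    have "(\<Sum>j<N. (1 + real j) powr (n - 1 - 2 * q)) \<le> ?C * 1"
      using sum_le_suminf[OF sm, of "{..<N}"] by simp
    \<comment> \<open>In both branches the exponent is nonnegative, so a convergent series is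
      dominated by its value times this power of X.\<close>
    also have "\<dots> \<le> ?C * X powr (n - (if q < n then q else 1))"
      using X n C by (intro mult_left_mono ge_one_powr_ge_zero) auto
    finally show "(\<Sum>j<N. (1 + real j) powr (n - 1 - 2 * q)) \<le> ?C * X powr (n - (if q < n then q else 1))" .
  qed
qed

text \<open>The part 1/R contributes R^(n-q), and so does V as long as q < n. For q \<ge> n the
  power R^(n-1) is recorded, which becomes the exponent of the first case of the theorem. The bound
  is phrased through a majorant because \<open>slice_estimate\<close> integrates one.\<close>

lemma ball_integral_potential:
  fixes V :: "'a::euclidean_space \<Rightarrow> real"
  assumes n: "2 \<le> DIM('a)" and q: "1 < q"
    and V: "\<And>x. 0 \<le> V x \<and> V x \<le> \<mu> / (1 + norm x)\<^sup>2" and \<mu>: "0 \<le> \<mu>"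
  obtains C where "0 \<le> C" "\<And>R. 1 \<le> R \<Longrightarrow> \<exists>g. integrable lebesgue g \<and> (\<forall>x. 0 \<le> g x) \<and>
    (\<forall>x. norm x \<le> R + 1 \<longrightarrow> (1 / R + V x) powr q \<le> g x) \<and>
    (LINT x|lebesgue. g x) \<le> C * R powr (real DIM('a) - (if q < real DIM('a) then q else 1))"
proof -
  define n where "n = real DIM('a)"
  define s where "s = (if q < n then q else 1)"
  have n2: "2 \<le> n" using n by (simp add: n_def)
  obtain Z where Z: "0 \<le> Z" "\<And>N X. 1 \<le> X \<Longrightarrow> real N \<le> X \<Longrightarrow>
      (\<Sum>j<N. (1 + real j) powr (n - 1 - 2 * q)) \<le> Z * X powr (n - s)"
    using sum_powr_bound[OF n2 q] unfolding s_def by metis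
  define C where "C = shell_const TYPE('a) * (2 powr q * (4 powr n + \<mu> powr q * (Z * 4 powr (n - s))))"
  show ?thesis
  proof (rule that[of C])
    show "0 \<le> C" unfolding C_def using Z(1) shell_const_nonneg[where 'a = 'a] by simp
    fix R :: real assume R: "1 \<le> R"
    define N where "N = nat \<lfloor>R + 1\<rfloor> + 1"
    have N: "R + 1 < real N" "real N \<le> 4 * R" using R by (auto simp: N_def) linarith+
    define G where "G j = 2 powr q * (R powr (- q) + \<mu> powr q * (1 + real j) powr (- 2 * q))" for j
    have G0: "0 \<le> G j" for j unfolding G_def by simp
    obtain g :: "'a \<Rightarrow> real" where g: "integrable lebesgue g" "\<And>x. 0 \<le> g x"
      "\<And>j x. j < N \<Longrightarrow> real j \<le> norm x \<Longrightarrow> norm x < real j + 1 \<Longrightarrow> G j \<le> g x"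
      "(LINT x|lebesgue. g x) \<le> shell_const TYPE('a) * (\<Sum>j<N. G j * (1 + real j) powr (real DIM('a) - 1))"
      by (rule shell_majorant[OF G0, where N = N]) (rule that)
    have "(1 / R + V x) powr q \<le> g x" if x: "norm x \<le> R + 1" for x
    proof -
      define j where "j = nat \<lfloor>norm x\<rfloor>"
      have "real j = of_int \<lfloor>norm x\<rfloor>" by (simp add: j_def)
      then have j: "real j \<le> norm x" "norm x < real j + 1" by linarith+
      have "real j < real N" using j x N by linarith
      then have "G j \<le> g x" using g(3)[of j x] j by simp
      have "V x \<le> \<mu> / (1 + real j)\<^sup>2"
        by (rule order_trans[OF conjunct2[OF V]]) (use j \<mu> in \<open>intro divide_left_mono power_mono mult_pos_pos; simp\<close>)
      then have "(1 / R + V x) powr q \<le> (1 / R + \<mu> / (1 + real j)\<^sup>2) powr q"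
        using V[of x] R q by (intro powr_mono2) auto
      also have "\<dots> \<le> 2 powr q * ((1 / R) powr q + (\<mu> / (1 + real j)\<^sup>2) powr q)"
        using R \<mu> q by (intro add_powr_le) auto
      also have "(1 / R) powr q = R powr (- q)" using R by (simp add: powr_divide powr_minus_divide)
      also have "(\<mu> / (1 + real j)\<^sup>2) powr q = \<mu> powr q * (1 + real j) powr (- 2 * q)"
      proof -
        have "(1 + real j)\<^sup>2 = (1 + real j) powr 2" by (simp add: powr_numeral)
        then have "((1 + real j)\<^sup>2) powr q = (1 + real j) powr (2 * q)" by (simp only: powr_powr)
        then show ?thesis using \<mu> by (simp add: powr_divide powr_minus_divide)
      qed
      finally show ?thesis using \<open>G j \<le> g x\<close> unfolding G_def by linarith
    qed
    moreover have "(LINT x|lebesgue. g x) \<le> C * R powr (n - s)"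
    proof -
      have "(\<Sum>j<N. G j * (1 + real j) powr (n - 1))
        = 2 powr q * (R powr (- q) * (\<Sum>j<N. (1 + real j) powr (n - 1))
          + \<mu> powr q * (\<Sum>j<N. (1 + real j) powr (n - 1 - 2 * q)))"
        unfolding G_def by (simp add: sum_distrib_left sum.distrib algebra_simps flip: powr_add)
      also have "\<dots> \<le> 2 powr q * (4 powr n * R powr (n - s) + \<mu> powr q * (Z * 4 powr (n - s) * R powr (n - s)))"
      proof (intro mult_left_mono add_mono)
        have "(\<Sum>j<N. (1 + real j) powr (n - 1)) \<le> (\<Sum>j<N. (4 * R) powr (n - 1))"
          using N n2 by (intro sum_mono powr_mono2) auto
        also have "\<dots> = real N * (4 * R) powr (n - 1)" by simp
        also have "\<dots> \<le> (4 * R) * (4 * R) powr (n - 1)" using N by (intro mult_right_mono) auto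
        also have "\<dots> = (4 * R) powr n" using R powr_mult_base[of "4 * R" "n - 1"] by simp
        also have "\<dots> = 4 powr n * R powr n" using R by (simp add: powr_mult)
        finally have "R powr (- q) * (\<Sum>j<N. (1 + real j) powr (n - 1)) \<le> R powr (- q) * (4 powr n * R powr n)"
          by (intro mult_left_mono) auto
        also have "\<dots> = 4 powr n * R powr (n - q)" by (simp add: powr_diff powr_minus_divide)
        also have "\<dots> \<le> 4 powr n * R powr (n - s)" using R q by (intro mult_left_mono powr_mono) (auto simp: s_def)
        finally show "R powr (- q) * (\<Sum>j<N. (1 + real j) powr (n - 1)) \<le> 4 powr n * R powr (n - s)" .
        have "(\<Sum>j<N. (1 + real j) powr (n - 1 - 2 * q)) \<le> Z * (4 * R) powr (n - s)"
          using N R by (intro Z(2)) auto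
        also have "\<dots> = Z * 4 powr (n - s) * R powr (n - s)" using R by (simp add: powr_mult)
        finally show "(\<Sum>j<N. (1 + real j) powr (n - 1 - 2 * q)) \<le> Z * 4 powr (n - s) * R powr (n - s)" .
      qed auto
      finally have "shell_const TYPE('a) * (\<Sum>j<N. G j * (1 + real j) powr (n - 1)) \<le>
        shell_const TYPE('a) * (2 powr q * (4 powr n * R powr (n - s) + \<mu> powr q * (Z * 4 powr (n - s) * R powr (n - s))))"
        using shell_const_nonneg[where 'a = 'a] by (intro mult_left_mono)
      also have "\<dots> = C * R powr (n - s)" by (simp add: C_def algebra_simps)
      finally show ?thesis using g(4) unfolding n_def by linarith
    qed
    ultimately show "\<exists>g. integrable lebesgue g \<and> (\<forall>x. 0 \<le> g x) \<and>
      (\<forall>x. norm x \<le> R + 1 \<longrightarrow> (1 / R + V x) powr q \<le> g x) \<and>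
      (LINT x|lebesgue. g x) \<le> C * R powr (real DIM('a) - (if q < real DIM('a) then q else 1))"
      using g(1,2) unfolding n_def s_def by blast
  qed
qed

section \<open>Integrals concentrated near the light cone\<close>

lemma powr_le_exp:
  fixes k a y :: real
  assumes "0 \<le> k" "0 < a" "0 < y"
  shows "y powr k \<le> (a / (k + 1)) powr (- k) * exp (a * y)"
proof -
  \<comment> \<open>The denominator k + 1 in place of k keeps \<delta> finite and positive at k = 0
    as well; the inequality is \<open>ln z \<le> z - 1\<close> at z = \<delta> y.\<close>
  define \<delta> where "\<delta> = a / (k + 1)"
  have \<delta>: "\<delta> > 0" "k * \<delta> \<le> a" using assms by (auto simp: \<delta>_def field_simps)
  have "ln (\<delta> * y) \<le> \<delta> * y" using ln_le_minus_one[of "\<delta> * y"] \<delta> assms by simp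
  then have "ln y \<le> \<delta> * y - ln \<delta>" using \<delta> assms by (simp add: ln_mult)
  then have "k * ln y \<le> k * (\<delta> * y - ln \<delta>)" using assms by (intro mult_left_mono)
  also have "\<dots> \<le> a * y - k * ln \<delta>" using \<delta>(2) assms by (simp add: right_diff_distrib mult_right_mono flip: mult.assoc)
  finally have "exp (k * ln y) \<le> exp (a * y - k * ln \<delta>)" by simp
  also have "\<dots> = exp (- k * ln \<delta>) * exp (a * y)" by (simp flip: exp_add)
  finally show ?thesis using assms \<delta> by (simp add: powr_def \<delta>_def)
qed

text \<open>Inside the cone, 1 + j and 1 + t differ in either direction by at most the factor 3 + t
  - j, which measures the distance to the cone. So the weight may be evaluated at t at the cost of a
  power of that distance, for either sign of c.\<close>

lemma powr_weight_transfer: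
  fixes t j c :: real
  assumes "0 \<le> t" "0 \<le> j" "j \<le> t + 1"
  shows "(1 + j) powr c \<le> (1 + t) powr c * (3 + t - j) powr \<bar>c\<bar>"
proof (cases "0 \<le> c")
  case True
  have "1 * (t + 1) \<le> (2 + t - j) * (t + 1)" using assms by (intro mult_right_mono) auto
  moreover have "0 \<le> t * (t + 1 - j)" using assms by simp
  ultimately have "1 + j \<le> (1 + t) * (3 + t - j)" using assms by (simp add: algebra_simps)
  then have "(1 + j) powr c \<le> ((1 + t) * (3 + t - j)) powr c" using True assms by (intro powr_mono2) auto
  then show ?thesis using True assms by (simp add: powr_mult)
next
  case False
  have "0 \<le> j * (t + 1 - j)" using assms by simp
  then have "1 + t \<le> (1 + j) * (3 + t - j)" using assms by (simp add: algebra_simps)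
  then have "(1 + t) powr (- c) \<le> ((1 + j) * (3 + t - j)) powr (- c)" using False assms by (intro powr_mono2) auto
  also have "\<dots> = (1 + j) powr (- c) * (3 + t - j) powr (- c)" using assms by (simp add: powr_mult)
  finally have "(1 + t) powr (- c) * ((1 + t) powr c * (1 + j) powr c)
      \<le> (1 + j) powr (- c) * (3 + t - j) powr (- c) * ((1 + t) powr c * (1 + j) powr c)"
    by (rule mult_right_mono) auto
  then show ?thesis using False assms by (simp add: powr_minus field_simps)
qed

lemma geometric_exp_bound:
  fixes a t :: real
  assumes "0 < a" "real N \<le> t + 2"
  shows "(\<Sum>j<N. exp (- (a * (3 + t - real j)))) \<le> 1 / (1 - exp (- a))"
proof -
  have e: "exp (- a) < 1" "0 < exp (- a)" using assms by auto
  have "(\<Sum>j<N. exp (- (a * (3 + t - real j)))) \<le> (\<Sum>j<N. exp (- a) ^ (N - Suc j))"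
  proof (rule sum_mono)
    fix j assume "j \<in> {..<N}"
    then have "real (N - Suc j) \<le> 3 + t - real j" using assms(2) by auto
    then have "a * real (N - Suc j) \<le> a * (3 + t - real j)" using assms(1) by (intro mult_left_mono) auto
    then show "exp (- (a * (3 + t - real j))) \<le> exp (- a) ^ (N - Suc j)"
      by (simp add: mult.commute flip: exp_of_nat_mult)
  qed
  also have "\<dots> = (\<Sum>j<N. exp (- a) ^ j)" by (rule sum.nat_diff_reindex)
  also have "\<dots> \<le> (\<Sum>j. exp (- a) ^ j)" using e by (intro sum_le_suminf summable_geometric) auto
  also have "\<dots> = 1 / (1 - exp (- a))" using e by (intro suminf_geometric) auto
  finally show ?thesis .
qed

text \<open>The factor e^(q(r-t)) concentrates the integral where r is within bounded distance of t.
  There the remaining factors (1+r)^(-mq) and (1+r)^(n-1) combine to (1+r)^c with c = (n-1)(1-q/2),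
  and t is comparable to R.\<close>

lemma ball_integral_profile:
  assumes q: "1 < q"
  obtains C where "0 \<le> C" "\<And>R t. 1 \<le> R \<Longrightarrow> R / 2 \<le> t \<Longrightarrow> t \<le> R \<Longrightarrow>
    \<exists>g :: 'a::euclidean_space \<Rightarrow> real. integrable lebesgue g \<and> (\<forall>x. 0 \<le> g x) \<and>
    (\<forall>x. norm x \<le> t + 1 \<longrightarrow> (exp (- t) * (exp (norm x) * (1 + norm x) powr (- ((real DIM('a) - 1) / 2)))) powr q \<le> g x) \<and>
    (LINT x|lebesgue. g x) \<le> C * R powr ((real DIM('a) - 1) * (1 - q / 2))"
proof -
  define n where "n = real DIM('a)"
  define m where "m = (n - 1) / 2"
  define c where "c = (n - 1) * (1 - q / 2)"
  define B where "B = (q / 2 / (\<bar>c\<bar> + 1)) powr (- \<bar>c\<bar>)"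
  define D where "D = exp (4 * q) * B / (1 - exp (- (q / 2)))"
  define C where "C = shell_const TYPE('a) * (D * 2 powr \<bar>c\<bar>)"
  have n1: "1 \<le> n" using DIM_positive[where 'a = 'a] by (simp add: n_def Suc_leI)
  have B0: "0 \<le> B" by (simp add: B_def)
  have D0: "0 \<le> D" unfolding D_def using B0 q by (intro divide_nonneg_nonneg mult_nonneg_nonneg) auto
  show ?thesis
  proof (rule that[of C])
    show "0 \<le> C" unfolding C_def using D0 shell_const_nonneg[where 'a = 'a] by simp
    fix R t :: real assume R: "1 \<le> R" and t: "R / 2 \<le> t" "t \<le> R"
    have t0: "0 \<le> t" using R t by simp
    define N where "N = nat \<lfloor>t + 1\<rfloor> + 1"
    have N: "t + 1 < real N" "real N \<le> t + 2" using t0 by (auto simp: N_def) linarith+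
    define G where "G j = exp (q * (real j + 1 - t)) * (1 + real j) powr (- (m * q))" for j
    have G0: "0 \<le> G j" for j unfolding G_def by simp
    obtain g :: "'a \<Rightarrow> real" where g: "integrable lebesgue g" "\<And>x. 0 \<le> g x"
      "\<And>j x. j < N \<Longrightarrow> real j \<le> norm x \<Longrightarrow> norm x < real j + 1 \<Longrightarrow> G j \<le> g x"
      "(LINT x|lebesgue. g x) \<le> shell_const TYPE('a) * (\<Sum>j<N. G j * (1 + real j) powr (real DIM('a) - 1))"
      by (rule shell_majorant[OF G0, where N = N]) (rule that)
    have "(exp (- t) * (exp (norm x) * (1 + norm x) powr (- m))) powr q \<le> g x" if x: "norm x \<le> t + 1" for x
    proof -
      define j where "j = nat \<lfloor>norm x\<rfloor>"
      have "real j = of_int \<lfloor>norm x\<rfloor>" by (simp add: j_def)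
      then have j: "real j \<le> norm x" "norm x < real j + 1" by linarith+
      have "real j < real N" using j x N by linarith
      then have Gg: "G j \<le> g x" using g(3)[of j x] j by simp
      have m0: "0 \<le> m" using n1 by (simp add: m_def)
      have "exp (- t) * (exp (norm x) * (1 + norm x) powr (- m))
         \<le> exp (- t) * (exp (real j + 1) * (1 + real j) powr (- m))"
        using j m0 by (intro mult_left_mono mult_mono powr_mono2') auto
      also have "\<dots> = exp (real j + 1 - t) * (1 + real j) powr (- m)" by (simp add: exp_diff exp_minus field_simps)
      finally have "(exp (- t) * (exp (norm x) * (1 + norm x) powr (- m))) powr q
         \<le> (exp (real j + 1 - t) * (1 + real j) powr (- m)) powr q"
        using q by (intro powr_mono2) auto
      also have "\<dots> = G j" by (simp add: G_def powr_mult powr_powr exp_powr_real mult.commute)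
      finally show ?thesis using Gg by linarith
    qed
    moreover have "(LINT x|lebesgue. g x) \<le> C * R powr c"
    proof -
      have "(\<Sum>j<N. G j * (1 + real j) powr (n - 1))
         \<le> (\<Sum>j<N. exp (4 * q) * B * (1 + t) powr c * exp (- (q / 2 * (3 + t - real j))))"
      proof (rule sum_mono)
        fix j assume "j \<in> {..<N}"
        then have jt: "real j \<le> t + 1" using N by auto
        let ?y = "3 + t - real j"
        have "G j * (1 + real j) powr (n - 1) = exp (q * (real j + 1 - t)) * (1 + real j) powr c"
          unfolding G_def mult.assoc powr_add[symmetric] by (simp add: m_def c_def algebra_simps diff_divide_distrib)
        also have "\<dots> \<le> exp (q * (real j + 1 - t)) * ((1 + t) powr c * ?y powr \<bar>c\<bar>)"
          using t0 jt by (intro mult_left_mono powr_weight_transfer) auto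
        \<comment> \<open>Since j + 1 - t = 4 - y for y = 3 + t - j, the exponential is e^(4q)
          e^(-qy). Half of its decay absorbs the power of y; the other half is summed as a geometric
          series.\<close>
        also have "\<dots> \<le> exp (q * (real j + 1 - t)) * ((1 + t) powr c * (B * exp (q / 2 * ?y)))"
          unfolding B_def using q jt by (intro mult_left_mono powr_le_exp) auto
        also have "\<dots> = B * (1 + t) powr c * (exp (q * (real j + 1 - t)) * exp (q / 2 * ?y))"
          by (simp add: mult_ac)
        also have "exp (q * (real j + 1 - t)) * exp (q / 2 * ?y) = exp (4 * q) * exp (- (q / 2 * ?y))"
          unfolding exp_add[symmetric] by (rule arg_cong[where f = exp]) (simp add: field_simps)
        finally show "G j * (1 + real j) powr (n - 1) \<le> exp (4 * q) * B * (1 + t) powr c * exp (- (q / 2 * ?y))"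
          by (simp add: mult_ac)
      qed
      also have "\<dots> = exp (4 * q) * B * (1 + t) powr c * (\<Sum>j<N. exp (- (q / 2 * (3 + t - real j))))"
        by (simp add: sum_distrib_left)
      also have "\<dots> \<le> exp (4 * q) * B * (1 + t) powr c * (1 / (1 - exp (- (q / 2))))"
        using q N B0 by (intro mult_left_mono geometric_exp_bound) auto
      also have "\<dots> = D * (1 + t) powr c" by (simp add: D_def)
      also have "\<dots> \<le> D * (2 powr \<bar>c\<bar> * R powr c)"
      proof (intro mult_left_mono D0)
        show "(1 + t) powr c \<le> 2 powr \<bar>c\<bar> * R powr c"
        proof (cases "0 \<le> c")
          case True
          then have "(1 + t) powr c \<le> (2 * R) powr c" using R t by (intro powr_mono2) auto
          then show ?thesis using True R by (simp add: powr_mult)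
        next
          case False
          then have "(1 + t) powr c \<le> (R / 2) powr c" using R t by (intro powr_mono2') auto
          then show ?thesis using False R by (simp add: powr_divide powr_minus_divide)
        qed
      qed
      finally have "shell_const TYPE('a) * (\<Sum>j<N. G j * (1 + real j) powr (n - 1)) \<le>
        shell_const TYPE('a) * (D * (2 powr \<bar>c\<bar> * R powr c))"
        using shell_const_nonneg[where 'a = 'a] by (intro mult_left_mono)
      then show ?thesis using g(4) unfolding n_def C_def by (simp add: mult_ac)
    qed
    ultimately show "\<exists>g :: 'a::euclidean_space \<Rightarrow> real. integrable lebesgue g \<and> (\<forall>x. 0 \<le> g x) \<and>
    (\<forall>x. norm x \<le> t + 1 \<longrightarrow> (exp (- t) * (exp (norm x) * (1 + norm x) powr (- ((real DIM('a) - 1) / 2)))) powr q \<le> g x) \<and>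
    (LINT x|lebesgue. g x) \<le> C * R powr ((real DIM('a) - 1) * (1 - q / 2))"
      using g(1,2) unfolding n_def m_def c_def by blast
  qed
qed

section \<open>The weak formulation for separated test functions\<close>

text \<open>Makes derivatives within [0,T) unique, including at t = 0, so that the time derivative
  of a product test function is a'(t) Y(x).\<close>

lemma time_ivl_not_isolated:
  assumes "t \<in> time_ivl T" shows "at t within time_ivl T \<noteq> bot"
proof -
  obtain b where b: "ereal t < ereal b" "ereal b < T"
    using assms ereal_dense2[of "ereal t" T] by (auto simp: time_ivl_def)
  have "{t..b} \<subseteq> time_ivl T"
    using assms b by (auto simp: time_ivl_def intro: le_less_trans[of "ereal _" "ereal b"])
  moreover have "t islimpt {t..b}" using b by (simp add: islimpt_Icc)
  ultimately have "t islimpt time_ivl T" by (rule islimpt_subset[rotated])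
  then show ?thesis by (simp add: trivial_limit_within)
qed

lemma Icc_subset_time_ivl: "ereal R < T \<Longrightarrow> {0..R} \<subseteq> time_ivl T"
  by (auto simp: time_ivl_def intro: le_less_trans[of "ereal _" "ereal R"])

text \<open>The support is a space-time notion for almost-everywhere classes; only almost every time
  slice inherits it.\<close>

lemma AE_slice_support:
  fixes u :: "real \<Rightarrow> 'a::euclidean_space \<Rightarrow> real"
  assumes "support_in (time_ivl T \<times> UNIV) (\<lambda>(t, x). u t x) \<subseteq> {(t, x). t \<in> time_ivl T \<and> norm x \<le> t + 1}"
  shows "AE t in lebesgue. t \<in> time_ivl T \<longrightarrow> (AE x in lebesgue. t + 1 < norm x \<longrightarrow> u t x = 0)"
proof -
  have "AE z in lebesgue. z \<in> time_ivl T \<times> UNIV \<longrightarrow> fst z + 1 < norm (snd z) \<longrightarrow> u (fst z) (snd z) = 0"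
    using AE_zero_off_support[of "time_ivl T \<times> UNIV" "\<lambda>(t, x). u t x"]
  proof eventually_elim
    case (elim z)
    show ?case
    proof (intro impI)
      assume z: "z \<in> time_ivl T \<times> UNIV" "fst z + 1 < norm (snd z)"
      have "z \<notin> support_in (time_ivl T \<times> UNIV) (\<lambda>(t, x). u t x)"
      proof
        assume "z \<in> support_in (time_ivl T \<times> UNIV) (\<lambda>(t, x). u t x)"
        then have "z \<in> {(t, x). t \<in> time_ivl T \<and> norm x \<le> t + 1}" using assms by blast
        then show False using z(2) by (simp add: case_prod_beta)
      qed
      then show "u (fst z) (snd z) = 0" using elim z by (simp add: case_prod_beta)
    qed
  qed
  from AE_lebesgue_pair[OF this] show ?thesis by (auto elim: eventually_mono)
qed

lemma separated_test_function:
  fixes a y :: "real \<Rightarrow> real"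
  assumes a: "\<And>k. Ck_on k UNIV a" "\<And>t. R < t \<Longrightarrow> a t = 0" and R: "ereal R < T"
    and y: "\<And>k. Ck_on k UNIV y" "\<And>s. S < s \<Longrightarrow> y s = 0" "0 \<le> S"
  shows "(\<lambda>(t, x). a t * y (x \<bullet> x)) \<in> test_functions (time_ivl T \<times> (UNIV :: 'a::euclidean_space set))"
proof -
  let ?\<Omega> = "time_ivl T \<times> (UNIV :: 'a set)"
  have "Ck_on k ?\<Omega> (\<lambda>z. a (fst z) * y (snd z \<bullet> snd z))" for k
  proof (rule Ck_on_mult)
    show "Ck_on k ?\<Omega> (\<lambda>z. a (fst z))"
      by (rule Ck_on_compose[OF a(1) Ck_on_bounded_linear[OF bounded_linear_fst]])
    have "Ck_on k ?\<Omega> (\<lambda>z. snd z \<bullet> snd z)"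
      by (rule Ck_on_inner;
          rule Ck_on_bounded_linear[OF bounded_linear_compose[OF bounded_linear_inner_left bounded_linear_snd]])
    then show "Ck_on k ?\<Omega> (\<lambda>z. y (snd z \<bullet> snd z))"
      by (rule Ck_on_compose[OF y(1)])
  qed
  then have sm: "\<forall>k. Ck_on k ?\<Omega> (\<lambda>(t, x). a t * y (x \<bullet> x))" by (simp add: case_prod_beta')
  have "a (fst z) * y (snd z \<bullet> snd z) = 0" if z: "z \<in> ?\<Omega> - {0..R} \<times> cball 0 (sqrt S)" for z
  proof (cases "R < fst z")
    case False
    then have "snd z \<notin> cball 0 (sqrt S)" using z by (auto simp: time_ivl_def)
    then have "S < snd z \<bullet> snd z" using y(3) by (simp add: norm_eq_sqrt_inner)
    then show ?thesis using y(2) by simp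
  qed (simp add: a(2))
  moreover have "compact ({0..R} \<times> cball (0::'a) (sqrt S))" by (intro compact_Times compact_Icc compact_cball)
  moreover have "{0..R} \<times> cball (0::'a) (sqrt S) \<subseteq> ?\<Omega>" using Icc_subset_time_ivl[OF R] by auto
  ultimately show ?thesis unfolding test_functions_def using sm
    by (auto simp: case_prod_beta' intro!: exI[of _ "{0..R} \<times> cball (0::'a) (sqrt S)"])
qed

lemma set_integral_restrict:
  fixes F F' :: "real \<Rightarrow> real"
  assumes "J \<subseteq> I" "\<And>t. t \<in> J \<Longrightarrow> F t = F' t" "\<And>t. t \<in> I \<Longrightarrow> t \<notin> J \<Longrightarrow> F t = 0"
  shows "(LINT t:I|M. F t) = (LINT t:J|M. F' t)" "set_integrable M I F \<longleftrightarrow> set_integrable M J F'"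
proof -
  have "(\<lambda>t. indicator I t *\<^sub>R F t) = (\<lambda>t. indicator J t *\<^sub>R F' t)"
    using assms by (auto simp: fun_eq_iff indicator_def)
  then show "(LINT t:I|M. F t) = (LINT t:J|M. F' t)" "set_integrable M I F \<longleftrightarrow> set_integrable M J F'"
    unfolding set_lebesgue_integral_def set_integrable_def by simp_all
qed

lemma continuous_Icc_lebesgue:
  fixes h :: "real \<Rightarrow> real"
  assumes "continuous_on {a..b} h"
  shows "set_integrable lebesgue {a..b} h" "(LINT t:{a..b}|lebesgue. h t) = (LINT t:{a..b}|lborel. h t)"
proof -
  have i: "integrable lborel (\<lambda>t. indicator {a..b} t *\<^sub>R h t)"
    using borel_integrable_atLeastAtMost'[OF assms] by (simp add: set_integrable_def)
  then have m: "(\<lambda>t. indicator {a..b} t *\<^sub>R h t) \<in> borel_measurable lborel" by (rule borel_measurable_integrable)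
  show "set_integrable lebesgue {a..b} h" unfolding set_integrable_def integrable_completion[OF m] by (rule i)
  show "(LINT t:{a..b}|lebesgue. h t) = (LINT t:{a..b}|lborel. h t)"
    unfolding set_lebesgue_integral_def integral_completion[OF m] ..
qed

lemma integral_by_parts_vanishing:
  fixes a a1 a2 m m' :: "real \<Rightarrow> real"
  assumes R: "0 \<le> R" and a1: "\<And>t. (a1 has_real_derivative a2 t) (at t)" "continuous_on UNIV a2" "a1 R = 0"
    and m: "\<And>t. t \<in> {0..R} \<Longrightarrow> (m has_real_derivative m' t) (at t within {0..R})" "continuous_on {0..R} m'"
  shows "(LINT t:{0..R}|lebesgue. a1 t * m' t) = - (a1 0 * m 0) - (LINT t:{0..R}|lebesgue. a2 t * m t)"
proof -
  have cm: "continuous_on {0..R} m" using m(1) by (meson DERIV_continuous_on)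
  have ca1: "continuous_on {0..R} a1" using a1(1)
    by (meson DERIV_continuous_on has_field_derivative_at_within)
  have ca2: "continuous_on {0..R} a2" using a1(2) by (rule continuous_on_subset) simp
  have c1: "continuous_on {0..R} (\<lambda>t. a1 t * m' t)" and c2: "continuous_on {0..R} (\<lambda>t. a2 t * m t)"
    by (intro continuous_intros ca1 ca2 cm m(2))+
  have "(LINT t:{0..R}|lborel. a1 t * m' t + a2 t * m t) = a1 R * m R - a1 0 * m 0"
    unfolding set_lebesgue_integral_def
  proof (rule integral_FTC_atLeastAtMost[OF R])
    fix t assume "0 \<le> t" "t \<le> R"
    then have "((\<lambda>t. a1 t * m t) has_real_derivative a1 t * m' t + a2 t * m t) (at t within {0..R})"
      by (intro DERIV_mult' m(1) has_field_derivative_at_within[OF a1(1)]) auto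
    then show "((\<lambda>t. a1 t * m t) has_vector_derivative a1 t * m' t + a2 t * m t) (at t within {0..R})"
      by (simp add: has_real_derivative_iff_has_vector_derivative)
  qed (intro continuous_intros c1 c2)
  moreover have "(LINT t:{0..R}|lborel. a1 t * m' t + a2 t * m t)
      = (LINT t:{0..R}|lborel. a1 t * m' t) + (LINT t:{0..R}|lborel. a2 t * m t)"
    by (intro set_integral_add borel_integrable_atLeastAtMost' c1 c2)
  ultimately show ?thesis using a1(3) continuous_Icc_lebesgue(2)[OF c1] continuous_Icc_lebesgue(2)[OF c2] by simp
qed

lemma damping_continuous: "continuous_on UNIV (damping \<mu> \<beta>)"
  unfolding damping_def[abs_def] by (intro continuous_intros) (auto simp: add_nonneg_eq_0_iff)

section \<open>The identity for one product test function\<close>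

context
  fixes \<mu> \<beta> p \<epsilon> :: real and f g :: "'a::euclidean_space \<Rightarrow> real" and T :: ereal
    and u :: "real \<Rightarrow> 'a \<Rightarrow> real" and R S :: real and a a1 a2 y y1 y2 :: "real \<Rightarrow> real"
  assumes sol: "energy_solution \<mu> \<beta> p \<epsilon> f g T u" and f: "f \<in> L2"
    and R: "0 \<le> R" "ereal R < T"
    and a: "\<And>k. Ck_on k UNIV a" "\<And>t. (a has_real_derivative a1 t) (at t)"
      "\<And>t. (a1 has_real_derivative a2 t) (at t)" "continuous_on UNIV a2"
      "\<forall>t\<ge>R. a t = 0"
    and y: "\<And>k. Ck_on k UNIV y" "\<And>s. (y has_real_derivative y1 s) (at s)"
      "\<And>s. (y1 has_real_derivative y2 s) (at s)" "\<And>k. Ck_on k UNIV y1" "continuous_on UNIV y2"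
      "\<forall>s\<ge>S. y s = 0"
    and S: "0 \<le> S"
begin

text \<open>Time integration by parts of the u_t term produces the boundary term with
  \<open>a1 0\<close>; the gradient term is handled slice by slice through
  \<open>weak_grad_radial\<close>. Every linear term is a continuous function of t times a pairing
  of u or \<open>ut\<close> with a fixed \<open>L2\<close> function, so its integrability is
  automatic. That of the nonlinear term is inherited from the notion of energy solution.\<close>

lemma weak_identity:
  shows "AE t in lebesgue. t \<in> {0..R} \<longrightarrow> integrable lebesgue (\<lambda>x. \<bar>u t x\<bar> powr p * (a t * y (x \<bullet> x)))" (is ?A)
    and "set_integrable lebesgue {0..R} (\<lambda>t. LINT x|lebesgue. \<bar>u t x\<bar> powr p * (a t * y (x \<bullet> x)))" (is ?B)
    and "set_integrable lebesgue {0..R} (\<lambda>t. LINT x|lebesgue. u t x *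
      (a2 t * y (x \<bullet> x) - a t * lap_radial y1 y2 x - a1 t * (damping \<mu> \<beta> x * y (x \<bullet> x))))" (is ?C)
    and "\<epsilon> * (LINT x|lebesgue. g x * (a 0 * y (x \<bullet> x)))
      + \<epsilon> * (LINT x|lebesgue. damping \<mu> \<beta> x * f x * (a 0 * y (x \<bullet> x)))
      - a1 0 * (\<epsilon> * (LINT x|lebesgue. f x * y (x \<bullet> x)))
      + (LINT t:{0..R}|lebesgue. (LINT x|lebesgue. \<bar>u t x\<bar> powr p * (a t * y (x \<bullet> x))))
      = (LINT t:{0..R}|lebesgue. (LINT x|lebesgue. u t x *
      (a2 t * y (x \<bullet> x) - a t * lap_radial y1 y2 x - a1 t * (damping \<mu> \<beta> x * y (x \<bullet> x)))))" (is ?D)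
    and "\<And>t. t \<in> {0..R} \<Longrightarrow> integrable lebesgue (\<lambda>x. u t x *
      (a2 t * y (x \<bullet> x) - a t * lap_radial y1 y2 x - a1 t * (damping \<mu> \<beta> x * y (x \<bullet> x))))"
proof -
  let ?I = "time_ivl T"
  define Y :: "'a \<Rightarrow> real" where "Y x = y (x \<bullet> x)" for x
  define LY :: "'a \<Rightarrow> real" where "LY = lap_radial y1 y2"
  define VY :: "'a \<Rightarrow> real" where "VY x = damping \<mu> \<beta> x * Y x" for x
  define \<Psi> :: "real \<times> 'a \<Rightarrow> real" where "\<Psi> = (\<lambda>(t, x). a t * y (x \<bullet> x))"
  have RI: "{0..R} \<subseteq> ?I" using Icc_subset_time_ivl[OF R(2)] .
  have az: "a t = 0" "a1 t = 0" "a2 t = 0" if "R < t" for t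
  proof -
    show "a t = 0" using a(5) that by simp
    have z: "a1 s = 0" if "R < s" for s by (rule zero_deriv_beyond[OF a(2) a(5)[rule_format] that])
    then show "a1 t = 0" using that by simp
    show "a2 t = 0" by (rule DERIV_locally_const[OF a(3), of "{R<..}" t 0]) (use z that in auto)
  qed
  \<comment> \<open>The boundary term at R has to vanish: \<open>a1\<close> is continuous and is
    zero to the right of R.\<close>
  have a1R: "a1 R = 0"
  proof (rule LIMSEQ_unique)
    have "isCont a1 R" using a(3) by (rule DERIV_isCont)
    then show "(\<lambda>n. a1 (R + 1 / real (Suc n))) \<longlonglongrightarrow> a1 R"
      by (rule isCont_tendsto_compose) (use LIMSEQ_inverse_real_of_nat_add[of R] in \<open>simp add: inverse_eq_divide\<close>)
    show "(\<lambda>n. a1 (R + 1 / real (Suc n))) \<longlonglongrightarrow> 0" by (simp add: az)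
  qed
  have out: "t > R" if "t \<in> ?I" "t \<notin> {0..R}" for t using that by (auto simp: time_ivl_def)
  have yz: "y s = 0" "y1 s = 0" "y2 s = 0" if "S < s" for s
  proof -
    show "y s = 0" using y(6) that by simp
    have z: "y1 s = 0" if "S < s" for s by (rule zero_deriv_beyond[OF y(2) y(6)[rule_format] that])
    then show "y1 s = 0" using that by simp
    show "y2 s = 0" by (rule DERIV_locally_const[OF y(3), of "{S<..}" s 0]) (use z that in auto)
  qed
  have sq: "S < x \<bullet> x" if "x \<notin> cball 0 (sqrt S)" for x :: 'a
    using that S by (simp add: norm_eq_sqrt_inner)
  have cont: "continuous_on UNIV (\<lambda>x::'a. h (x \<bullet> x))" if "continuous_on UNIV h" for h :: "real \<Rightarrow> real"
    by (rule continuous_on_compose2[OF that]) (auto intro!: continuous_intros)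
  have cy: "continuous_on UNIV y" "continuous_on UNIV y1" using y(1)[of 0] y(4)[of 0] by auto
  note L2I = continuous_compact_support_L2[OF _ compact_cball[of 0 "sqrt S"]]
  have YL: "Y \<in> L2" unfolding Y_def[abs_def]
    by (rule L2I) (auto simp: yz sq intro!: cont cy)
  have LYL: "LY \<in> L2" unfolding LY_def lap_radial_def[abs_def]
    by (rule L2I) (auto simp: yz sq intro!: continuous_intros cont cy y(5))
  have VYL: "VY \<in> L2" unfolding VY_def[abs_def] Y_def[abs_def]
    by (rule L2I) (auto simp: yz sq intro!: continuous_intros cont cy damping_continuous)
  from sol obtain ut where H1: "H1_continuous_on ?I u" and C1: "L2_C1_on ?I u ut"
    and u0: "AE x in lebesgue. u 0 x = \<epsilon> * f x"
    and weak: "\<forall>\<Psi>\<in>test_functions (?I \<times> UNIV).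
         let \<Psi>t = (\<lambda>t x. vector_derivative (\<lambda>s. \<Psi> (s, x)) (at t within ?I));
             F = (\<lambda>t x. \<bar>u t x\<bar> powr p * \<Psi> (t, x));
             A = (\<lambda>t x. ut t x * \<Psi>t t x);
             B = (\<lambda>t x. weak_grad (u t) x \<bullet> grad (\<lambda>y. \<Psi> (t, y)) x);
             D = (\<lambda>t x. damping \<mu> \<beta> x * u t x * \<Psi>t t x)
         in
           integrable lebesgue (\<lambda>x. g x * \<Psi> (0, x)) \<and>
           integrable lebesgue (\<lambda>x. damping \<mu> \<beta> x * f x * \<Psi> (0, x)) \<and>
           spacetime_convergent T F \<and> spacetime_convergent T A \<and>
           spacetime_convergent T B \<and> spacetime_convergent T D \<and>
           \<epsilon> * (LINT x|lebesgue. g x * \<Psi> (0, x))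
             + \<epsilon> * (LINT x|lebesgue. damping \<mu> \<beta> x * f x * \<Psi> (0, x))
             + spacetime_integral T F
           = - spacetime_integral T A + spacetime_integral T B - spacetime_integral T D"
    unfolding energy_solution_def by blast
  have "\<Psi> \<in> test_functions (?I \<times> UNIV)" unfolding \<Psi>_def
    by (rule separated_test_function[OF a(1) az(1) R(2) y(1) yz(1) S])
  note W = bspec[OF weak this, unfolded Let_def spacetime_convergent_def spacetime_integral_def]
  have \<Psi>: "\<Psi> (t, x) = a t * Y x" for t x by (simp add: \<Psi>_def Y_def)
  have \<Psi>t: "vector_derivative (\<lambda>s. \<Psi> (s, x)) (at t within ?I) = a1 t * Y x" if "t \<in> ?I" for t x
  proof (rule vector_derivative_within[OF time_ivl_not_isolated[OF that]])
    have "((\<lambda>s. a s * Y x) has_real_derivative a1 t * Y x) (at t within ?I)"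
      by (rule DERIV_cmult_right[OF has_field_derivative_at_within[OF a(2)]])
    then show "((\<lambda>s. \<Psi> (s, x)) has_vector_derivative a1 t * Y x) (at t within ?I)"
      by (simp add: \<Psi> has_real_derivative_iff_has_vector_derivative)
  qed
  have uL: "u t \<in> L2" "ut t \<in> L2" "u t \<in> H1" if "t \<in> ?I" for t
    using that C1 H1 by (auto simp: L2_C1_on_def L2_continuous_on_def H1_continuous_on_def)
  define m where "m t = (LINT x|lebesgue. u t x * Y x)" for t
  define m' where "m' t = (LINT x|lebesgue. ut t x * Y x)" for t
  define mL where "mL t = (LINT x|lebesgue. u t x * LY x)" for t
  define mV where "mV t = (LINT x|lebesgue. u t x * VY x)" for t
  have uc: "L2_continuous_on ?I u" "L2_continuous_on ?I ut" using C1 by (auto simp: L2_C1_on_def)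
  have cm: "continuous_on {0..R} m" "continuous_on {0..R} m'" "continuous_on {0..R} mL" "continuous_on {0..R} mV"
    unfolding m_def[abs_def] m'_def[abs_def] mL_def[abs_def] mV_def[abs_def]
    by (rule continuous_on_subset[OF L2_curve_pairing_continuous RI]; (rule uc YL LYL VYL))+
  have dm: "(m has_real_derivative m' t) (at t within {0..R})" if "t \<in> {0..R}" for t
    unfolding m_def[abs_def] m'_def
    using L2_C1_pairing_deriv[OF C1 YL, of t] RI that by (meson has_field_derivative_subset subsetD)
  have ca: "continuous_on {0..R} a" "continuous_on {0..R} a1" "continuous_on {0..R} a2"
    using a(2,3,4) by (meson DERIV_continuous_on has_field_derivative_at_within continuous_on_subset subset_UNIV)+
  have Z: "integrable lebesgue (\<lambda>x. u t x * (a2 t * Y x - a t * LY x - a1 t * VY x))"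
    "(LINT x|lebesgue. u t x * (a2 t * Y x - a t * LY x - a1 t * VY x)) = a2 t * m t - a t * mL t - a1 t * mV t"
    if "t \<in> {0..R}" for t
  proof -
    have e: "u t x * (a2 t * Y x - a t * LY x - a1 t * VY x)
      = a2 t * (u t x * Y x) - a t * (u t x * LY x) - a1 t * (u t x * VY x)" for x by (simp add: algebra_simps)
    have i: "integrable lebesgue (\<lambda>x. u t x * Y x)" "integrable lebesgue (\<lambda>x. u t x * LY x)"
      "integrable lebesgue (\<lambda>x. u t x * VY x)"
      using uL(1)[of t] that RI by (auto intro!: L2_mult_integrable YL LYL VYL)
    show "integrable lebesgue (\<lambda>x. u t x * (a2 t * Y x - a t * LY x - a1 t * VY x))"
      unfolding e using i by (intro Bochner_Integration.integrable_diff integrable_mult_right)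
    show "(LINT x|lebesgue. u t x * (a2 t * Y x - a t * LY x - a1 t * VY x)) = a2 t * m t - a t * mL t - a1 t * mV t"
      unfolding e m_def mL_def mV_def using i by simp
  qed
  have c: "continuous_on {0..R} (\<lambda>t. a2 t * m t)" "continuous_on {0..R} (\<lambda>t. a t * mL t)"
     "continuous_on {0..R} (\<lambda>t. a1 t * mV t)" "continuous_on {0..R} (\<lambda>t. a1 t * m' t)"
    by (intro continuous_intros ca cm)+
  have Zeq: "(LINT x|lebesgue. u t x *
      (a2 t * y (x \<bullet> x) - a t * lap_radial y1 y2 x - a1 t * (damping \<mu> \<beta> x * y (x \<bullet> x))))
      = a2 t * m t - a t * mL t - a1 t * mV t" if "t \<in> {0..R}" for t
    using Z(2)[OF that] by (simp add: Y_def VY_def LY_def)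
  show "integrable lebesgue (\<lambda>x. u t x *
      (a2 t * y (x \<bullet> x) - a t * lap_radial y1 y2 x - a1 t * (damping \<mu> \<beta> x * y (x \<bullet> x))))" if "t \<in> {0..R}" for t
    using Z(1)[OF that] by (simp add: Y_def VY_def LY_def)
  have "set_integrable lebesgue {0..R} (\<lambda>t. a2 t * m t - a t * mL t - a1 t * mV t)"
    by (intro continuous_Icc_lebesgue continuous_intros c)
  then show ?C
    by (subst set_integral_restrict(2)[OF order_refl Zeq]) auto
  have F: "AE t in lebesgue. t \<in> ?I \<longrightarrow> integrable lebesgue (\<lambda>x. \<bar>u t x\<bar> powr p * \<Psi> (t, x))"
    "set_integrable lebesgue ?I (\<lambda>t. LINT x|lebesgue. \<bar>u t x\<bar> powr p * \<Psi> (t, x))"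
    using W by blast+
  show ?A using F(1) by eventually_elim (use RI in \<open>auto simp: \<Psi> Y_def\<close>)
  have Fz: "(LINT x|lebesgue. \<bar>u t x\<bar> powr p * \<Psi> (t, x)) = 0" if "t \<in> ?I" "t \<notin> {0..R}" for t
    using out[OF that] by (simp add: \<Psi> az)
  have Feq: "(LINT x|lebesgue. \<bar>u t x\<bar> powr p * \<Psi> (t, x)) = (LINT x|lebesgue. \<bar>u t x\<bar> powr p * (a t * y (x \<bullet> x)))" for t
    by (simp add: \<Psi> Y_def)
  have "?B \<longleftrightarrow> set_integrable lebesgue ?I (\<lambda>t. LINT x|lebesgue. \<bar>u t x\<bar> powr p * \<Psi> (t, x))"
    by (rule set_integral_restrict(2)[OF RI, symmetric]) (rule Feq, rule Fz)
  then show ?B using F(2) by blast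
  have F_int: "(LINT t:?I|lebesgue. (LINT x|lebesgue. \<bar>u t x\<bar> powr p * \<Psi> (t, x)))
     = (LINT t:{0..R}|lebesgue. (LINT x|lebesgue. \<bar>u t x\<bar> powr p * (a t * y (x \<bullet> x))))"
    by (rule set_integral_restrict(1)[OF RI]) (rule Feq, rule Fz)
  have A_int: "(LINT t:?I|lebesgue. (LINT x|lebesgue. ut t x * vector_derivative (\<lambda>s. \<Psi> (s, x)) (at t within ?I)))
     = (LINT t:{0..R}|lebesgue. a1 t * m' t)"
  proof (rule set_integral_restrict(1)[OF RI])
    fix t assume "t \<in> {0..R}"
    then have "t \<in> ?I" using RI by blast
    then show "(LINT x|lebesgue. ut t x * vector_derivative (\<lambda>s. \<Psi> (s, x)) (at t within ?I)) = a1 t * m' t"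
      by (simp add: \<Psi>t m'_def mult.left_commute)
  next
    fix t assume "t \<in> ?I" "t \<notin> {0..R}"
    then show "(LINT x|lebesgue. ut t x * vector_derivative (\<lambda>s. \<Psi> (s, x)) (at t within ?I)) = 0"
      using out by (simp add: \<Psi>t az)
  qed
  have D_int: "(LINT t:?I|lebesgue. (LINT x|lebesgue. damping \<mu> \<beta> x * u t x * vector_derivative (\<lambda>s. \<Psi> (s, x)) (at t within ?I)))
     = (LINT t:{0..R}|lebesgue. a1 t * mV t)"
  proof (rule set_integral_restrict(1)[OF RI])
    fix t assume "t \<in> {0..R}"
    then have "t \<in> ?I" using RI by blast
    then have "damping \<mu> \<beta> x * u t x * vector_derivative (\<lambda>s. \<Psi> (s, x)) (at t within ?I) = a1 t * (u t x * VY x)" for x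
      by (simp add: \<Psi>t VY_def)
    then show "(LINT x|lebesgue. damping \<mu> \<beta> x * u t x * vector_derivative (\<lambda>s. \<Psi> (s, x)) (at t within ?I)) = a1 t * mV t"
      by (simp only: mV_def integral_mult_right_zero)
  next
    fix t assume "t \<in> ?I" "t \<notin> {0..R}"
    then show "(LINT x|lebesgue. damping \<mu> \<beta> x * u t x * vector_derivative (\<lambda>s. \<Psi> (s, x)) (at t within ?I)) = 0"
      using out by (simp add: \<Psi>t az)
  qed
  have gr: "(LINT x|lebesgue. weak_grad (u t) x \<bullet> grad (\<lambda>y. \<Psi> (t, y)) x) = - (a t * mL t)" if "t \<in> ?I" for t
  proof -
    have "(\<lambda>x. \<Psi> (t, x)) = (\<lambda>x. (\<lambda>s. a t * y s) (x \<bullet> x))" by (simp add: \<Psi> Y_def)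
    moreover have "(LINT x|lebesgue. weak_grad (u t) x \<bullet> grad (\<lambda>x. (\<lambda>s. a t * y s) (x \<bullet> x)) x)
       = - (LINT x|lebesgue. u t x * lap_radial (\<lambda>s. a t * y1 s) (\<lambda>s. a t * y2 s) x)"
    proof (rule weak_grad_radial[where y = "\<lambda>s. a t * y s" and S = S])
      show "Ck_on k UNIV (\<lambda>s. a t * y1 s)" for k by (rule Ck_on_mult[OF Ck_on_const y(4)])
    qed (use uL that y(5,6) S in \<open>auto intro!: DERIV_cmult y continuous_intros\<close>)
    moreover have "u t x * lap_radial (\<lambda>s. a t * y1 s) (\<lambda>s. a t * y2 s) x = a t * (u t x * LY x)" for x
      by (simp add: lap_radial_def LY_def algebra_simps)
    ultimately show ?thesis by (simp add: mL_def)
  qed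
  have B_int: "(LINT t:?I|lebesgue. (LINT x|lebesgue. weak_grad (u t) x \<bullet> grad (\<lambda>y. \<Psi> (t, y)) x))
     = (LINT t:{0..R}|lebesgue. - (a t * mL t))"
    by (rule set_integral_restrict(1)[OF RI]) (use gr RI out az in auto)
  have m0: "m 0 = \<epsilon> * (LINT x|lebesgue. f x * y (x \<bullet> x))"
  proof -
    have z0: "0 \<in> ?I" using RI R by auto
    have "m 0 = (LINT x|lebesgue. u 0 x * Y x)" by (simp add: m_def)
    also have "\<dots> = (LINT x|lebesgue. \<epsilon> * (f x * Y x))"
    proof (rule integral_cong_AE)
      show meas: "(\<lambda>x. u 0 x * Y x) \<in> borel_measurable lebesgue"
        by (intro borel_measurable_times L2_measurable uL z0 YL)
      show ae: "AE x in lebesgue. u 0 x * Y x = \<epsilon> * (f x * Y x)" using u0 by eventually_elim simp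
      show "(\<lambda>x. \<epsilon> * (f x * Y x)) \<in> borel_measurable lebesgue"
        using f by (intro borel_measurable_times borel_measurable_const L2_measurable YL)
    qed
    finally show ?thesis by (simp add: Y_def)
  qed
  have ibp: "(LINT t:{0..R}|lebesgue. a1 t * m' t) = - (a1 0 * m 0) - (LINT t:{0..R}|lebesgue. a2 t * m t)"
    by (rule integral_by_parts_vanishing[OF R(1) a(3,4) a1R dm cm(2)])
  have "(LINT t:{0..R}|lebesgue. (LINT x|lebesgue. u t x *
      (a2 t * y (x \<bullet> x) - a t * lap_radial y1 y2 x - a1 t * (damping \<mu> \<beta> x * y (x \<bullet> x)))))
     = (LINT t:{0..R}|lebesgue. a2 t * m t - a t * mL t - a1 t * mV t)"
    by (rule set_integral_restrict(1)[OF order_refl Zeq]) auto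
  also have "\<dots> = (LINT t:{0..R}|lebesgue. a2 t * m t) - (LINT t:{0..R}|lebesgue. a t * mL t)
     - (LINT t:{0..R}|lebesgue. a1 t * mV t)"
    using continuous_Icc_lebesgue(1)[OF c(1)] continuous_Icc_lebesgue(1)[OF c(2)] continuous_Icc_lebesgue(1)[OF c(3)]
    by (simp add: set_integral_diff)
  finally have RHS: "(LINT t:{0..R}|lebesgue. (LINT x|lebesgue. u t x *
      (a2 t * y (x \<bullet> x) - a t * lap_radial y1 y2 x - a1 t * (damping \<mu> \<beta> x * y (x \<bullet> x)))))
     = \<dots>" .
  have "(LINT t:{0..R}|lebesgue. - (a t * mL t)) = - (LINT t:{0..R}|lebesgue. a t * mL t)"
    using continuous_Icc_lebesgue(1)[OF c(2)] by (simp add: set_lebesgue_integral_def)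
  moreover have "\<epsilon> * (LINT x|lebesgue. g x * \<Psi> (0, x))
             + \<epsilon> * (LINT x|lebesgue. damping \<mu> \<beta> x * f x * \<Psi> (0, x))
             + (LINT t:{0..R}|lebesgue. (LINT x|lebesgue. \<bar>u t x\<bar> powr p * (a t * y (x \<bullet> x))))
     = - (LINT t:{0..R}|lebesgue. a1 t * m' t) + (LINT t:{0..R}|lebesgue. - (a t * mL t))
        - (LINT t:{0..R}|lebesgue. a1 t * mV t)"
    using W unfolding F_int A_int B_int D_int by blast
  ultimately show ?D unfolding RHS ibp m0 by (simp add: \<Psi> Y_def)
qed

end

section \<open>The two test function estimates\<close>

text \<open>Young's inequality for the factors l |w| e^(1/p) and M/l, with the factors 1/p and 1/q
  estimated by 1. The power e^(1/p) granted by the cutoff becomes e itself, so the first term is the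
  integrand of \<open>J\<close>.\<close>

lemma young_weighted:
  fixes w X M e l p q :: real
  assumes p: "1 < p" "q = p / (p - 1)" and l: "0 < l" and e: "0 \<le> e" and M: "0 \<le> M"
    and X: "\<bar>X\<bar> \<le> M * e powr (1 / p)"
  shows "w * X \<le> l powr p * (\<bar>w\<bar> powr p * e) + l powr (- q) * M powr q"
proof -
  have "q = 1 + 1 / (p - 1)" using p by (simp add: field_simps)
  moreover have "1 / q = (p - 1) / p" unfolding p(2) by simp
  moreover have "1 / p + (p - 1) / p = 1" using p by (simp flip: add_divide_distrib)
  ultimately have q: "1 < q" "1 / p + 1 / q = 1" using p by auto
  have "w * X \<le> \<bar>w\<bar> * \<bar>X\<bar>" by (metis abs_ge_self abs_mult)
  also have "\<dots> \<le> \<bar>w\<bar> * (M * e powr (1 / p))" using X by (intro mult_left_mono) auto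
  also have "\<dots> = (l * \<bar>w\<bar> * e powr (1 / p)) * (M / l)" using l by simp
  also have "\<dots> \<le> (l * \<bar>w\<bar> * e powr (1 / p)) powr p / p + (M / l) powr q / q"
    using p q l M by (intro Youngs_inequality) auto
  also have "\<dots> \<le> (l * \<bar>w\<bar> * e powr (1 / p)) powr p + (M / l) powr q"
  proof (rule add_mono)
    have shrink: "x / c \<le> x" if "0 \<le> x" "1 < c" for x c :: real
      using that by (simp add: divide_le_eq mult_le_cancel_left1)
    show "(l * \<bar>w\<bar> * e powr (1 / p)) powr p / p \<le> (l * \<bar>w\<bar> * e powr (1 / p)) powr p"
      by (rule shrink[OF powr_ge_zero p(1)])
    show "(M / l) powr q / q \<le> (M / l) powr q" by (rule shrink[OF powr_ge_zero q(1)])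
  qed
  also have "(l * \<bar>w\<bar> * e powr (1 / p)) powr p = l powr p * (\<bar>w\<bar> powr p * e)"
    using l e p by (simp add: powr_mult powr_powr)
  also have "(M / l) powr q = l powr (- q) * M powr q"
    using l M by (simp add: powr_divide powr_minus_divide)
  finally show ?thesis .
qed

text \<open>Within radius r the spatial cutoff \<open>z\<close> is 1 and Young's inequality applies
  pointwise; beyond it \<open>w\<close> vanishes almost everywhere. Integrating the majorant
  \<open>h\<close> spares any discussion of the weight M outside the ball.\<close>

lemma slice_estimate:
  fixes w X z M h :: "'a::euclidean_space \<Rightarrow> real"
  assumes p: "1 < p" "q = p / (p - 1)" and l: "0 < l" and e: "0 \<le> e"
    and w: "AE x in lebesgue. r < norm x \<longrightarrow> w x = 0"
    and i: "integrable lebesgue (\<lambda>x. \<bar>w x\<bar> powr p * (e * z x))" "integrable lebesgue (\<lambda>x. w x * X x)"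
      "integrable lebesgue h"
    and z: "\<And>x. 0 \<le> z x" "\<And>x. norm x \<le> r \<Longrightarrow> z x = 1"
    and X: "\<And>x. norm x \<le> r \<Longrightarrow> 0 \<le> M x \<and> \<bar>X x\<bar> \<le> M x * e powr (1 / p)"
    and h: "\<And>x. norm x \<le> r \<Longrightarrow> M x powr q \<le> h x" "\<And>x. 0 \<le> h x"
  shows "(LINT x|lebesgue. w x * X x)
    \<le> l powr p * (LINT x|lebesgue. \<bar>w x\<bar> powr p * (e * z x)) + l powr (- q) * (LINT x|lebesgue. h x)"
proof -
  have "(LINT x|lebesgue. w x * X x)
      \<le> (LINT x|lebesgue. l powr p * (\<bar>w x\<bar> powr p * (e * z x)) + l powr (- q) * h x)"
  proof (rule integral_mono_AE)
    show "AE x in lebesgue. w x * X x \<le> l powr p * (\<bar>w x\<bar> powr p * (e * z x)) + l powr (- q) * h x"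
      using w
    proof eventually_elim
      case (elim x)
      show ?case
      proof (cases "norm x \<le> r")
        case True
        have "w x * X x \<le> l powr p * (\<bar>w x\<bar> powr p * e) + l powr (- q) * M x powr q"
          using X[OF True] by (intro young_weighted[OF p l e]) auto
        also have "\<dots> \<le> l powr p * (\<bar>w x\<bar> powr p * e) + l powr (- q) * h x"
          using h(1)[OF True] by (intro add_left_mono mult_left_mono) auto
        finally show ?thesis using z(2)[OF True] by simp
      next
        case False
        then have "w x = 0" using elim by simp
        then show ?thesis using h(2)[of x] p(1) by simp
      qed
    qed
  qed (use i in auto)
  then show ?thesis using i by simp
qed

lemma set_integral_mono_affine:
  fixes F A :: "real \<Rightarrow> real"
  assumes R: "0 \<le> R" and i: "set_integrable lebesgue {0..R} F" "set_integrable lebesgue {0..R} A"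
    and le: "AE t in lebesgue. t \<in> {0..R} \<longrightarrow> F t \<le> c * A t + K"
  shows "(LINT t:{0..R}|lebesgue. F t) \<le> c * (LINT t:{0..R}|lebesgue. A t) + K * R"
proof -
  have c: "set_integrable lebesgue {0..R} (\<lambda>_. K)" "(LINT t:{0..R}|lebesgue. K) = K * R"
  proof -
    show "set_integrable lebesgue {0..R} (\<lambda>_. K)" by (intro continuous_Icc_lebesgue continuous_intros)
    show "(LINT t:{0..R}|lebesgue. K) = K * R"
      using R by (simp add: set_lebesgue_integral_def)
  qed
  have i2: "set_integrable lebesgue {0..R} (\<lambda>t. c * A t)" using i(2) by (rule set_integrable_mult_right)
  have "(LINT t:{0..R}|lebesgue. F t) \<le> (LINT t:{0..R}|lebesgue. c * A t + K)"
    using i(1) set_integral_add(1)[OF i2 c(1)] le by (intro set_integral_mono_AE) auto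
  also have "\<dots> = c * (LINT t:{0..R}|lebesgue. A t) + K * R"
    using set_integral_add(2)[OF i2 c(1)] c(2) by simp
  finally show ?thesis .
qed

lemma damping_bounds:
  assumes "2 < \<beta>" "0 < \<mu>"
  shows "0 \<le> damping \<mu> \<beta> x" "damping \<mu> \<beta> x \<le> \<mu> / (1 + norm x)\<^sup>2" "damping \<mu> \<beta> x \<le> \<mu>"
proof -
  have n: "0 < 1 + norm x" by (simp add: add_pos_nonneg)
  then have "(1 + norm x)\<^sup>2 = (1 + norm x) powr 2" by simp
  also have "\<dots> \<le> (1 + norm x) powr \<beta>" using assms by (intro powr_mono) auto
  finally have le: "(1 + norm x)\<^sup>2 \<le> (1 + norm x) powr \<beta>" .
  have pos: "0 < (1 + norm x)\<^sup>2" using n by simp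
  show "0 \<le> damping \<mu> \<beta> x" using assms by (simp add: damping_def)
  show "damping \<mu> \<beta> x \<le> \<mu> / (1 + norm x)\<^sup>2"
    unfolding damping_def using assms le pos n by (intro divide_left_mono mult_pos_pos) auto
  also have "\<dots> \<le> \<mu> / 1" using assms by (intro divide_left_mono) (auto simp: add_nonneg_eq_0_iff)
  finally show "damping \<mu> \<beta> x \<le> \<mu>" by simp
qed

section \<open>The data common to both estimates\<close>

locale cutoff_setup =
  fixes p q C0 :: real and \<eta> \<eta>1 \<eta>2 :: "real \<Rightarrow> real"
  assumes p: "1 < p" and q_def: "q = p / (p - 1)"
    and \<eta>_smooth: "\<And>k. Ck_on k UNIV \<eta>"
    and \<eta>_deriv: "\<And>x. (\<eta> has_real_derivative \<eta>1 x) (at x)" "\<And>x. (\<eta>1 has_real_derivative \<eta>2 x) (at x)"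
    and \<eta>2_cont: "continuous_on UNIV \<eta>2"
    and \<eta>_range: "\<And>x. 0 \<le> \<eta> x" "\<And>x. \<eta> x \<le> 1"
    and \<eta>_left: "\<And>x. x < 1 / 2 \<Longrightarrow> \<eta> x = 1 \<and> \<eta>1 x = 0 \<and> \<eta>2 x = 0"
    and \<eta>_right: "\<And>x. 1 \<le> x \<Longrightarrow> \<eta> x = 0 \<and> \<eta>1 x = 0 \<and> \<eta>2 x = 0"
    and C0: "C0 > 0" and \<eta>_bound: "\<And>x. \<bar>\<eta>1 x\<bar> \<le> C0 * \<eta> x powr (1 / p)" "\<And>x. \<bar>\<eta>2 x\<bar> \<le> C0 * \<eta> x powr (1 / p)"

locale damped_solution = cutoff_setup +
  fixes \<mu> \<beta> \<epsilon> :: real and f g :: "'a::euclidean_space \<Rightarrow> real" and T :: ereal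
    and u :: "real \<Rightarrow> 'a \<Rightarrow> real" and R :: real
  assumes \<mu>: "0 < \<mu>" and \<beta>: "2 < \<beta>" and \<epsilon>: "0 < \<epsilon>"
    and fg_L2: "f \<in> L2" "g \<in> L2"
    and f_nonneg: "AE x in lebesgue. 0 \<le> f x" and g_nonneg: "AE x in lebesgue. 0 \<le> g x"
    and sol: "energy_solution \<mu> \<beta> p \<epsilon> f g T u"
    and supp: "support_in (time_ivl T \<times> UNIV) (\<lambda>(t, x). u t x) \<subseteq> {(t, x). t \<in> time_ivl T \<and> norm x \<le> t + 1}"
    and R1: "1 \<le> R" and RT: "ereal R < T"
begin

lemma q1: "1 < q" using p by (simp add: q_def field_simps)

text \<open>With this S the cutoff \<zeta>(|x|^2) is 1 for |x|^2 \<le> 2(R+1)^2. The ball |x| \<le>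
  R+1, which carries u up to time R, lies strictly inside, so the derivatives of \<zeta> vanish on
  it.\<close>

definition "S = 4 * (R + 1)\<^sup>2"
definition "\<zeta> s = step (s / S)"
text \<open>The link between the two estimates: the first bounds it from above, and it occurs on the
  right of the second. It carries the bare cutoffs, without the exponential weight of the second
  test function.\<close>

definition "J = (LINT t:{0..R}|lebesgue. (LINT x|lebesgue. \<bar>u t x\<bar> powr p * (\<eta> (t / R) * \<zeta> (x \<bullet> x))))"

lemma S_pos: "0 < S" using R1 by (simp add: S_def)

lemma u_slice: "AE t in lebesgue. t \<in> {0..R} \<longrightarrow> (AE x in lebesgue. t + 1 < norm x \<longrightarrow> u t x = 0)"
  using AE_slice_support[OF supp] by eventually_elim (use Icc_subset_time_ivl[OF RT] in blast)

lemma \<zeta>_smooth: "Ck_on k UNIV \<zeta>"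
proof -
  have "Ck_on k UNIV (\<lambda>s. step (s * (1 / S)))"
    by (rule Ck_on_compose[OF Ck_on_step Ck_on_bounded_linear[OF bounded_linear_mult_left]])
  then show ?thesis by (simp add: \<zeta>_def[abs_def])
qed

lemma \<zeta>_nonneg: "0 \<le> \<zeta> s" by (simp add: \<zeta>_def step_nonneg)

lemma \<zeta>_eq_1: "s \<le> S / 2 \<Longrightarrow> \<zeta> s = 1"
  unfolding \<zeta>_def using S_pos by (intro step_eq_1) (simp add: field_simps)

lemma \<zeta>_eq_0: "\<forall>s\<ge>S. \<zeta> s = 0"
  unfolding \<zeta>_def using S_pos by (intro allI impI step_eq_0) (simp add: field_simps)

lemma \<zeta>_derivs:
  obtains \<zeta>1 \<zeta>2 where "\<And>s. (\<zeta> has_real_derivative \<zeta>1 s) (at s)" "\<And>s. (\<zeta>1 has_real_derivative \<zeta>2 s) (at s)"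
    "\<And>k. Ck_on k UNIV \<zeta>1" "\<And>k. Ck_on k UNIV \<zeta>2" "\<And>s. s < S / 2 \<Longrightarrow> \<zeta>1 s = 0 \<and> \<zeta>2 s = 0"
proof -
  obtain \<zeta>1 where 1: "\<And>s. (\<zeta> has_real_derivative \<zeta>1 s) (at s)" "\<And>k. Ck_on k UNIV \<zeta>1"
    by (rule smooth_realE[OF \<zeta>_smooth]) (rule that)
  obtain \<zeta>2 where 2: "\<And>s. (\<zeta>1 has_real_derivative \<zeta>2 s) (at s)" "\<And>k. Ck_on k UNIV \<zeta>2"
    by (rule smooth_realE[OF 1(2)]) (rule that)
  have z1: "\<zeta>1 s = 0" if "s < S / 2" for s
    by (rule DERIV_locally_const[OF 1(1), of "{..<S / 2}" s 1]) (use that \<zeta>_eq_1 in auto)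
  have z2: "\<zeta>2 s = 0" if "s < S / 2" for s
    by (rule DERIV_locally_const[OF 2(1), of "{..<S / 2}" s 0]) (use that z1 in auto)
  show ?thesis by (rule that[OF 1(1) 2(1) 1(2) 2(2)]) (simp add: z1 z2)
qed

lemma sq_less_half: fixes x :: 'a assumes "norm x \<le> R + 1" shows "x \<bullet> x < S / 2"
proof -
  have "x \<bullet> x \<le> (R + 1)\<^sup>2" unfolding power2_norm_eq_inner[symmetric] using assms by (intro power_mono) auto
  also have "\<dots> < S / 2" using R1 by (simp add: S_def)
  finally show ?thesis .
qed

text \<open>First test function \<open>\<eta> (t / R) \<zeta> (\<bar>x\<bar>\<^sup>2)\<close>: the nonlinear term is absorbed by Young's inequality.\<close>

lemma
  assumes pot: "\<exists>h :: 'a \<Rightarrow> real. integrable lebesgue h \<and> (\<forall>x. 0 \<le> h x) \<and>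
    (\<forall>x. norm x \<le> R + 1 \<longrightarrow> (1 / R + damping \<mu> \<beta> x) powr q \<le> h x) \<and> (LINT x|lebesgue. h x) \<le> B"
  shows J_bound: "J \<le> 2 * 2 powr (q / p) * C0 powr q * R powr (1 - q) * B"
    and J_integrable: "AE t in lebesgue. t \<in> {0..R} \<longrightarrow> integrable lebesgue (\<lambda>x. \<bar>u t x\<bar> powr p * (\<eta> (t / R) * \<zeta> (x \<bullet> x)))"
      "set_integrable lebesgue {0..R} (\<lambda>t. LINT x|lebesgue. \<bar>u t x\<bar> powr p * (\<eta> (t / R) * \<zeta> (x \<bullet> x)))"
proof -
  obtain h :: "'a \<Rightarrow> real" where h: "integrable lebesgue h" "\<And>x. 0 \<le> h x"
    "\<And>x. norm x \<le> R + 1 \<Longrightarrow> (1 / R + damping \<mu> \<beta> x) powr q \<le> h x" "(LINT x|lebesgue. h x) \<le> B"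
    using pot by blast
  obtain \<zeta>1 \<zeta>2 where \<zeta>': "\<And>s. (\<zeta> has_real_derivative \<zeta>1 s) (at s)" "\<And>s. (\<zeta>1 has_real_derivative \<zeta>2 s) (at s)"
    "\<And>k. Ck_on k UNIV \<zeta>1" "\<And>k. Ck_on k UNIV \<zeta>2" "\<And>s. s < S / 2 \<Longrightarrow> \<zeta>1 s = 0 \<and> \<zeta>2 s = 0"
    by (rule \<zeta>_derivs) (rule that)
  define a where "a t = \<eta> (t / R)" for t
  define a1 where "a1 t = \<eta>1 (t / R) / R" for t
  define a2 where "a2 t = \<eta>2 (t / R) / R\<^sup>2" for t
  have lin: "((\<lambda>t. t / R) has_real_derivative 1 / R) (at t)" for t
    using R1 by (auto intro!: derivative_eq_intros)
  have a: "\<And>k. Ck_on k UNIV a" "\<And>t. (a has_real_derivative a1 t) (at t)"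
      "\<And>t. (a1 has_real_derivative a2 t) (at t)" "continuous_on UNIV a2" "\<forall>t\<ge>R. a t = 0"
  proof -
    have "Ck_on k UNIV (\<lambda>t. \<eta> (t * (1 / R)))" for k
      by (rule Ck_on_compose[OF \<eta>_smooth Ck_on_bounded_linear[OF bounded_linear_mult_left]])
    then show "Ck_on k UNIV a" for k by (simp add: a_def[abs_def])
    show "(a has_real_derivative a1 t) (at t)" for t
      using DERIV_chain2[OF \<eta>_deriv(1) lin[of t]] by (simp add: a_def[abs_def] a1_def)
    show "(a1 has_real_derivative a2 t) (at t)" for t
      using DERIV_cdivide[OF DERIV_chain2[OF \<eta>_deriv(2) lin[of t]], of R]
      by (simp add: a1_def[abs_def] a2_def power2_eq_square)
    show "continuous_on UNIV a2" unfolding a2_def[abs_def] using R1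
      by (intro continuous_intros continuous_on_compose2[OF \<eta>2_cont]) auto
    show "\<forall>t\<ge>R. a t = 0" using \<eta>_right R1 by (simp add: a_def)
  qed
  note \<zeta>2c = \<zeta>'(4)[of 0, unfolded Ck_on.simps]
  have R0: "0 \<le> R" using R1 by simp
  note W = weak_identity[OF sol fg_L2(1) R0 RT a \<zeta>_smooth \<zeta>'(1,2,3) \<zeta>2c \<zeta>_eq_0 less_imp_le[OF S_pos]]
  let ?N = "\<lambda>t. LINT x|lebesgue. \<bar>u t x\<bar> powr p * (a t * \<zeta> (x \<bullet> x))"
  let ?X = "\<lambda>t (x::'a). a2 t * \<zeta> (x \<bullet> x) - a t * lap_radial \<zeta>1 \<zeta>2 x - a1 t * (damping \<mu> \<beta> x * \<zeta> (x \<bullet> x))"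
  show "AE t in lebesgue. t \<in> {0..R} \<longrightarrow> integrable lebesgue (\<lambda>x. \<bar>u t x\<bar> powr p * (\<eta> (t / R) * \<zeta> (x \<bullet> x)))"
    using W(1) by (simp add: a_def)
  show "set_integrable lebesgue {0..R} (\<lambda>t. LINT x|lebesgue. \<bar>u t x\<bar> powr p * (\<eta> (t / R) * \<zeta> (x \<bullet> x)))"
    using W(2) by (simp add: a_def)
  \<comment> \<open>Gives the nonlinear term the coefficient 1/2, so that it can be absorbed into
    the left side; \<open>J\<close> is the integral of an integrable function, so the subtraction is
    legitimate.\<close>
  define l where "l = 2 powr (- 1 / p)"
  have l: "0 < l" "l powr p = 1 / 2" "l powr (- q) = 2 powr (q / p)"
  proof -
    show "0 < l" by (simp add: l_def)
    have "l powr p = 2 powr (- 1)" unfolding l_def powr_powr using p by simp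
    then show "l powr p = 1 / 2" by (simp add: powr_neg_one)
    show "l powr (- q) = 2 powr (q / p)" unfolding l_def powr_powr by simp
  qed
  have J: "J = (LINT t:{0..R}|lebesgue. ?N t)" by (simp add: J_def a_def)
  have "(LINT t:{0..R}|lebesgue. (LINT x|lebesgue. u t x * ?X t x))
     \<le> l powr p * J + l powr (- q) * ((C0 / R) powr q * B) * R"
    unfolding J
  proof (rule set_integral_mono_affine[OF R0 W(3) W(2)])
    show "AE t in lebesgue. t \<in> {0..R} \<longrightarrow>
      (LINT x|lebesgue. u t x * ?X t x) \<le> l powr p * ?N t + l powr (- q) * ((C0 / R) powr q * B)"
      using u_slice W(1)
    proof eventually_elim
      case (elim t)
      show ?case
      proof
        assume t: "t \<in> {0..R}"
        have "(LINT x|lebesgue. u t x * ?X t x)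
           \<le> l powr p * ?N t + l powr (- q) * (LINT x|lebesgue. (C0 / R) powr q * h x)"
        proof (rule slice_estimate[OF p q_def l(1), where r = "t + 1" and M = "\<lambda>x. C0 / R * (1 / R + damping \<mu> \<beta> x)"])
          show "0 \<le> a t" by (simp add: a_def \<eta>_range)
          show "AE x in lebesgue. t + 1 < norm x \<longrightarrow> u t x = 0" using elim(1) t by blast
          show "integrable lebesgue (\<lambda>x. \<bar>u t x\<bar> powr p * (a t * \<zeta> (x \<bullet> x)))" using elim(2) t by blast
          show "integrable lebesgue (\<lambda>x. u t x * ?X t x)" by (rule W(5)[OF t])
          show "integrable lebesgue (\<lambda>x. (C0 / R) powr q * h x)" using h(1) by simp
          show "0 \<le> \<zeta> (x \<bullet> x)" for x :: 'a by (rule \<zeta>_nonneg)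
          fix x :: 'a
          show "0 \<le> (C0 / R) powr q * h x" using h(2) by simp
          assume "norm x \<le> t + 1"
          then have x: "norm x \<le> R + 1" using t by simp
          note s = sq_less_half[OF x]
          show "\<zeta> (x \<bullet> x) = 1" using s by (simp add: \<zeta>_eq_1)
          have V: "0 \<le> damping \<mu> \<beta> x" using damping_bounds[OF \<beta> \<mu>] by blast
          have M0: "0 \<le> C0 / R * (1 / R + damping \<mu> \<beta> x)"
            using C0 R1 V by (intro mult_nonneg_nonneg add_nonneg_nonneg) auto
          \<comment> \<open>Where \<zeta> is constant the Laplacian drops out, and only derivatives
            of the time cutoff remain, of sizes 1/R^2 and 1/R.\<close>
          have "?X t x = a2 t - a1 t * damping \<mu> \<beta> x"
            using s \<zeta>'(5)[OF s] by (simp add: \<zeta>_eq_1 lap_radial_def)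
          then have "\<bar>?X t x\<bar> \<le> \<bar>a2 t\<bar> + \<bar>a1 t\<bar> * damping \<mu> \<beta> x"
            using abs_triangle_ineq4[of "a2 t" "a1 t * damping \<mu> \<beta> x"] V by (simp add: abs_mult)
          also have "\<dots> \<le> C0 * a t powr (1 / p) / R\<^sup>2 + C0 * a t powr (1 / p) / R * damping \<mu> \<beta> x"
            unfolding a2_def a1_def a_def abs_divide using R1 V \<eta>_bound[of "t / R"]
            by (intro add_mono mult_right_mono) (auto intro!: divide_right_mono)
          also have "\<dots> = C0 / R * (1 / R + damping \<mu> \<beta> x) * a t powr (1 / p)"
            using R1 by (simp add: field_simps power2_eq_square)
          finally show "0 \<le> C0 / R * (1 / R + damping \<mu> \<beta> x) \<and>
            \<bar>?X t x\<bar> \<le> C0 / R * (1 / R + damping \<mu> \<beta> x) * a t powr (1 / p)" using M0 by blast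
          have "(C0 / R * (1 / R + damping \<mu> \<beta> x)) powr q = (C0 / R) powr q * (1 / R + damping \<mu> \<beta> x) powr q"
            by (rule powr_mult)
          also have "\<dots> \<le> (C0 / R) powr q * h x" using h(3)[OF x] by (intro mult_left_mono) auto
          finally show "(C0 / R * (1 / R + damping \<mu> \<beta> x)) powr q \<le> (C0 / R) powr q * h x" .
        qed
        also have "\<dots> \<le> l powr p * ?N t + l powr (- q) * ((C0 / R) powr q * B)"
          using h(4) by (simp add: mult_left_mono)
        finally show "(LINT x|lebesgue. u t x * ?X t x) \<le> l powr p * ?N t + l powr (- q) * ((C0 / R) powr q * B)" .
      qed
    qed
  qed
  moreover have "J \<le> (LINT t:{0..R}|lebesgue. (LINT x|lebesgue. u t x * ?X t x))"
  proof -
    have a0: "a 0 = 1" "a1 0 = 0" using \<eta>_left[of 0] by (auto simp: a_def a1_def)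
    have "0 \<le> (LINT x|lebesgue. g x * (a 0 * \<zeta> (x \<bullet> x)))"
      by (rule integral_nonneg_AE) (use g_nonneg in \<open>eventually_elim, simp add: a0 \<zeta>_nonneg\<close>)
    moreover have "0 \<le> (LINT x|lebesgue. damping \<mu> \<beta> x * f x * (a 0 * \<zeta> (x \<bullet> x)))"
      by (rule integral_nonneg_AE) (use f_nonneg in \<open>eventually_elim, simp add: a0 \<zeta>_nonneg damping_bounds[OF \<beta> \<mu>]\<close>)
    ultimately have "0 \<le> \<epsilon> * (LINT x|lebesgue. g x * (a 0 * \<zeta> (x \<bullet> x)))
      + \<epsilon> * (LINT x|lebesgue. damping \<mu> \<beta> x * f x * (a 0 * \<zeta> (x \<bullet> x)))" using \<epsilon> by simp
    then show ?thesis using W(4) unfolding J by (simp add: a0(2))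
  qed
  ultimately have "J \<le> 2 * (2 powr (q / p) * ((C0 / R) powr q * B) * R)" unfolding l by linarith
  also have "\<dots> = 2 * 2 powr (q / p) * C0 powr q * R powr (1 - q) * B"
    using C0 R1 by (simp add: powr_divide powr_diff)
  finally show "J \<le> 2 * 2 powr (q / p) * C0 powr q * R powr (1 - q) * B" .
qed

text \<open>Second test function \<open>e\<^sup>-\<^sup>t \<eta> (t / R) Q (\<bar>x\<bar>\<^sup>2) \<zeta> (\<bar>x\<bar>\<^sup>2)\<close>, where \<open>Q\<close> almost solves
  \<open>\<Delta>Q = (1 + V) Q\<close>; only terms with a derivative on the cutoff remain, up to the error \<open>\<kappa>\<close>.\<close>

lemma data_estimate:
  fixes B Cp :: real
  defines "m \<equiv> (real DIM('a) - 1) / 2" and "c \<equiv> (real DIM('a) - 1) * (1 - q / 2)"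
  assumes Q: "\<And>\<kappa>. 0 < \<kappa> \<Longrightarrow> \<exists>Q::real poly. \<forall>r. 0 \<le> r \<and> r \<le> R + 1 \<longrightarrow> 1 \<le> poly Q (r\<^sup>2)
      \<and> poly Q (r\<^sup>2) \<le> B * (exp r * (1 + r) powr (- m))
      \<and> \<bar>4 * r\<^sup>2 * poly (pderiv (pderiv Q)) (r\<^sup>2) + 2 * real DIM('a) * poly (pderiv Q) (r\<^sup>2)
          - (1 + \<mu> / (1 + r) powr \<beta>) * poly Q (r\<^sup>2)\<bar> \<le> \<kappa>"
    and B: "0 < B" and Cp: "0 \<le> Cp"
    and prof: "\<And>t. R / 2 \<le> t \<Longrightarrow> t \<le> R \<Longrightarrow> \<exists>h :: 'a \<Rightarrow> real. integrable lebesgue h \<and> (\<forall>x. 0 \<le> h x) \<and>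
    (\<forall>x. norm x \<le> t + 1 \<longrightarrow> (exp (- t) * (exp (norm x) * (1 + norm x) powr (- m))) powr q \<le> h x) \<and>
    (LINT x|lebesgue. h x) \<le> Cp * R powr c"
    and JI: "AE t in lebesgue. t \<in> {0..R} \<longrightarrow> integrable lebesgue (\<lambda>x. \<bar>u t x\<bar> powr p * (\<eta> (t / R) * \<zeta> (x \<bullet> x)))"
      "set_integrable lebesgue {0..R} (\<lambda>t. LINT x|lebesgue. \<bar>u t x\<bar> powr p * (\<eta> (t / R) * \<zeta> (x \<bullet> x)))"
    and fg_supp: "AE x in lebesgue. 1 < norm x \<longrightarrow> f x = 0" "AE x in lebesgue. 1 < norm x \<longrightarrow> g x = 0"
    and l: "0 < l"
  shows "\<epsilon> * (LINT x|lebesgue. g x * step (x \<bullet> x / 2))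
    \<le> l powr p * J + l powr (- q) * (2 powr q * ((C0 * (3 + \<mu>) * B) powr q * Cp + 1) * R powr (1 + c - q))"
proof -
  \<comment> \<open>One C0 bounds the second derivative of the cutoff and 2 + \<mu> copies of it
    bound its first derivative, which comes with the factor 2 + V.\<close>
  define C1 where "C1 = C0 * (3 + \<mu>)"
  have C1: "0 < C1" using C0 \<mu> by (simp add: C1_def)
  define W0 where "W0 = measure lebesgue (cball (0::'a) (R + 1))"
  have W0: "0 < W0" using R1 by (simp add: W0_def content_cball)
  \<comment> \<open>The tolerance at which the residual, raised to the power q and integrated over
    the ball, has the size R^(c-q) of the main term. It depends on R, while the growth constant B
    does not.\<close>
  define \<kappa> where "\<kappa> = (R powr (c - q) / W0) powr (1 / q)"
  have \<kappa>: "0 < \<kappa>" "\<kappa> powr q * W0 = R powr (c - q)"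
    using R1 W0 q1 by (simp_all add: \<kappa>_def powr_powr)
  obtain Q :: "real poly" where Q: "\<And>r. 0 \<le> r \<Longrightarrow> r \<le> R + 1 \<Longrightarrow> 1 \<le> poly Q (r\<^sup>2)
      \<and> poly Q (r\<^sup>2) \<le> B * (exp r * (1 + r) powr (- m))
      \<and> \<bar>4 * r\<^sup>2 * poly (pderiv (pderiv Q)) (r\<^sup>2) + 2 * real DIM('a) * poly (pderiv Q) (r\<^sup>2)
          - (1 + \<mu> / (1 + r) powr \<beta>) * poly Q (r\<^sup>2)\<bar> \<le> \<kappa>"
    using Q[OF \<kappa>(1)] by blast
  let ?Q = "\<lambda>x::'a. poly Q (x \<bullet> x)"
  define D :: "'a \<Rightarrow> real" where "D x = 4 * (x \<bullet> x) * poly (pderiv (pderiv Q)) (x \<bullet> x)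
      + 2 * real DIM('a) * poly (pderiv Q) (x \<bullet> x) - (1 + damping \<mu> \<beta> x) * ?Q x" for x
  have Qx: "1 \<le> ?Q x" "?Q x \<le> B * (exp (norm x) * (1 + norm x) powr (- m))" "\<bar>D x\<bar> \<le> \<kappa>"
    if "norm x \<le> R + 1" for x
    using Q[OF norm_ge_zero that] by (simp_all add: D_def power2_norm_eq_inner damping_def)
  obtain \<zeta>1 \<zeta>2 where \<zeta>': "\<And>s. (\<zeta> has_real_derivative \<zeta>1 s) (at s)" "\<And>s. (\<zeta>1 has_real_derivative \<zeta>2 s) (at s)"
    "\<And>k. Ck_on k UNIV \<zeta>1" "\<And>k. Ck_on k UNIV \<zeta>2" "\<And>s. s < S / 2 \<Longrightarrow> \<zeta>1 s = 0 \<and> \<zeta>2 s = 0"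
    by (rule \<zeta>_derivs) (rule that)
  define y where "y s = poly Q s * \<zeta> s" for s
  define y1 where "y1 s = poly Q s * \<zeta>1 s + poly (pderiv Q) s * \<zeta> s" for s
  define y2 where "y2 s = (poly Q s * \<zeta>2 s + poly (pderiv Q) s * \<zeta>1 s)
      + (poly (pderiv Q) s * \<zeta>1 s + poly (pderiv (pderiv Q)) s * \<zeta> s)" for s
  have y: "\<And>k. Ck_on k UNIV y" "\<And>s. (y has_real_derivative y1 s) (at s)"
      "\<And>s. (y1 has_real_derivative y2 s) (at s)" "\<And>k. Ck_on k UNIV y1" "continuous_on UNIV y2"
      "\<forall>s\<ge>S. y s = 0"
  proof -
    show "Ck_on k UNIV y" for k unfolding y_def[abs_def] by (rule Ck_on_mult[OF Ck_on_poly \<zeta>_smooth])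
    show "(y has_real_derivative y1 s) (at s)" for s
      unfolding y_def[abs_def] y1_def by (rule DERIV_mult'[OF poly_DERIV \<zeta>'(1)])
    show "(y1 has_real_derivative y2 s) (at s)" for s
      unfolding y1_def[abs_def] y2_def
      by (rule DERIV_add[OF DERIV_mult'[OF poly_DERIV \<zeta>'(2)] DERIV_mult'[OF poly_DERIV \<zeta>'(1)]])
    show "Ck_on k UNIV y1" for k unfolding y1_def[abs_def]
      by (rule Ck_on_add[OF Ck_on_mult[OF Ck_on_poly \<zeta>'(3)] Ck_on_mult[OF Ck_on_poly \<zeta>_smooth]])
    show "continuous_on UNIV y2" unfolding y2_def[abs_def]
      using \<zeta>_smooth[of 0] \<zeta>'(3)[of 0] \<zeta>'(4)[of 0] by (auto intro!: continuous_intros)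
    show "\<forall>s\<ge>S. y s = 0" using \<zeta>_eq_0 by (simp add: y_def)
  qed
  define a where "a t = exp (- t) * \<eta> (t / R)" for t
  define a1 where "a1 t = exp (- t) * (\<eta>1 (t / R) / R - \<eta> (t / R))" for t
  define a2 where "a2 t = exp (- t) * (\<eta>2 (t / R) / R\<^sup>2 - 2 * (\<eta>1 (t / R) / R) + \<eta> (t / R))" for t
  have a: "\<And>k. Ck_on k UNIV a" "\<And>t. (a has_real_derivative a1 t) (at t)"
      "\<And>t. (a1 has_real_derivative a2 t) (at t)" "continuous_on UNIV a2" "\<forall>t\<ge>R. a t = 0"
  proof -
    have lin: "((\<lambda>t. t / R) has_real_derivative 1 / R) (at t)" for t
      using R1 by (auto intro!: derivative_eq_intros)
    have d0: "((\<lambda>t. \<eta> (t / R)) has_real_derivative \<eta>1 (t / R) / R) (at t)" for t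
      using DERIV_chain2[OF \<eta>_deriv(1) lin[of t]] by simp
    have d1: "((\<lambda>t. \<eta>1 (t / R) / R) has_real_derivative \<eta>2 (t / R) / R\<^sup>2) (at t)" for t
      using DERIV_cdivide[OF DERIV_chain2[OF \<eta>_deriv(2) lin[of t]], of R] by (simp add: power2_eq_square)
    have de: "((\<lambda>t. exp (- t)) has_real_derivative - exp (- t)) (at t)" for t :: real
      by (auto intro!: derivative_eq_intros)
    have e: "Ck_on k UNIV (\<lambda>t::real. exp (- t))" for k
    proof (induction k)
      case (Suc k)
      have "Ck_on k UNIV (\<lambda>t::real. (- 1) * exp (- t))" by (rule Ck_on_mult[OF Ck_on_const Suc.IH])
      then show ?case using Ck_on_Suc_realI[OF de] by simp
    qed (auto intro!: continuous_intros)
    have "Ck_on k UNIV (\<lambda>t. \<eta> (t * (1 / R)))" for k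
      by (rule Ck_on_compose[OF \<eta>_smooth Ck_on_bounded_linear[OF bounded_linear_mult_left]])
    then have "Ck_on k UNIV (\<lambda>t. \<eta> (t / R))" for k by simp
    then show "Ck_on k UNIV a" for k unfolding a_def[abs_def] by (rule Ck_on_mult[OF e])
    show "(a has_real_derivative a1 t) (at t)" for t
      using DERIV_mult'[OF de d0, of t] by (simp add: a_def[abs_def] a1_def algebra_simps)
    show "(a1 has_real_derivative a2 t) (at t)" for t
      using DERIV_mult'[OF de DERIV_diff[OF d1 d0], of t] by (simp add: a1_def[abs_def] a2_def algebra_simps)
    have c0: "continuous_on UNIV \<eta>" "continuous_on UNIV \<eta>1"
      using \<eta>_deriv by (meson DERIV_continuous_on)+
    have cd: "continuous_on UNIV (\<lambda>t. h (t / R))" if "continuous_on UNIV h" for h :: "real \<Rightarrow> real"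
      by (rule continuous_on_compose2[OF that]) (use R1 in \<open>auto intro!: continuous_intros\<close>)
    show "continuous_on UNIV a2" unfolding a2_def[abs_def] using R1
      by (intro continuous_intros cd c0 \<eta>2_cont) auto
    show "\<forall>t\<ge>R. a t = 0" using \<eta>_right R1 by (simp add: a_def)
  qed
  have R0: "0 \<le> R" using R1 by simp
  note W = weak_identity[OF sol fg_L2(1) R0 RT a y less_imp_le[OF S_pos]]
  let ?N = "\<lambda>t. LINT x|lebesgue. \<bar>u t x\<bar> powr p * (\<eta> (t / R) * \<zeta> (x \<bullet> x))"
  let ?X = "\<lambda>t (x::'a). a2 t * y (x \<bullet> x) - a t * lap_radial y1 y2 x - a1 t * (damping \<mu> \<beta> x * y (x \<bullet> x))"
  have yQ: "y (x \<bullet> x) = ?Q x" if "norm x \<le> R + 1" for x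
    using sq_less_half[OF that] by (simp add: y_def \<zeta>_eq_1)
  \<comment> \<open>The terms \<eta> Q and V \<eta> Q from a'' and a' cancel against those from
    \<Delta>Q = (1 + V) Q, up to the residual \<open>D\<close>.\<close>
  have X_eq: "?X t x = exp (- t) * ((\<eta>2 (t / R) / R\<^sup>2 - (2 + damping \<mu> \<beta> x) * (\<eta>1 (t / R) / R)) * ?Q x - \<eta> (t / R) * D x)"
    if "norm x \<le> R + 1" for t x
  proof -
    note s = sq_less_half[OF that]
    have "lap_radial y1 y2 x = D x + (1 + damping \<mu> \<beta> x) * ?Q x"
      using s \<zeta>'(5)[OF s] by (simp add: lap_radial_def y1_def y2_def D_def \<zeta>_eq_1)
    then show ?thesis unfolding yQ[OF that] by (simp add: a_def a1_def a2_def algebra_simps)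
  qed
  define K where "K = 2 powr q * ((C1 * B / R) powr q * (Cp * R powr c) + R powr (c - q))"
  have bound: "(LINT x|lebesgue. u t x * ?X t x) \<le> l powr p * ?N t + l powr (- q) * K"
    if t: "t \<in> {0..R}" and us: "AE x in lebesgue. t + 1 < norm x \<longrightarrow> u t x = 0"
      and int: "integrable lebesgue (\<lambda>x. \<bar>u t x\<bar> powr p * (\<eta> (t / R) * \<zeta> (x \<bullet> x)))" for t
  proof -
    \<comment> \<open>Marks the times at which derivatives of the cutoff may be nonzero. Before R/2
      only the residual contributes, and \<open>prof\<close> speaks about later times only.\<close>
    define i where "i = (if R / 2 \<le> t then 1 else 0 :: real)"
    obtain h0 :: "'a \<Rightarrow> real" where h0: "integrable lebesgue h0" "\<And>x. 0 \<le> h0 x"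
      "\<And>x. norm x \<le> t + 1 \<Longrightarrow> i * (exp (- t) * (exp (norm x) * (1 + norm x) powr (- m))) powr q \<le> h0 x"
      "(LINT x|lebesgue. h0 x) \<le> Cp * R powr c"
    proof (cases "R / 2 \<le> t")
      case True
      then have i: "i = 1" by (simp add: i_def)
      obtain h :: "'a \<Rightarrow> real" where "integrable lebesgue h" "\<forall>x. 0 \<le> h x"
        "\<forall>x. norm x \<le> t + 1 \<longrightarrow> (exp (- t) * (exp (norm x) * (1 + norm x) powr (- m))) powr q \<le> h x"
        "(LINT x|lebesgue. h x) \<le> Cp * R powr c"
        using prof[OF True] t by auto
      then show ?thesis using that[of h] i by simp
    next
      case False
      then show ?thesis using that[of "\<lambda>_. 0"] Cp by (simp add: i_def)
    qed
    define h where "h x = 2 powr q * ((C1 * B / R) powr q * h0 x + \<kappa> powr q * indicator (cball 0 (R + 1)) x)" for x :: 'a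
    have ind: "integrable lebesgue (indicator (cball (0::'a) (R + 1)) :: 'a \<Rightarrow> real)"
      by (intro integrable_real_indicator) (use lmeasurable_cball[of "0::'a" "R + 1"] in \<open>auto simp: fmeasurable_def\<close>)
    have h_int: "integrable lebesgue h" unfolding h_def[abs_def] using h0(1) ind by simp
    have "(LINT x|lebesgue. h x) = 2 powr q * ((C1 * B / R) powr q * (LINT x|lebesgue. h0 x) + \<kappa> powr q * W0)"
      unfolding h_def W0_def using h0(1) ind by simp
    also have "\<dots> \<le> K" unfolding K_def \<kappa>(2) using h0(4) by (intro mult_left_mono add_right_mono) auto
    finally have hK: "(LINT x|lebesgue. h x) \<le> K" .
    have "(LINT x|lebesgue. u t x * ?X t x) \<le> l powr p * ?N t + l powr (- q) * (LINT x|lebesgue. h x)"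
    proof (rule slice_estimate[OF p q_def l _ us int W(5)[OF t] h_int \<zeta>_nonneg, where M = "\<lambda>x. i * (exp (- t) * (C1 / R) * ?Q x) + \<kappa>"])
      show "0 \<le> \<eta> (t / R)" by (rule \<eta>_range)
      fix x :: 'a
      show "0 \<le> h x" unfolding h_def using h0(2) by simp
      assume xt: "norm x \<le> t + 1"
      then have x: "norm x \<le> R + 1" using t by simp
      show "\<zeta> (x \<bullet> x) = 1" using sq_less_half[OF x] by (simp add: \<zeta>_eq_1)
      let ?E = "\<eta> (t / R) powr (1 / p)" and ?V = "damping \<mu> \<beta> x"
      have V: "0 \<le> ?V" "?V \<le> \<mu>" using damping_bounds[OF \<beta> \<mu>] by blast+
      have Q0: "0 \<le> ?Q x" using Qx(1)[OF x] by simp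
      have i0: "0 \<le> i" by (simp add: i_def)
      have M1: "0 \<le> exp (- t) * (C1 / R) * ?Q x" using C1 R1 Q0 by simp
      have E0: "0 \<le> ?E" by simp
      \<comment> \<open>The residual comes with \<eta> itself; since \<eta> lies between 0 and 1, it
        too is dominated by the power 1/p that Young's inequality requires.\<close>
      have "\<eta> (t / R) powr 1 \<le> ?E" using p \<eta>_range[of "t / R"] by (intro powr_mono') auto
      then have \<eta>E: "\<eta> (t / R) \<le> ?E" using \<eta>_range(1)[of "t / R"] by simp
      have RR: "1 / R\<^sup>2 \<le> 1 / R" using R1 by (simp add: power2_eq_square field_simps)
      have e2: "\<bar>\<eta>2 (t / R) / R\<^sup>2\<bar> \<le> i * (C0 * ?E / R)"
      proof (cases "R / 2 \<le> t")
        case True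
        have "\<bar>\<eta>2 (t / R) / R\<^sup>2\<bar> = \<bar>\<eta>2 (t / R)\<bar> * (1 / R\<^sup>2)" by (simp add: abs_divide)
        also have "\<dots> \<le> (C0 * ?E) * (1 / R)" using RR C0 E0 \<eta>_bound(2)[of "t / R"] by (intro mult_mono) auto
        finally show ?thesis using True by (simp add: i_def)
      next
        case False
        then show ?thesis using \<eta>_left[of "t / R"] R1 by (simp add: i_def field_simps)
      qed
      have e1: "\<bar>\<eta>1 (t / R) / R\<bar> \<le> i * (C0 * ?E / R)"
      proof (cases "R / 2 \<le> t")
        case True
        then show ?thesis using R1 \<eta>_bound(1)[of "t / R"] by (simp add: i_def abs_divide divide_right_mono)
      next
        case False
        then show ?thesis using \<eta>_left[of "t / R"] R1 by (simp add: i_def field_simps)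
      qed
      define G where "G = i * (C0 * ?E / R)"
      have G0: "0 \<le> G" unfolding G_def using i0 C0 E0 R1 by simp
      have "\<bar>\<eta>2 (t / R) / R\<^sup>2 - (2 + ?V) * (\<eta>1 (t / R) / R)\<bar> \<le> \<bar>\<eta>2 (t / R) / R\<^sup>2\<bar> + (2 + ?V) * \<bar>\<eta>1 (t / R) / R\<bar>"
        using abs_triangle_ineq4[of "\<eta>2 (t / R) / R\<^sup>2" "(2 + ?V) * (\<eta>1 (t / R) / R)"] V(1) by (simp only: abs_mult)
      also have "\<dots> \<le> G + (2 + \<mu>) * G" unfolding G_def
        using e1 e2 V \<mu> by (intro add_mono mult_mono) auto
      also have "\<dots> = i * (C1 / R) * ?E" unfolding G_def C1_def using R1 by (simp add: field_simps)
      finally have key: "\<bar>\<eta>2 (t / R) / R\<^sup>2 - (2 + ?V) * (\<eta>1 (t / R) / R)\<bar> \<le> i * (C1 / R) * ?E" .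
      have "\<bar>?X t x\<bar> = exp (- t) * \<bar>(\<eta>2 (t / R) / R\<^sup>2 - (2 + ?V) * (\<eta>1 (t / R) / R)) * ?Q x - \<eta> (t / R) * D x\<bar>"
        unfolding X_eq[OF x] abs_mult[of "exp _"] by simp
      also have "\<dots> \<le> exp (- t) * (\<bar>\<eta>2 (t / R) / R\<^sup>2 - (2 + ?V) * (\<eta>1 (t / R) / R)\<bar> * ?Q x + \<eta> (t / R) * \<bar>D x\<bar>)"
        using abs_triangle_ineq4[of "(\<eta>2 (t / R) / R\<^sup>2 - (2 + ?V) * (\<eta>1 (t / R) / R)) * ?Q x" "\<eta> (t / R) * D x"] Q0 \<eta>_range(1)
        by (intro mult_left_mono) (simp_all only: abs_mult abs_of_nonneg exp_ge_zero)
      also have "\<dots> \<le> exp (- t) * ((i * (C1 / R) * ?E) * ?Q x + ?E * \<kappa>)"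
        using key \<eta>E Qx(3)[OF x] Q0 E0 by (intro mult_left_mono add_mono mult_right_mono mult_mono) auto
      also have "\<dots> = i * (exp (- t) * (C1 / R) * ?Q x) * ?E + exp (- t) * (?E * \<kappa>)" by (simp add: algebra_simps)
      also have "\<dots> \<le> i * (exp (- t) * (C1 / R) * ?Q x) * ?E + 1 * (?E * \<kappa>)"
        using t \<kappa>(1) E0 by (intro add_left_mono mult_right_mono) auto
      also have "\<dots> = (i * (exp (- t) * (C1 / R) * ?Q x) + \<kappa>) * ?E" by (simp add: algebra_simps)
      finally show "0 \<le> i * (exp (- t) * (C1 / R) * ?Q x) + \<kappa> \<and>
          \<bar>?X t x\<bar> \<le> (i * (exp (- t) * (C1 / R) * ?Q x) + \<kappa>) * ?E"
        using mult_nonneg_nonneg[OF i0 M1] \<kappa>(1) by linarith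
      have "(i * (exp (- t) * (C1 / R) * ?Q x) + \<kappa>) powr q
         \<le> 2 powr q * ((i * (exp (- t) * (C1 / R) * ?Q x)) powr q + \<kappa> powr q)"
        using mult_nonneg_nonneg[OF i0 M1] \<kappa>(1) q1 by (intro add_powr_le) linarith+
      also have "\<dots> \<le> 2 powr q * ((C1 * B / R) powr q * h0 x + \<kappa> powr q)"
      proof (intro mult_left_mono add_right_mono)
        let ?P = "exp (- t) * (exp (norm x) * (1 + norm x) powr (- m))"
        have "exp (- t) * (C1 / R) * ?Q x \<le> exp (- t) * (C1 / R) * (B * (exp (norm x) * (1 + norm x) powr (- m)))"
          using C1 R1 Qx(2)[OF x] by (intro mult_left_mono) auto
        also have "\<dots> = C1 * B / R * ?P" by simp
        finally have "(i * (exp (- t) * (C1 / R) * ?Q x)) powr q \<le> (i * (C1 * B / R * ?P)) powr q"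
          using mult_nonneg_nonneg[OF i0 M1] i0 q1 by (intro powr_mono2 mult_left_mono) auto
        also have "\<dots> = i * (C1 * B / R * ?P) powr q"
          using q1 by (simp add: i_def)
        also have "\<dots> = i * ((C1 * B / R) powr q * ?P powr q)"
          by (simp only: powr_mult[of "C1 * B / R"])
        also have "\<dots> = (C1 * B / R) powr q * (i * ?P powr q)" by (rule mult.left_commute)
        also have "\<dots> \<le> (C1 * B / R) powr q * h0 x" using h0(3)[OF xt] by (intro mult_left_mono) auto
        finally show "(i * (exp (- t) * (C1 / R) * ?Q x)) powr q \<le> (C1 * B / R) powr q * h0 x" .
      qed auto
      also have "\<dots> = h x" unfolding h_def using x by simp
      finally show "(i * (exp (- t) * (C1 / R) * ?Q x) + \<kappa>) powr q \<le> h x" .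
    qed
    also have "\<dots> \<le> l powr p * ?N t + l powr (- q) * K" using hK by (simp add: mult_left_mono)
    finally show ?thesis .
  qed
  have up: "(LINT t:{0..R}|lebesgue. (LINT x|lebesgue. u t x * ?X t x)) \<le> l powr p * J + l powr (- q) * K * R"
    unfolding J_def
    by (rule set_integral_mono_affine[OF R0 W(3) JI(2)])
      (use u_slice JI(1) in \<open>eventually_elim, use bound in blast\<close>)
  \<comment> \<open>The exponential makes \<open>a1 0\<close> negative, so the boundary term with f
    enters the left side with a nonnegative sign.\<close>
  have a0: "a 0 = 1" "a1 0 = - 1" using \<eta>_left[of 0] by (auto simp: a_def a1_def)
  have y0: "1 \<le> y (x \<bullet> x)" if "norm x \<le> R + 1" for x :: 'a using yQ[OF that] Qx(1)[OF that] by simp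
  have sq: "S < x \<bullet> x" if "x \<notin> cball 0 (sqrt S)" for x :: 'a
    using that S_pos by (simp add: norm_eq_sqrt_inner)
  have yL: "(\<lambda>x::'a. y (x \<bullet> x)) \<in> L2"
  proof (rule continuous_compact_support_L2[OF _ compact_cball[of 0 "sqrt S"]])
    show "continuous_on UNIV (\<lambda>x::'a. y (x \<bullet> x))"
      by (rule continuous_on_compose2[OF y(1)[of 0, unfolded Ck_on.simps]]) (auto intro!: continuous_intros)
  qed (use sq y(6) in \<open>auto simp: less_imp_le\<close>)
  \<comment> \<open>The data term is bounded below by a quantity free of R and Q: on the unit ball,
    which carries g, the test function is at least 1 and \<open>step\<close> at most 1.\<close>
  have "(LINT x|lebesgue. g x * step (x \<bullet> x / 2)) \<le> (LINT x|lebesgue. g x * (a 0 * y (x \<bullet> x)))"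
  proof (rule integral_mono_AE)
    show "integrable lebesgue (\<lambda>x. g x * step (x \<bullet> x / 2))" by (rule L2_mult_integrable[OF fg_L2(2) step_sq_L2])
    show "integrable lebesgue (\<lambda>x. g x * (a 0 * y (x \<bullet> x)))"
      unfolding a0 using L2_mult_integrable[OF fg_L2(2) yL] by simp
    show "AE x in lebesgue. g x * step (x \<bullet> x / 2) \<le> g x * (a 0 * y (x \<bullet> x))"
      using fg_supp(2) g_nonneg
    proof eventually_elim
      case (elim x)
      show ?case
      proof (cases "norm x \<le> 1")
        case True
        then have "step (x \<bullet> x / 2) \<le> a 0 * y (x \<bullet> x)"
          using y0[of x] step_le_1[of "x \<bullet> x / 2"] R1 by (simp add: a0)
        then show ?thesis using elim(2) by (rule mult_left_mono)
      qed (use elim(1) in simp)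
    qed
  qed
  then have "\<epsilon> * (LINT x|lebesgue. g x * step (x \<bullet> x / 2)) \<le> \<epsilon> * (LINT x|lebesgue. g x * (a 0 * y (x \<bullet> x)))"
    using \<epsilon> by simp
  moreover have "0 \<le> \<epsilon> * (LINT x|lebesgue. damping \<mu> \<beta> x * f x * (a 0 * y (x \<bullet> x)))"
  proof (intro mult_nonneg_nonneg integral_nonneg_AE)
    show "AE x in lebesgue. 0 \<le> damping \<mu> \<beta> x * f x * (a 0 * y (x \<bullet> x))"
      using fg_supp(1) f_nonneg
    proof eventually_elim
      case (elim x)
      then show ?case using y0[of x] R1 damping_bounds(1)[OF \<beta> \<mu>, of x]
        by (cases "norm x \<le> 1") (auto simp: a0)
    qed
  qed (use \<epsilon> in simp)
  moreover have "0 \<le> \<epsilon> * (LINT x|lebesgue. f x * y (x \<bullet> x))"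
  proof (intro mult_nonneg_nonneg integral_nonneg_AE)
    show "AE x in lebesgue. 0 \<le> f x * y (x \<bullet> x)"
      using fg_supp(1) f_nonneg
    proof eventually_elim
      case (elim x)
      then show ?case using y0[of x] R1 by (cases "norm x \<le> 1") auto
    qed
  qed (use \<epsilon> in simp)
  \<comment> \<open>Q is known to be positive only for |x| \<le> R+1. The sign of the nonlinear term
    therefore rests on the support of u, slice by slice.\<close>
  moreover have "0 \<le> (LINT t:{0..R}|lebesgue. (LINT x|lebesgue. \<bar>u t x\<bar> powr p * (a t * y (x \<bullet> x))))"
    unfolding set_lebesgue_integral_def
  proof (rule integral_nonneg_AE)
    show "AE t in lebesgue. 0 \<le> indicator {0..R} t *\<^sub>R (LINT x|lebesgue. \<bar>u t x\<bar> powr p * (a t * y (x \<bullet> x)))"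
      using u_slice
    proof eventually_elim
      case (elim t)
      have "0 \<le> (LINT x|lebesgue. \<bar>u t x\<bar> powr p * (a t * y (x \<bullet> x)))" if t: "t \<in> {0..R}"
      proof (rule integral_nonneg_AE)
        have "AE x in lebesgue. t + 1 < norm x \<longrightarrow> u t x = 0" using elim t by blast
        then show "AE x in lebesgue. 0 \<le> \<bar>u t x\<bar> powr p * (a t * y (x \<bullet> x))"
        proof eventually_elim
          case (elim x)
          show ?case
          proof (cases "norm x \<le> t + 1")
            case True
            then have "0 \<le> y (x \<bullet> x)" using y0[of x] t by simp
            then show ?thesis using \<eta>_range(1)[of "t / R"] by (simp add: a_def)
          qed (use elim p in simp)
        qed
      qed
      then show ?case by (auto simp: indicator_def)
    qed
  qed
  ultimately have "\<epsilon> * (LINT x|lebesgue. g x * step (x \<bullet> x / 2)) \<le> l powr p * J + l powr (- q) * K * R"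
    using up W(4) unfolding a0(2) by linarith
  also have "K * R = 2 powr q * ((C1 * B) powr q * Cp + 1) * R powr (1 + c - q)"
    using R1 C1 B by (simp add: K_def powr_divide powr_diff powr_add field_simps)
  then have "l powr (- q) * K * R = l powr (- q) * (2 powr q * ((C1 * B) powr q * Cp + 1) * R powr (1 + c - q))"
    by simp
  finally show ?thesis by (simp add: C1_def)
qed

end

section \<open>Exponents\<close>

text \<open>With a = n - 1 and s the root of the discriminant, 4a times the polynomial factors into
  s - (2ap - a - 2) and s + (2ap - a - 2). The first factor is positive below the positive root, the
  second for p > 0.\<close>

lemma strauss_poly_pos:
  assumes n: "2 \<le> n" and p: "0 < p" "p < strauss_exponent n"
  shows "0 < strauss_poly p n"
proof -
  define a where "a = real n - 1"
  define s where "s = sqrt ((real n)\<^sup>2 + 10 * real n - 7)"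
  have a: "1 \<le> a" using n by (simp add: a_def)
  have disc: "(real n)\<^sup>2 + 10 * real n - 7 = (a + 2)\<^sup>2 + 8 * a"
    by (simp add: a_def power2_eq_square algebra_simps)
  have s2: "s\<^sup>2 = (a + 2)\<^sup>2 + 8 * a" and "0 \<le> s"
    using a unfolding s_def disc by simp_all
  have s_gt: "a + 2 < s"
    by (rule power2_less_imp_less) (use s2 a \<open>0 \<le> s\<close> in auto)
  have "strauss_exponent n = (a + 2 + s) / (2 * a)"
    unfolding strauss_exponent_eq[OF n] by (simp add: a_def s_def)
  then have "p < (a + 2 + s) / (2 * a)" using p(2) by simp
  then have "2 * a * p < a + 2 + s" using a by (simp add: pos_less_divide_eq mult.commute)
  moreover have "0 < 2 * a * p" using a p by simp
  ultimately have "0 < (s - (2 * a * p - (a + 2))) * (s + (2 * a * p - (a + 2)))"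
    using s_gt by (intro mult_pos_pos) linarith+
  also have "\<dots> = s\<^sup>2 - (2 * a * p - (a + 2))\<^sup>2"
    by (simp add: power2_eq_square algebra_simps)
  also have "\<dots> = 4 * a * strauss_poly p n"
    unfolding s2 strauss_poly_def by (simp add: a_def power2_eq_square algebra_simps)
  finally show ?thesis using a by (simp add: zero_less_mult_iff)
qed

text \<open>The choice \<open>\<lambda> = R\<^sup>e\<close> balances the two terms of the second test function estimate.\<close>

lemma balanced_exponents:
  fixes n p :: real
  assumes n: "2 \<le> n" and p: "1 < p" and q: "q = p / (p - 1)"
  defines "c \<equiv> (n - 1) * (1 - q / 2)" and "s \<equiv> (if q < n then q else 1)"
  defines "e \<equiv> (c - n + s) / (p + q)"
    and "E \<equiv> (if p \<le> n / (n - 1) then - ((n + 1 - (n - 1) * p) / (2 * (p - 1)))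
            else - ((2 + (n + 1) * p - (n - 1) * p\<^sup>2) / (2 * p * (p - 1))))"
  shows "p * e + (1 - q) + (n - s) = E" "- q * e + (1 + c - q) = E"
proof -
  define d where "d = p - 1"
  have d: "0 < d" and p_eq: "p = 1 + d" using p by (auto simp: d_def)
  have qd: "q = (1 + d) / d" using q by (simp add: p_eq)
  have q0: "0 < q" using d by (simp add: qd)
  \<comment> \<open>Conjugacy of p and q, which cancels q from the denominator of
    \<open>q * e\<close>.\<close>
  have pq: "p + q = p * q" using d unfolding qd p_eq by (simp add: field_simps)
  have same: "p * e + (1 - q) + (n - s) = - q * e + (1 + c - q)"
  proof -
    have "(p + q) * e = c - n + s" using p q0 by (simp add: e_def)
    then show ?thesis by (simp add: algebra_simps)
  qed
  \<comment> \<open>Translates the case distinction of the spatial integral, in terms of q, into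
    that of the theorem, in terms of p.\<close>
  have case_iff: "q < n \<longleftrightarrow> \<not> p \<le> n / (n - 1)"
  proof -
    have "q < n \<longleftrightarrow> p < n * (p - 1)" using p by (simp add: q divide_less_eq)
    also have "\<dots> \<longleftrightarrow> n < p * (n - 1)" by (simp add: algebra_simps)
    also have "\<dots> \<longleftrightarrow> n / (n - 1) < p" using n by (simp add: divide_less_eq)
    finally show ?thesis by (simp only: not_le)
  qed
  have "q * e = (c - n + s) / p" unfolding e_def pq using p q0 by simp
  then have "- q * e + (1 + c - q) = - ((c - n + s) / p) + (1 + c - q)" by simp
  also have "\<dots> = E"
  proof -
    have qd': "q * d = p" using d by (simp add: qd p_eq)
    have cd: "2 * (c * d) = (n - 1) * (2 * d - p)"
      unfolding c_def qd'[symmetric] by (simp add: field_simps)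
    have "(- ((c - n + s) / p) + (1 + c - q)) * (2 * p * d)
        = - (2 * (c * d)) + 2 * n * d - 2 * (s * d) + 2 * p * d + p * (2 * (c * d)) - 2 * p * (q * d)"
      using p by (simp add: field_simps)
    also have "\<dots> = E * (2 * p * d)"
    proof (cases "q < n")
      case True
      then have sd: "s * d = p" and E': "E = - ((2 + (n + 1) * p - (n - 1) * p\<^sup>2) / (2 * p * d))"
        using case_iff qd' by (auto simp: s_def E_def d_def)
      have Ed: "E * (2 * p * d) = - (2 + (n + 1) * p - (n - 1) * p\<^sup>2)" unfolding E' using d p by simp
      show ?thesis unfolding cd qd' sd Ed by (simp add: d_def power2_eq_square algebra_simps)
    next
      case False
      then have sd: "s * d = d" and E': "E = - ((n + 1 - (n - 1) * p) / (2 * d))"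
        using case_iff by (auto simp: s_def E_def d_def)
      have Ed: "E * (2 * p * d) = - (p * (n + 1 - (n - 1) * p))" unfolding E' using d p by simp
      show ?thesis unfolding cd qd' sd Ed by (simp add: d_def algebra_simps)
    qed
    finally show ?thesis using d p by simp
  qed
  finally show "- q * e + (1 + c - q) = E" .
  then show "p * e + (1 - q) + (n - s) = E" using same by simp
qed

lemma lifespan_from_decay:
  fixes R \<theta> c0 C \<epsilon> :: real
  assumes "0 < \<theta>" "0 < c0" "0 < C" "0 < \<epsilon>" "0 < R"
    and le: "\<epsilon> * c0 \<le> C * R powr (- (1 / \<theta>))"
  shows "R \<le> (C / c0) powr \<theta> * \<epsilon> powr (- \<theta>)"
proof -
  have "\<epsilon> * c0 * R powr (1 / \<theta>) \<le> C * R powr (- (1 / \<theta>)) * R powr (1 / \<theta>)"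
    using le by (intro mult_right_mono) auto
  also have "\<dots> = C" using assms(5) by (simp add: powr_minus)
  finally have "R powr (1 / \<theta>) \<le> C / c0 * (1 / \<epsilon>)"
    using assms by (simp add: field_simps)
  then have "(R powr (1 / \<theta>)) powr \<theta> \<le> (C / c0 * (1 / \<epsilon>)) powr \<theta>"
    using assms by (intro powr_mono2) auto
  also have "\<dots> = (C / c0) powr \<theta> * (1 / \<epsilon>) powr \<theta>" by (rule powr_mult)
  also have "(1 / \<epsilon>) powr \<theta> = \<epsilon> powr (- \<theta>)" using assms by (simp add: powr_divide powr_minus_divide)
  finally show ?thesis using assms by (simp add: powr_powr)
qed

section \<open>The lifespan bound\<close>

theorem theorem2p1:
  fixes f g :: "real ^ 'n \<Rightarrow> real" and \<mu> \<beta> p :: real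
  assumes "2 \<le> CARD('n)"
    and "0 < \<mu>" and "2 < \<beta>"
    and "1 < p" and "p < strauss_exponent CARD('n)"
    and "f \<in> H1" and "g \<in> L2"
    and "AE x in lebesgue. 0 \<le> f x" and "AE x in lebesgue. 0 \<le> g x"
    and "\<not> (AE x in lebesgue. f x = 0)" and "\<not> (AE x in lebesgue. g x = 0)"
    and "support_in UNIV f \<subseteq> {x. norm x \<le> 1}" and "support_in UNIV g \<subseteq> {x. norm x \<le> 1}"
  shows "\<exists>\<epsilon>\<^sub>0>0. \<exists>C>0. \<forall>\<epsilon>. 0 < \<epsilon> \<and> \<epsilon> \<le> \<epsilon>\<^sub>0 \<longrightarrow>
    (\<forall>(T::ereal) u. 0 < T \<longrightarrow> energy_solution \<mu> \<beta> p \<epsilon> f g T u \<longrightarrow>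
      support_in (time_ivl T \<times> UNIV) (\<lambda>(t, x). u t x)
        \<subseteq> {(t, x). t \<in> time_ivl T \<and> norm x \<le> t + 1} \<longrightarrow>
      T \<le> ereal
        (if p \<le> real CARD('n) / (real CARD('n) - 1)
         then C * \<epsilon> powr (- (2 * (p - 1) / (real CARD('n) + 1 - (real CARD('n) - 1) * p)))
         else C * \<epsilon> powr (- (2 * p * (p - 1) / strauss_poly p CARD('n)))))"
proof -
  define n where "n = real CARD('n)"
  have n: "2 \<le> n" using assms(1) by (simp add: n_def)
  have dim: "DIM(real ^ 'n) = CARD('n)" by simp
  define q where "q = p / (p - 1)"
  have q1: "1 < q" using assms(4) by (simp add: q_def)
  define c where "c = (n - 1) * (1 - q / 2)"
  define s where "s = (if q < n then q else 1)"
  define e where "e = (c - n + s) / (p + q)"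
  define \<theta> where "\<theta> = (if p \<le> n / (n - 1) then 2 * (p - 1) / (n + 1 - (n - 1) * p)
      else 2 * p * (p - 1) / strauss_poly p CARD('n))"
  have \<theta>: "0 < \<theta>"
  proof (cases "p \<le> n / (n - 1)")
    case True
    then have "(n - 1) * p \<le> n" using n by (simp add: field_simps)
    then have "0 < n + 1 - (n - 1) * p" by linarith
    then show ?thesis using True assms(4) by (simp add: \<theta>_def)
  next
    case False
    have "0 < strauss_poly p CARD('n)" using assms by (intro strauss_poly_pos) auto
    then show ?thesis using False assms(4) by (simp add: \<theta>_def)
  qed
  have E: "p * e + (1 - q) + (n - s) = - (1 / \<theta>)" "- q * e + (1 + c - q) = - (1 / \<theta>)"
    using balanced_exponents[OF n assms(4) q_def]
    by (simp_all add: e_def c_def s_def \<theta>_def strauss_poly_def n_def)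
  obtain \<eta> \<eta>1 \<eta>2 C0 where cut: "cutoff_setup p q C0 \<eta> \<eta>1 \<eta>2"
  proof (rule cutoff[OF assms(4)], goal_cases)
    case (1 \<eta> \<eta>1 \<eta>2 C)
    show ?case
      by (rule that[of C \<eta> \<eta>1 \<eta>2], rule cutoff_setup.intro) (rule 1 assms(4) q_def | assumption)+
  qed
  have C0: "0 < C0" using cut by (simp add: cutoff_setup_def)
  have V: "0 \<le> damping \<mu> \<beta> x \<and> damping \<mu> \<beta> x \<le> \<mu> / (1 + norm x)\<^sup>2" for x :: "real ^ 'n"
    using damping_bounds[OF assms(3,2)] by blast
  obtain Cv where Cv: "0 \<le> Cv" "\<And>R. 1 \<le> R \<Longrightarrow> \<exists>h :: real ^ 'n \<Rightarrow> real. integrable lebesgue h \<and> (\<forall>x. 0 \<le> h x) \<and>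
    (\<forall>x. norm x \<le> R + 1 \<longrightarrow> (1 / R + damping \<mu> \<beta> x) powr q \<le> h x) \<and>
    (LINT x|lebesgue. h x) \<le> Cv * R powr (n - s)"
    using ball_integral_potential[of q "damping \<mu> \<beta> :: real ^ 'n \<Rightarrow> real" \<mu>] assms(1,2) q1 V
    unfolding dim n_def s_def by (metis less_imp_le)
  have "continuous_on {0..} (\<lambda>r. \<mu> / (1 + r) powr \<beta>)" by (intro continuous_intros) auto
  moreover have "0 \<le> \<mu> / (1 + r) powr \<beta> \<and> \<mu> / (1 + r) powr \<beta> \<le> \<mu> / (1 + r)\<^sup>2" if "0 \<le> r" for r
    using damping_bounds[OF assms(3,2), of r] that by (simp add: damping_def)
  ultimately obtain B where B: "0 < B" "\<And>L \<kappa>. 0 \<le> L \<Longrightarrow> 0 < \<kappa> \<Longrightarrow>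
    \<exists>Q::real poly. \<forall>r. 0 \<le> r \<and> r \<le> L \<longrightarrow> 1 \<le> poly Q (r\<^sup>2)
      \<and> poly Q (r\<^sup>2) \<le> B * (exp r * (1 + r) powr (- ((real CARD('n) - 1) / 2)))
      \<and> \<bar>4 * r\<^sup>2 * poly (pderiv (pderiv Q)) (r\<^sup>2) + 2 * real CARD('n) * poly (pderiv Q) (r\<^sup>2)
          - (1 + \<mu> / (1 + r) powr \<beta>) * poly Q (r\<^sup>2)\<bar> \<le> \<kappa>"
    using radial_test_function[OF assms(1), of "\<lambda>r. \<mu> / (1 + r) powr \<beta>" \<mu>] assms(2)
    by (metis less_imp_le)
  obtain Cp where Cp: "0 \<le> Cp" "\<And>R t. 1 \<le> R \<Longrightarrow> R / 2 \<le> t \<Longrightarrow> t \<le> R \<Longrightarrow>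
    \<exists>h :: real ^ 'n \<Rightarrow> real. integrable lebesgue h \<and> (\<forall>x. 0 \<le> h x) \<and>
    (\<forall>x. norm x \<le> t + 1 \<longrightarrow> (exp (- t) * (exp (norm x) * (1 + norm x) powr (- ((real CARD('n) - 1) / 2)))) powr q \<le> h x) \<and>
    (LINT x|lebesgue. h x) \<le> Cp * R powr c"
    using ball_integral_profile[OF q1, where 'a = "real ^ 'n"] unfolding dim n_def c_def by metis
  have f_L2: "f \<in> L2" using assms(6) by (simp add: H1_def)
  have fg_supp: "AE x in lebesgue. 1 < norm x \<longrightarrow> f x = 0" "AE x in lebesgue. 1 < norm x \<longrightarrow> g x = 0"
  proof -
    show "AE x in lebesgue. 1 < norm x \<longrightarrow> f x = 0"
      using AE_zero_off_support[of UNIV f] by eventually_elim (use assms(12) in force)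
    show "AE x in lebesgue. 1 < norm x \<longrightarrow> g x = 0"
      using AE_zero_off_support[of UNIV g] by eventually_elim (use assms(13) in force)
  qed
  define c0 where "c0 = (LINT x|lebesgue. g x * step (x \<bullet> x / 2))"
  \<comment> \<open>The weight is 1 on the unit ball and g vanishes outside it, so c0 = 0 would
    force the nonnegative function g to vanish almost everywhere.\<close>
  have c0: "0 < c0"
  proof -

    have int: "integrable lebesgue (\<lambda>x. g x * step (x \<bullet> x / 2))"
      by (rule L2_mult_integrable[OF assms(7) step_sq_L2])
    have nn: "AE x in lebesgue. 0 \<le> g x * step (x \<bullet> x / 2)"
      using assms(9) by eventually_elim (simp add: step_nonneg)
    have "c0 \<noteq> 0"
    proof
      assume "c0 = 0"
      then have "AE x in lebesgue. g x * step (x \<bullet> x / 2) = 0"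
        using integral_nonneg_eq_0_iff_AE[OF int nn] by (simp add: c0_def)
      then have "AE x in lebesgue. g x = 0" using fg_supp(2)
      proof eventually_elim
        case (elim x)
        show ?case
        proof (cases "norm x \<le> 1")
          case True
          then have "x \<bullet> x \<le> 1" by (simp add: norm_le_square)
          then have "step (x \<bullet> x / 2) = 1" by (intro step_eq_1) simp
          then show ?thesis using elim(1) by simp
        qed (use elim(2) in simp)
      qed
      then show False using assms(11) by blast
    qed
    moreover have "0 \<le> c0" unfolding c0_def by (rule integral_nonneg_AE[OF nn])
    ultimately show ?thesis by simp
  qed
  define A1 where "A1 = 2 * 2 powr (q / p) * C0 powr q * Cv"
  define A2 where "A2 = 2 powr q * ((C0 * (3 + \<mu>) * B) powr q * Cp + 1)"
  have A: "0 \<le> A1" "0 < A2" using Cv(1) Cp(1) by (auto simp: A1_def A2_def add_nonneg_pos)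
  have main: "R \<le> ((A1 + A2) / c0) powr \<theta> * \<epsilon> powr (- \<theta>)"
    if "0 < \<epsilon>" "energy_solution \<mu> \<beta> p \<epsilon> f g T u"
      "support_in (time_ivl T \<times> UNIV) (\<lambda>(t, x). u t x) \<subseteq> {(t, x). t \<in> time_ivl T \<and> norm x \<le> t + 1}"
      "1 \<le> R" "ereal R < T" for \<epsilon> T u R
  proof -
    interpret damped_solution p q C0 \<eta> \<eta>1 \<eta>2 \<mu> \<beta> \<epsilon> f g T u R
      by (intro damped_solution.intro cut damped_solution_axioms.intro)
        (use assms that f_L2 in simp_all)
    \<comment> \<open>The weight \<lambda> of the data estimate is R^e, for which both resulting
      powers of R equal R^(-1/\<theta>) by \<open>E\<close>.\<close>
    have l: "0 < R powr e" using that(4) by simp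
    have "\<epsilon> * c0 \<le> (R powr e) powr p * J + (R powr e) powr (- q) * (A2 * R powr (1 + c - q))"
      unfolding c0_def A2_def c_def n_def
      using data_estimate[unfolded dim, OF B(2) B(1) Cp(1) Cp(2)[unfolded c_def n_def]
          J_integrable[OF Cv(2)] fg_supp l] that(4) by simp
    also have "\<dots> \<le> (R powr e) powr p * (A1 * R powr (1 - q) * R powr (n - s))
        + (R powr e) powr (- q) * (A2 * R powr (1 + c - q))"
      using J_bound[OF Cv(2)[OF that(4)]] by (intro add_right_mono mult_left_mono) (simp_all add: A1_def mult_ac)
    also have "\<dots> = A1 * R powr (p * e + (1 - q) + (n - s)) + A2 * R powr (- q * e + (1 + c - q))"
    proof -
      have "(R powr e) powr p * R powr (1 - q) * R powr (n - s) = R powr (p * e + (1 - q) + (n - s))"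
        "(R powr e) powr (- q) * R powr (1 + c - q) = R powr (- q * e + (1 + c - q))"
        unfolding powr_powr powr_add[symmetric] by (simp_all add: mult.commute)
      from this[symmetric] show ?thesis by (simp only: mult_ac)
    qed
    also have "\<dots> = (A1 + A2) * R powr (- (1 / \<theta>))" unfolding E by (simp add: algebra_simps)
    finally show ?thesis
      using \<theta> c0 A that by (intro lifespan_from_decay) auto
  qed
  \<comment> \<open>The maximum with 1, together with \<epsilon> \<le> 1, makes the claimed bound at
    least 1, so every R beyond it satisfies the condition 1 \<le> R of \<open>main\<close>.\<close>
  define C where "C = max 1 (((A1 + A2) / c0) powr \<theta>)"
  have lifespan: "T \<le> ereal (C * \<epsilon> powr (- \<theta>))"
    if \<epsilon>: "0 < \<epsilon>" "\<epsilon> \<le> 1" and "energy_solution \<mu> \<beta> p \<epsilon> f g T u"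
      "support_in (time_ivl T \<times> UNIV) (\<lambda>(t, x). u t x) \<subseteq> {(t, x). t \<in> time_ivl T \<and> norm x \<le> t + 1}" for \<epsilon> T u
  proof (rule ccontr)
    assume "\<not> ?thesis"
    then have "ereal (C * \<epsilon> powr (- \<theta>)) < T" by (simp only: not_le)
    \<comment> \<open>T may be infinite, so the contradiction uses a real R strictly between the
      claimed bound and T.\<close>
    then obtain R where R: "C * \<epsilon> powr (- \<theta>) < R" "ereal R < T"
      using ereal_dense2[of "ereal (C * \<epsilon> powr (- \<theta>))" T] by auto
    have "1 \<le> \<epsilon> powr (- \<theta>)" using \<epsilon> \<theta> powr_mono'[of "- \<theta>" 0 \<epsilon>] by simp
    then have "1 * 1 \<le> C * \<epsilon> powr (- \<theta>)" by (intro mult_mono) (auto simp: C_def)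
    then have "R \<le> ((A1 + A2) / c0) powr \<theta> * \<epsilon> powr (- \<theta>)"
      using R that by (intro main[of \<epsilon> T u R]) auto
    also have "\<dots> \<le> C * \<epsilon> powr (- \<theta>)" by (intro mult_right_mono) (auto simp: C_def)
    finally show False using R(1) by simp
  qed
  show ?thesis
  proof (rule exI[of _ 1], rule conjI, rule zero_less_one, rule exI[of _ C], intro conjI allI impI)
    show "0 < C" by (simp add: C_def)
    fix \<epsilon> T u
    assume "0 < \<epsilon> \<and> \<epsilon> \<le> 1" "energy_solution \<mu> \<beta> p \<epsilon> f g T u"
      "support_in (time_ivl T \<times> UNIV) (\<lambda>(t, x). u t x) \<subseteq> {(t, x). t \<in> time_ivl T \<and> norm x \<le> t + 1}"
    then show "T \<le> ereal
        (if p \<le> real CARD('n) / (real CARD('n) - 1)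
         then C * \<epsilon> powr (- (2 * (p - 1) / (real CARD('n) + 1 - (real CARD('n) - 1) * p)))
         else C * \<epsilon> powr (- (2 * p * (p - 1) / strauss_poly p CARD('n))))"
      using lifespan[of \<epsilon> T u] by (auto simp: \<theta>_def n_def split: if_splits)
  qed
qed

end
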